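(* Let $\{(M^\theta,G^\theta):\theta\in\Theta\}$ be a parametric family of state space models with $\Theta$ a compact subset of a Euclidean space, with proposals $r_0^\theta,R^\theta$ and initial distribution $\mu$, as in the context. Assume: (A-1) for all $\theta\in\Theta$, $M^\theta$ has a unique stationary distribution $\pi^\theta$; (A-2) there exist a constant $\sigma_+\in\mathbb R^+$ and a nonnegative measure $\lambda$ on $\mathsf X$ such that $M^\theta(x,A)\le\sigma_+\lambda(A)$ for all $\theta\in\Theta$, $(x,A)\in\mathsf X\times\mathcal X$; write $m^\theta(x,x')=\frac{dM^\theta(x,\cdot)}{d\lambda}(x')$; moreover $\mu\ll\lambda$, and $\mu$, $\pi^\theta$ also denote densities with respect to $\lambda$; (A-3) $m^\theta(x,x')>0$ and $g^\theta(x,y)>0$ for all $\theta\in\Theta$, $(x,x',y)\in\mathsf X^2\times\mathsf Y$; (A-4) there exist an integer $\ell_\star\ge1$ and $\alpha\in(0,1)$ such that $$\sup_{t\in\mathbb N}\sup_{\theta\in\Theta}\mathbb E^\theta_\mu\big[(\widetilde B^\theta_{t,\ell})^\alpha\big]<\infty\ \text{ for all }\ell\in\{0,\dots,\ell_\star-1\},\qquad \sup_{t\in\mathbb N}\sup_{\theta\in\Theta}\mathbb E^\theta_\mu\big[(\widetilde C^\theta_{t,\ell_\star})^\alpha\big]<\infty .$$ Let $\theta_\star\in\Theta$ and let $\{\theta_T\}_{T\in\mathbb N}\subset\Theta$ satisfy $$\limsup_{T\to\infty}\ T\ \bar{\mathbb E}^{\theta_\star}\left[\ln\frac{m^{\theta_\star}(X_0,X_1)g^{\theta_\star}(X_1,Y_1)}{m^{\theta_T}(X_0,X_1)g^{\theta_T}(X_1,Y_1)}\right]<\infty,$$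 and assume $$\bar{\mathbb E}^{\theta_\star}\left[\ln\frac{\pi^{\theta_\star}(X_0)}{\mu(X_0)}\right]<\infty .$$ Then, for all $0<\gamma<\alpha$ and all sequences of integers $\{N_T\}_{T\ge1}$ with $N_T\ge 2$ and $N_T\sim T^{1/\gamma}$ as $T\to\infty$, the sequence $\{\epsilon_{T,N_T}^{-1}(\theta_T)\}_{T\ge1}$ is $\bar{\mathbb P}^{\theta_\star}$-tight (bounded in probability), where $$\epsilon_{T,N}(\theta)=\prod_{t=0}^T\frac{N-1}{2B^\theta_{t,T}+N-2},\qquad B^\theta_{t,T}=\sup_{0\le\ell\le T-t}\frac{|w^\theta\langle Y_t\rangle|_\infty\,|Q^\theta\langle Y_{t+1:t+\ell}\rangle\mathbf 1|_\infty}{p^\theta_\mu(Y_{t:t+\ell}\mid Y_{0:t-1})}.$$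
   Context: $(\mathsf X,\mathcal X)$, $(\mathsf Y,\mathcal Y)$ are measurable spaces. For each $\theta\in\Theta$, $M^\theta$ is a Markov kernel on $\mathsf X$ and $G^\theta$ a Markov kernel from $\mathsf X$ to $\mathsf Y$ with density $g^\theta(x,\cdot)$ with respect to a common $\sigma$-finite measure $\kappa$ on $\mathsf Y$ ($\lambda$ is also $\sigma$-finite). $\mu$ is a probability measure on $\mathsf X$. Under $\mathbb P^\theta_\mu$ (expectation $\mathbb E^\theta_\mu$), $\{(X_t,Y_t)\}_{t\in\mathbb N}$ is the hidden Markov model with $X_0\sim\mu$, $\{X_t\}$ Markov with kernel $M^\theta$, and, given $\{X_t\}$, the $Y_t$ independent with $Y_t\sim G^\theta(X_t,\cdot)$. $\bar{\mathbb P}^\theta=\mathbb P^\theta_{\pi^\theta}$, $\bar{\mathbb E}^\theta=\mathbb E^\theta_{\pi^\theta}$. $\mathbb N=\{0,1,\dots\}$. $p^\theta_\mu(y_{0:t})=\int\mu(dx_0)g^\theta(x_0,y_0)\prod_{s=1}^tM^\theta(x_{s-1},dx_s)g^\theta(x_s,y_s)$; $p^\theta_\mu(y_{s:t}\mid y_{0:s-1})=p^\theta_\mu(y_{0:t})/p^\theta_\mu(y_{0:s-1})$ (equal to $0$ if the denominator is $0$), with $p^\theta_\mu(y_{0:t}\mid y_{0:-1})=p^\theta_\mu(y_{0:t})$. $p^\theta_{\mu,s}(y_{s:t})=\int p^\theta_\mu(y_{0:t})\,\kappa^{\otimes s}(dy_{0:s-1})$ is the marginal density of $Y_{s:t}$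 under $\mathbb P^\theta_\mu$ (for $s=0$ it is $p^\theta_\mu(y_{0:t})$). $Q^\theta\langle y\rangle(x,A)=\int M^\theta(x,dx')g^\theta(x',y)1_A(x')$; $Q^\theta\langle y_{s:t}\rangle=Q^\theta\langle y_s\rangle\cdots Q^\theta\langle y_t\rangle$ (composition), and $Q^\theta\langle y_{s:t}\rangle\mathbf 1=\mathbf 1$ (constant function $1$) if $s>t$. $|f|_\infty=\sup|f|$. Proposals: for each $\theta,y$, $r_0^\theta\langle y\rangle$ is a probability measure on $\mathsf X$ with $\mu\ll r^\theta_0\langle y\rangle$ and $R^\theta\langle y\rangle$ is a Markov kernel on $\mathsf X$ with $Q^\theta\langle y\rangle(x,\cdot)\ll R^\theta\langle y\rangle(x,\cdot)$. Weight functions: $w^\theta\langle y\rangle(x,x')=\frac{dQ^\theta\langle y\rangle(x,\cdot)}{dR^\theta\langle y\rangle(x,\cdot)}(x')$ for times $t\ge1$, and at time $0$ the symbol $w^\theta\langle Y_0\rangle$ stands for $w_0^\theta\langle Y_0\rangle(x)=g^\theta(x,Y_0)\frac{d\mu}{dr_0^\theta\langle Y_0\rangle}(x)$. For $t\in\mathbb N$, $\ell\ge0$: $$\widetilde B^\theta_{t,\ell}=\frac{|w^\theta\langle Y_t\rangle|_\infty\,|Q^\theta\langle Y_{t+1:t+\ell}\rangle\mathbf 1|_\infty}{p^\theta_{\mu,t}(Y_{t:t+\ell})},$$ and for $\ell\ge1$: $$\widetilde C^\theta_{t,\ell}=\frac{|w^\theta\langle Y_t\rangle|_\infty\int\lambda(dx_{t+1})\,g^\theta(x_{t+1},Y_{t+1})\,Q^\theta\langle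 Y_{t+2:t+\ell}\rangle\mathbf 1(x_{t+1})}{p^\theta_{\mu,t}(Y_{t:t+\ell})}.$$ ($\epsilon_{T,N}(\theta)$ is a minorization constant of the particle Gibbs kernel with $N$ particles run with model $\theta$ on data $Y_{0:T}$.) *)

theory Defs
  imports "HOL-Probability.Probability" "HOL-Library.Landau_Symbols"
begin

section \<open>Laws of Markov chains and hidden Markov models\<close>

text \<open>
  Only the space and the sigma-algebra of the arguments \<open>X\<close> and \<open>Y\<close> matter. The law of the
  chain with initial law \<open>mu\<close> and kernel \<open>M\<close> is the Ionescu-Tulcea measure on the sequence space.
\<close>

definition chain_step ::
  "'x measure \<Rightarrow> ('x \<Rightarrow> 'x measure) \<Rightarrow> nat \<Rightarrow> (nat \<Rightarrow> 'x) \<Rightarrow> 'x measure" where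
  "chain_step mu M n x = (if n = 0 then mu else M (x (n - 1)))"

definition chain_law ::
  "'x measure \<Rightarrow> 'x measure \<Rightarrow> ('x \<Rightarrow> 'x measure) \<Rightarrow> (nat \<Rightarrow> 'x) measure" where
  "chain_law X mu M =
     projective_family.lim UNIV (Ionescu_Tulcea.CI (chain_step mu M) (\<lambda>_. X)) (\<lambda>_. X)"

text \<open>
  A sample point is a pair of the state sequence and the observation sequence; given the states,
  the observations are independent, the one at time \<open>t\<close> having law \<open>G (x t)\<close>.
\<close>

definition hmm_law ::
  "'x measure \<Rightarrow> 'y measure \<Rightarrow> 'x measure \<Rightarrow> ('x \<Rightarrow> 'x measure) \<Rightarrow> ('x \<Rightarrow> 'y measure)
    \<Rightarrow> ((nat \<Rightarrow> 'x) \<times> (nat \<Rightarrow> 'y)) measure" where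
  "hmm_law X Y mu M G =
     chain_law X mu M \<bind> (\<lambda>x. PiM UNIV (\<lambda>t. G (x t)) \<bind>
       (\<lambda>y. return (PiM UNIV (\<lambda>_. X) \<Otimes>\<^sub>M PiM UNIV (\<lambda>_. Y)) (x, y)))"

definition stationary :: "'x measure \<Rightarrow> ('x \<Rightarrow> 'x measure) \<Rightarrow> 'x measure \<Rightarrow> bool" where
  "stationary X M p \<longleftrightarrow> p \<in> space (prob_algebra X) \<and> p \<bind> M = p"

lemma Ionescu_Tulcea_chain_step:
  assumes mu: "mu \<in> space (prob_algebra X)" and M: "M \<in> X \<rightarrow>\<^sub>M prob_algebra X"
  shows "Ionescu_Tulcea (chain_step mu M) (\<lambda>_. X)"
proof (rule Ionescu_Tulcea.intro)
  fix i :: nat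
  note M' = measurable_prob_algebraD[OF M]
  show "chain_step mu M i \<in> PiM {0..<i} (\<lambda>_. X) \<rightarrow>\<^sub>M subprob_algebra X"
  proof (cases "i = 0")
    case True
    have "(\<lambda>_. mu) \<in> PiM {0..<i} (\<lambda>_. X) \<rightarrow>\<^sub>M prob_algebra X"
      using mu by simp
    from measurable_prob_algebraD[OF this] show ?thesis
      using True by (simp add: chain_step_def[abs_def])
  next
    case False
    then have "(\<lambda>x. x (i - 1)) \<in> PiM {0..<i} (\<lambda>_. X) \<rightarrow>\<^sub>M X"
      by (intro measurable_component_singleton) auto
    from measurable_compose[OF this M'] show ?thesis
      using False by (simp add: chain_step_def[abs_def])
  qed
next
  fix i :: nat and x assume x: "x \<in> space (PiM {0..<i} (\<lambda>_. X))"
  show "prob_space (chain_step mu M i x)"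
  proof (cases "i = 0")
    case True
    then show ?thesis using mu by (simp add: chain_step_def space_prob_algebra)
  next
    case False
    with x have "x (i - 1) \<in> space X" by (auto simp: space_PiM)
    from measurable_space[OF M this] show ?thesis
      using False by (simp add: chain_step_def space_prob_algebra)
  qed
qed

lemma chain_law_in_prob_algebra:
  assumes mu: "mu \<in> space (prob_algebra X)" and M: "M \<in> X \<rightarrow>\<^sub>M prob_algebra X"
  shows "chain_law X mu M \<in> space (prob_algebra (PiM UNIV (\<lambda>_. X)))"
proof -
  interpret IT: Ionescu_Tulcea "chain_step mu M" "\<lambda>_. X"
    using assms by (rule Ionescu_Tulcea_chain_step)
  have "emeasure IT.PF.lim (space IT.PF.lim) = 1"
  proof -
    have "emeasure IT.PF.lim (prod_emb UNIV (\<lambda>_. X) {} (space (PiM {} (\<lambda>_. X)))) = 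
      emeasure (IT.CI {}) (space (PiM {} (\<lambda>_. X)))"
      by (rule IT.lim) auto
    moreover have "prod_emb UNIV (\<lambda>_. X) {} (space (PiM {} (\<lambda>_. X))) = space IT.PF.lim"
      by (auto simp: prod_emb_def space_PiM)
    moreover have "emeasure (IT.CI {}) (space (PiM {} (\<lambda>_. X))) = 1"
      using prob_space.emeasure_space_1[OF IT.PF.prob_space_P[of "{}"]] IT.PF.space_P[of "{}"] by simp
    ultimately show ?thesis by simp
  qed
  then show ?thesis
    by (auto simp: chain_law_def space_prob_algebra intro!: prob_spaceI)
qed

text \<open>
  The finite-dimensional laws: the law of the first \<open>n\<close> states is obtained by successively
  drawing from the steps.
\<close>

lemma chain_law_fidi:
  assumes mu: "mu \<in> space (prob_algebra X)" and M: "M \<in> X \<rightarrow>\<^sub>M prob_algebra X"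
    and A: "A \<in> sets (PiM {0..<n} (\<lambda>_. X))"
  shows "emeasure (chain_law X mu M) (prod_emb UNIV (\<lambda>_. X) {0..<n} A)
    = emeasure (Ionescu_Tulcea.C (chain_step mu M) (\<lambda>_. X) 0 n (\<lambda>_. undefined)) A"
proof -
  interpret IT: Ionescu_Tulcea "chain_step mu M" "\<lambda>_. X"
    using assms(1,2) by (rule Ionescu_Tulcea_chain_step)
  have "prod_emb {0..<n} (\<lambda>_. X) {0..<n} A = A"
    using A sets.sets_into_space[OF A] by (intro prod_emb_id) (auto simp: space_PiM)
  then show ?thesis
    using IT.lim[OF _ A] IT.emeasure_CI[OF order.refl A] by (simp add: chain_law_def)
qed

lemma measurable_PiM_kernel:
  assumes G: "G \<in> X \<rightarrow>\<^sub>M prob_algebra Y"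
  shows "(\<lambda>x. PiM UNIV (\<lambda>t::nat. G (x t))) \<in> PiM UNIV (\<lambda>_. X) \<rightarrow>\<^sub>M prob_algebra (PiM UNIV (\<lambda>_. Y))"
proof (rule measurable_prob_algebra_generated)
  show "sets (PiM UNIV (\<lambda>_::nat. Y)) =
      sigma_sets (space (PiM UNIV (\<lambda>_. Y))) (prod_algebra UNIV (\<lambda>_. Y))"
    by (simp add: sets_PiM space_PiM)
  show "Int_stable (prod_algebra (UNIV::nat set) (\<lambda>_. Y))"
    by (rule Int_stable_prod_algebra)
  show "prod_algebra (UNIV::nat set) (\<lambda>_. Y) \<subseteq> Pow (space (PiM UNIV (\<lambda>_. Y)))"
    using prod_algebra_sets_into_space[of "UNIV::nat set" "\<lambda>_. Y"] by (simp add: space_PiM)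
  fix x assume x: "x \<in> space (PiM UNIV (\<lambda>_::nat. X))"
  have Gx: "prob_space (G (x t))" "sets (G (x t)) = sets Y" for t
    using x measurable_space[OF G, of "x t"] by (auto simp: space_PiM space_prob_algebra)
  interpret product_prob_space "\<lambda>t. G (x t)" UNIV
    using Gx by (auto simp: product_prob_space_def product_prob_space_axioms_def
      product_sigma_finite_def intro!: prob_space_imp_sigma_finite)
  show "prob_space (PiM UNIV (\<lambda>t. G (x t)))"
    by (rule P.prob_space_axioms)
  show "sets (PiM UNIV (\<lambda>t. G (x t))) = sets (PiM UNIV (\<lambda>_. Y))"
    by (intro sets_PiM_cong Gx) auto
next
  fix A assume "A \<in> prod_algebra (UNIV::nat set) (\<lambda>_. Y)"
  then obtain J E where J: "finite J" and E: "\<And>i. i \<in> J \<Longrightarrow> E i \<in> sets Y"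
    and A: "A = prod_emb UNIV (\<lambda>_. Y) J (\<Pi>\<^sub>E j\<in>J. E j)"
    by (rule prod_algebraE) auto
  have "emeasure (PiM UNIV (\<lambda>t. G (x t))) A = (\<Prod>j\<in>J. emeasure (G (x j)) (E j))"
    if x: "x \<in> space (PiM UNIV (\<lambda>_::nat. X))" for x
  proof -
    have Gx: "prob_space (G (x t))" "sets (G (x t)) = sets Y" for t
      using x measurable_space[OF G, of "x t"] by (auto simp: space_PiM space_prob_algebra)
    interpret product_prob_space "\<lambda>t. G (x t)" UNIV
      using Gx by (auto simp: product_prob_space_def product_prob_space_axioms_def
        product_sigma_finite_def intro!: prob_space_imp_sigma_finite)
    have "A = prod_emb UNIV (\<lambda>t. G (x t)) J (\<Pi>\<^sub>E j\<in>J. E j)"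
      using sets_eq_imp_space_eq[OF Gx(2)] by (simp add: A prod_emb_def)
    then show ?thesis using J E Gx by (simp add: emeasure_PiM_emb)
  qed
  moreover have "(\<lambda>x. \<Prod>j\<in>J. emeasure (G (x j)) (E j)) \<in> borel_measurable (PiM UNIV (\<lambda>_::nat. X))"
  proof (intro borel_measurable_prod_ennreal)
    fix j assume "j \<in> J"
    show "(\<lambda>x. emeasure (G (x j)) (E j)) \<in> borel_measurable (PiM UNIV (\<lambda>_::nat. X))"
      using measurable_compose[OF measurable_component_singleton[of j UNIV "\<lambda>_. X"]
        measurable_emeasure_kernel[OF measurable_prob_algebraD[OF G] E[OF \<open>j \<in> J\<close>]]] by simp
  qed
  ultimately show "(\<lambda>x. emeasure (PiM UNIV (\<lambda>t. G (x t))) A) \<in> borel_measurable (PiM UNIV (\<lambda>_. X))"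
    by (simp cong: measurable_cong)
qed

lemma hmm_law_in_prob_algebra:
  assumes mu: "mu \<in> space (prob_algebra X)" and M: "M \<in> X \<rightarrow>\<^sub>M prob_algebra X"
    and G: "G \<in> X \<rightarrow>\<^sub>M prob_algebra Y"
  shows "hmm_law X Y mu M G \<in> space (prob_algebra (PiM UNIV (\<lambda>_. X) \<Otimes>\<^sub>M PiM UNIV (\<lambda>_. Y)))"
proof -
  note [measurable] = measurable_PiM_kernel[OF G]
  let ?P = "PiM UNIV (\<lambda>_::nat. X) \<Otimes>\<^sub>M PiM UNIV (\<lambda>_::nat. Y)"
  have "(\<lambda>x. PiM UNIV (\<lambda>t. G (x t)) \<bind> (\<lambda>y. return ?P (x, y)))
      \<in> PiM UNIV (\<lambda>_. X) \<rightarrow>\<^sub>M prob_algebra ?P"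
    by (rule measurable_bind_prob_space2[where N="PiM UNIV (\<lambda>_. Y)"]) measurable
  then have "(\<lambda>_. hmm_law X Y mu M G) \<in> count_space UNIV \<rightarrow>\<^sub>M prob_algebra ?P"
    unfolding hmm_law_def
    using chain_law_in_prob_algebra[OF mu M]
    by (intro measurable_bind_prob_space[where N="PiM UNIV (\<lambda>_. X)"]) auto
  from measurable_space[OF this, of undefined] show ?thesis by simp
qed


section \<open>Likelihoods\<close>

text \<open>Densities with respect to \<open>kappa\<close> are real-valued functions \<open>g x y\<close>.\<close>

definition Q_ker ::
  "('x \<Rightarrow> 'x measure) \<Rightarrow> ('x \<Rightarrow> 'y \<Rightarrow> real) \<Rightarrow> 'y \<Rightarrow> 'x \<Rightarrow> 'x measure" where
  "Q_ker M g y x = density (M x) (\<lambda>x'. ennreal (g x' y))"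

text \<open>
  \<open>Q_one M g y s n\<close> is the composition of the \<open>n\<close> kernels \<open>Q_ker M g (y s), \<dots>,
  Q_ker M g (y (s + n - 1))\<close> applied to the constant function 1. The upper index is thus
  \<open>s + n - 1\<close>, and \<open>n = 0\<close> is the empty composition.
\<close>

primrec Q_one ::
  "('x \<Rightarrow> 'x measure) \<Rightarrow> ('x \<Rightarrow> 'y \<Rightarrow> real) \<Rightarrow> (nat \<Rightarrow> 'y) \<Rightarrow> nat \<Rightarrow> nat \<Rightarrow> 'x \<Rightarrow> ennreal" where
  "Q_one M g y s 0 x = 1"
| "Q_one M g y s (Suc n) x = (\<integral>\<^sup>+ x'. Q_one M g y (Suc s) n x' \<partial>Q_ker M g (y s) x)"

text \<open>
  \<open>lik mu M g y t\<close> is the density of the observations up to and including time \<open>t\<close>: the iterated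
  integral over the states at times \<open>1, \<dots>, t\<close> is \<open>Q_one M g y 1 t\<close>.
\<close>

definition lik ::
  "'x measure \<Rightarrow> ('x \<Rightarrow> 'x measure) \<Rightarrow> ('x \<Rightarrow> 'y \<Rightarrow> real) \<Rightarrow> (nat \<Rightarrow> 'y) \<Rightarrow> nat \<Rightarrow> ennreal" where
  "lik mu M g y t = (\<integral>\<^sup>+ x. ennreal (g x (y 0)) * Q_one M g y 1 t x \<partial>mu)"

text \<open>Density of the observations at times \<open>s, \<dots>, t\<close> given those at times \<open>0, \<dots>, s - 1\<close>.\<close>

definition cond_lik ::
  "'x measure \<Rightarrow> ('x \<Rightarrow> 'x measure) \<Rightarrow> ('x \<Rightarrow> 'y \<Rightarrow> real) \<Rightarrow> (nat \<Rightarrow> 'y) \<Rightarrow> nat \<Rightarrow> nat \<Rightarrow> ennreal" where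
  "cond_lik mu M g y s t =
     (if s = 0 then lik mu M g y t
      else if lik mu M g y (s - 1) = 0 then 0
      else lik mu M g y t / lik mu M g y (s - 1))"

text \<open>Marginal density of the observations at times \<open>s, \<dots>, t\<close>.\<close>

definition marg_lik ::
  "'y measure \<Rightarrow> 'x measure \<Rightarrow> ('x \<Rightarrow> 'x measure) \<Rightarrow> ('x \<Rightarrow> 'y \<Rightarrow> real) \<Rightarrow> (nat \<Rightarrow> 'y)
    \<Rightarrow> nat \<Rightarrow> nat \<Rightarrow> ennreal" where
  "marg_lik kappa mu M g y s t =
     (\<integral>\<^sup>+ z. lik mu M g (\<lambda>i. if i < s then z i else y i) t \<partial>PiM {..<s} (\<lambda>_. kappa))"


section \<open>Weights and the constants of the particle Gibbs minorization\<close>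

text \<open>
  All functions below are nonnegative, so the sup norm is a supremum in \<^typ>\<open>ennreal\<close>. The weight at
  time 0 is \<open>g x y * d0 y x\<close>, where \<open>d0 y\<close> is a density of \<open>mu\<close> with respect to \<open>r0 y\<close>.
\<close>

definition w_norm ::
  "'x measure \<Rightarrow> ('x \<Rightarrow> 'y \<Rightarrow> real) \<Rightarrow> ('y \<Rightarrow> 'x \<Rightarrow> ennreal) \<Rightarrow> ('y \<Rightarrow> 'x \<Rightarrow> 'x \<Rightarrow> ennreal)
    \<Rightarrow> nat \<Rightarrow> 'y \<Rightarrow> ennreal" where
  "w_norm X g d0 w t y =
     (if t = 0 then (SUP x\<in>space X. ennreal (g x y) * d0 y x)
      else (SUP x\<in>space X. SUP x'\<in>space X. w y x x'))"

definition Q_norm ::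
  "'x measure \<Rightarrow> ('x \<Rightarrow> 'x measure) \<Rightarrow> ('x \<Rightarrow> 'y \<Rightarrow> real) \<Rightarrow> (nat \<Rightarrow> 'y) \<Rightarrow> nat \<Rightarrow> nat \<Rightarrow> ennreal" where
  "Q_norm X M g y s n = (SUP x\<in>space X. Q_one M g y s n x)"

definition B_tilde ::
  "'x measure \<Rightarrow> 'y measure \<Rightarrow> 'x measure \<Rightarrow> ('x \<Rightarrow> 'x measure) \<Rightarrow> ('x \<Rightarrow> 'y \<Rightarrow> real)
    \<Rightarrow> ('y \<Rightarrow> 'x \<Rightarrow> ennreal) \<Rightarrow> ('y \<Rightarrow> 'x \<Rightarrow> 'x \<Rightarrow> ennreal) \<Rightarrow> nat \<Rightarrow> nat \<Rightarrow> (nat \<Rightarrow> 'y) \<Rightarrow> ennreal" where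
  "B_tilde X kappa mu M g d0 w t l y =
     w_norm X g d0 w t (y t) * Q_norm X M g y (t + 1) l / marg_lik kappa mu M g y t (t + l)"

text \<open>Meant for \<open>l \<ge> 1\<close>.\<close>

definition C_tilde ::
  "'x measure \<Rightarrow> 'x measure \<Rightarrow> 'y measure \<Rightarrow> 'x measure \<Rightarrow> ('x \<Rightarrow> 'x measure) \<Rightarrow> ('x \<Rightarrow> 'y \<Rightarrow> real)
    \<Rightarrow> ('y \<Rightarrow> 'x \<Rightarrow> ennreal) \<Rightarrow> ('y \<Rightarrow> 'x \<Rightarrow> 'x \<Rightarrow> ennreal) \<Rightarrow> nat \<Rightarrow> nat \<Rightarrow> (nat \<Rightarrow> 'y) \<Rightarrow> ennreal" where
  "C_tilde X lambda kappa mu M g d0 w t l y =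
     w_norm X g d0 w t (y t)
       * (\<integral>\<^sup>+ x. ennreal (g x (y (t + 1))) * Q_one M g y (t + 2) (l - 1) x \<partial>lambda)
       / marg_lik kappa mu M g y t (t + l)"

definition B_const ::
  "'x measure \<Rightarrow> 'x measure \<Rightarrow> ('x \<Rightarrow> 'x measure) \<Rightarrow> ('x \<Rightarrow> 'y \<Rightarrow> real)
    \<Rightarrow> ('y \<Rightarrow> 'x \<Rightarrow> ennreal) \<Rightarrow> ('y \<Rightarrow> 'x \<Rightarrow> 'x \<Rightarrow> ennreal) \<Rightarrow> nat \<Rightarrow> nat \<Rightarrow> (nat \<Rightarrow> 'y) \<Rightarrow> ennreal" where
  "B_const X mu M g d0 w t T y =
     (SUP l\<in>{0..T - t}. w_norm X g d0 w t (y t) * Q_norm X M g y (t + 1) l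
        / cond_lik mu M g y t (t + l))"

text \<open>Meant for \<open>N \<ge> 2\<close>.\<close>

definition eps_const ::
  "'x measure \<Rightarrow> 'x measure \<Rightarrow> ('x \<Rightarrow> 'x measure) \<Rightarrow> ('x \<Rightarrow> 'y \<Rightarrow> real)
    \<Rightarrow> ('y \<Rightarrow> 'x \<Rightarrow> ennreal) \<Rightarrow> ('y \<Rightarrow> 'x \<Rightarrow> 'x \<Rightarrow> ennreal) \<Rightarrow> nat \<Rightarrow> nat \<Rightarrow> (nat \<Rightarrow> 'y) \<Rightarrow> ennreal" where
  "eps_const X mu M g d0 w T N y =
     (\<Prod>t\<in>{0..T}. ennreal (real N - 1) /
        (2 * B_const X mu M g d0 w t T y + ennreal (real N - 2)))"


section \<open>The standing setup for a single model\<close>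

text \<open>
  The Radon-Nikodym derivatives entering the weights are only determined almost everywhere, whereas
  their pointwise suprema are used; hence versions \<open>d0\<close> and \<open>w\<close> are part of the data. The last
  three assumptions say that the sup norms are measurable functions of the observations, so that the
  constants above are random variables; for uncountable \<open>X\<close> this is not automatic.
\<close>

locale hmm_with_proposals =
  fixes X :: "'x measure" and Y :: "'y measure" and kappa :: "'y measure" and mu :: "'x measure"
    and M :: "'x \<Rightarrow> 'x measure" and G :: "'x \<Rightarrow> 'y measure" and g :: "'x \<Rightarrow> 'y \<Rightarrow> real"
    and r0 :: "'y \<Rightarrow> 'x measure" and d0 :: "'y \<Rightarrow> 'x \<Rightarrow> ennreal"
    and R :: "'y \<Rightarrow> 'x \<Rightarrow> 'x measure" and w :: "'y \<Rightarrow> 'x \<Rightarrow> 'x \<Rightarrow> ennreal"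
  assumes kappa_sigma_finite: "sigma_finite_measure kappa"
    and sets_kappa: "sets kappa = sets Y"
    and mu: "mu \<in> space (prob_algebra X)"
    and M: "M \<in> X \<rightarrow>\<^sub>M prob_algebra X"
    and G: "G \<in> X \<rightarrow>\<^sub>M prob_algebra Y"
    and g_measurable: "(\<lambda>(x, y). g x y) \<in> borel_measurable (X \<Otimes>\<^sub>M Y)"
    and g_nonneg: "\<And>x y. x \<in> space X \<Longrightarrow> y \<in> space Y \<Longrightarrow> 0 \<le> g x y"
    and g_density: "\<And>x. x \<in> space X \<Longrightarrow> G x = density kappa (\<lambda>y. ennreal (g x y))"
    and r0: "\<And>y. y \<in> space Y \<Longrightarrow> r0 y \<in> space (prob_algebra X)"
    and mu_ac_r0: "\<And>y. y \<in> space Y \<Longrightarrow> absolutely_continuous (r0 y) mu"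
    and d0_measurable: "\<And>y. y \<in> space Y \<Longrightarrow> d0 y \<in> borel_measurable X"
    and d0_density: "\<And>y. y \<in> space Y \<Longrightarrow> density (r0 y) (d0 y) = mu"
    and R: "\<And>y. y \<in> space Y \<Longrightarrow> R y \<in> X \<rightarrow>\<^sub>M prob_algebra X"
    and Q_ac_R: "\<And>x y. x \<in> space X \<Longrightarrow> y \<in> space Y \<Longrightarrow>
          absolutely_continuous (R y x) (Q_ker M g y x)"
    and w_measurable: "\<And>x y. x \<in> space X \<Longrightarrow> y \<in> space Y \<Longrightarrow> w y x \<in> borel_measurable X"
    and w_density: "\<And>x y. x \<in> space X \<Longrightarrow> y \<in> space Y \<Longrightarrow>
          density (R y x) (w y x) = Q_ker M g y x"
    and w0_norm_measurable: "w_norm X g d0 w 0 \<in> borel_measurable Y"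
    and w_norm_measurable: "w_norm X g d0 w 1 \<in> borel_measurable Y"
    and Q_norm_measurable: "\<And>n. (\<lambda>y. Q_norm X M g y 0 n) \<in> borel_measurable (PiM UNIV (\<lambda>_. Y))"


section \<open>Extended-real expectations, logarithms and tightness\<close>

definition ennreal_powr :: "ennreal \<Rightarrow> real \<Rightarrow> ennreal" where
  "ennreal_powr b a = (if b = \<infinity> then \<infinity> else ennreal (enn2real b powr a))"

definition ln_ennreal :: "ennreal \<Rightarrow> ereal" where
  "ln_ennreal a = (if a = 0 then -\<infinity> else if a = \<infinity> then \<infinity> else ereal (ln (enn2real a)))"

text \<open>
  Integral of the positive part minus integral of the negative part. It is used for logarithms of
  likelihood ratios, whose negative parts always have finite integral. Unlike the Bochner integral,
  which is 0 for a function that is not integrable, it can then take the value \<open>\<infinity>\<close>.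
\<close>

definition ereal_expectation :: "'a measure \<Rightarrow> ('a \<Rightarrow> ereal) \<Rightarrow> ereal" where
  "ereal_expectation P f =
     enn2ereal (\<integral>\<^sup>+ x. e2ennreal (f x) \<partial>P) - enn2ereal (\<integral>\<^sup>+ x. e2ennreal (- f x) \<partial>P)"

text \<open>Boundedness in probability of the variables with indices in \<open>I\<close>; each of them is finite
  almost surely if this holds.\<close>

definition bounded_in_prob :: "'a measure \<Rightarrow> 'i set \<Rightarrow> ('i \<Rightarrow> 'a \<Rightarrow> ennreal) \<Rightarrow> bool" where
  "bounded_in_prob P I Z \<longleftrightarrow>
     (\<forall>\<delta>>0. \<exists>K::real. \<forall>i\<in>I. measure P {x \<in> space P. Z i x > ennreal K} < \<delta>)"

end

theory Submission
  imports Defs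
begin

text \<open>
  Under the law of model \<open>\<theta>\<^sub>T\<close> started at \<open>\<mu>\<close>, the ratios defining \<open>B\<^bsub>t,T\<^esub>\<close> with \<open>l \<ge> l\<^sub>\<star>\<close> are bounded,
  through (A-2), by nonnegative martingales in \<open>l\<close>. A maximal inequality together with (A-4) gives
  \<open>P (B\<^bsub>t,T\<^esub> > c) \<le> K c\<^bsup>-\<alpha>\<^esup>\<close> uniformly in \<open>t\<close>, \<open>T\<close> and \<open>\<theta>\<close>. Since \<open>\<alpha> < 1\<close>, truncation yields
  \<open>P (\<Sum>t\<le>T. B\<^bsub>t,T\<^esub> > s N\<^sub>T) \<le> K' T (s N\<^sub>T)\<^bsup>-\<alpha>\<^esup>\<close>, where \<open>T N\<^sub>T\<^bsup>-\<alpha>\<^esup>\<close> stays bounded because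
  \<open>\<gamma> < \<alpha>\<close>, and the inverse of \<open>\<epsilon>\<close> is at most \<open>exp (4 (\<Sum>t\<le>T. B\<^bsub>t,T\<^esub>) / N\<^sub>T)\<close>.

  This transfers to the stationary law of \<open>\<theta>\<^sub>\<star>\<close> because the likelihood ratio of the two laws of
  \<open>(X\<^sub>s, Y\<^sub>s)\<^bsub>s\<le>T\<^esub>\<close> is tight under the latter: its logarithm is an initial term plus a sum with mean
  \<open>T E[ln (m\<^bsub>\<theta>\<star>\<^esub> g\<^bsub>\<theta>\<star>\<^esub> / m\<^bsub>\<theta>T\<^esub> g\<^bsub>\<theta>T\<^esub>)]\<close>, and the mean of the negative part of that sum is at most 1.
\<close>

section \<open>The Markov property of the hidden Markov model\<close>

text \<open>The supremum in \<open>B_const\<close> runs over look-ahead lengths whose number grows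
  with the horizon, so a union bound over \<open>l\<close> would not be uniform. The supremum norm
  of the future kernels is no martingale in \<open>l\<close>, but it is at most \<sigma> times an
  integral against \<lambda>, from which the last observation integrates out exactly. Hence (A-4)
  uses the norm for finitely many \<open>l\<close> and the \<lambda>-integral for the single length
  \<open>lstar\<close>. The event compares with the likelihood conditional on the past, while (A-4)
  has the marginal one; they are matched by integrating out the past, whose likelihood has total
  mass one.

  For the likelihood ratio of the two laws only an upper bound on a mean logarithm is available and
  no moment, so the transfer rests on tightness. The ratio is taken for states and observations
  jointly because it then factorizes into one-step terms, whose logarithms are the quantity in the
  rate assumption.

  All events involve finitely many coordinates. The argument is phrased with integrals of densities
  over such coordinates, so that neither filtrations nor conditional expectations enter.\<close>

text \<open>The dependence conditions range over all sequences, also those outside the product space.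
  Hence events have to be given by predicates that do not mention the space.\<close>

definition dep :: "nat \<Rightarrow> ((nat \<Rightarrow> 'a) \<Rightarrow> 'c) \<Rightarrow> bool" where
  "dep n f \<longleftrightarrow> (\<forall>x x'. (\<forall>i\<le>n. x i = x' i) \<longrightarrow> f x = f x')"

definition adapted :: "nat \<Rightarrow> ((nat \<Rightarrow> 'x) \<times> (nat \<Rightarrow> 'y) \<Rightarrow> 'c) \<Rightarrow> bool" where
  "adapted n f \<longleftrightarrow> (\<forall>x x' y y'. (\<forall>i\<le>n. x i = x' i \<and> y i = y' i) \<longrightarrow> f (x, y) = f (x', y'))"

lemma depD: "dep n f \<Longrightarrow> (\<And>i. i \<le> n \<Longrightarrow> x i = x' i) \<Longrightarrow> f x = f x'"
  by (simp add: dep_def)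

lemma adaptedD: "adapted n f \<Longrightarrow> (\<And>i. i \<le> n \<Longrightarrow> x i = x' i) \<Longrightarrow> (\<And>i. i \<le> n \<Longrightarrow> y i = y' i)
    \<Longrightarrow> f (x, y) = f (x', y')"
  by (simp add: adapted_def)

abbreviation upd :: "nat \<Rightarrow> (nat \<Rightarrow> 'x) \<times> (nat \<Rightarrow> 'y) \<Rightarrow> 'x \<Rightarrow> 'y \<Rightarrow> (nat \<Rightarrow> 'x) \<times> (nat \<Rightarrow> 'y)" where
  "upd n \<omega> v u \<equiv> ((fst \<omega>)(n := v), (snd \<omega>)(n := u))"

lemma measurable_fun_upd_UNIV:
  assumes "f \<in> N \<rightarrow>\<^sub>M PiM UNIV (\<lambda>_. A)" "h \<in> N \<rightarrow>\<^sub>M A"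
  shows "(\<lambda>x. (f x)(i := h x)) \<in> N \<rightarrow>\<^sub>M PiM UNIV (\<lambda>_::nat. A)"
  using assms by (intro measurable_fun_upd[where J=UNIV]) auto

text \<open>Elements of a product over \<open>J\<close> are \<open>undefined\<close> elsewhere. A
  fixed reference sequence fills these coordinates, so that functions on the full sequence space can
  be evaluated at finite-horizon samples.\<close>

lemma extend_measurable:
  assumes x0: "x0 \<in> space (PiM UNIV (\<lambda>_. A))"
  shows "(\<lambda>x i. if i \<in> J then x i else x0 i) \<in> PiM J (\<lambda>_. A) \<rightarrow>\<^sub>M PiM (UNIV::nat set) (\<lambda>_. A)"
proof (rule measurable_PiM_single')
  have x0i: "x0 i \<in> space A" for i using x0 by (auto simp: space_PiM)
  then show "(\<lambda>x i. if i \<in> J then x i else x0 i) \<in> space (PiM J (\<lambda>_. A)) \<rightarrow> (\<Pi>\<^sub>E i\<in>UNIV. space A)"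
    by (auto simp: space_PiM PiE_iff)
  show "(\<lambda>x. if i \<in> J then x i else x0 i) \<in> PiM J (\<lambda>_. A) \<rightarrow>\<^sub>M A" for i
    by (cases "i \<in> J") (auto intro!: measurable_component_singleton measurable_const x0i)
qed

locale hmm =
  fixes X :: "'x measure" and Y :: "'y measure" and mu :: "'x measure"
    and M :: "'x \<Rightarrow> 'x measure" and G :: "'x \<Rightarrow> 'y measure"
  assumes mu: "mu \<in> space (prob_algebra X)"
    and M: "M \<in> X \<rightarrow>\<^sub>M prob_algebra X"
    and G: "G \<in> X \<rightarrow>\<^sub>M prob_algebra Y"
begin

abbreviation "PX \<equiv> PiM (UNIV :: nat set) (\<lambda>_. X)"
abbreviation "PY \<equiv> PiM (UNIV :: nat set) (\<lambda>_. Y)"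
abbreviation "law \<equiv> hmm_law X Y mu M G"

lemma mu_prob: "prob_space mu" and sets_mu [measurable_cong, simp]: "sets mu = sets X"
  using mu by (auto simp: space_prob_algebra)

lemma space_mu [simp]: "space mu = space X"
  using sets_eq_imp_space_eq[OF sets_mu] .

lemma M_prob: "x \<in> space X \<Longrightarrow> prob_space (M x)" and sets_M [simp]: "x \<in> space X \<Longrightarrow> sets (M x) = sets X"
  using measurable_space[OF M] by (auto simp: space_prob_algebra)

lemma space_M [simp]: "x \<in> space X \<Longrightarrow> space (M x) = space X"
  using sets_eq_imp_space_eq[OF sets_M] .

lemma G_prob: "x \<in> space X \<Longrightarrow> prob_space (G x)" and sets_G [simp]: "x \<in> space X \<Longrightarrow> sets (G x) = sets Y"
  using measurable_space[OF G] by (auto simp: space_prob_algebra)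

lemma space_G [simp]: "x \<in> space X \<Longrightarrow> space (G x) = space Y"
  using sets_eq_imp_space_eq[OF sets_G] .

lemma X_ne: "space X \<noteq> {}" and Y_ne: "space Y \<noteq> {}"
proof -
  show "space X \<noteq> {}" using prob_space.not_empty[OF mu_prob] by simp
  then obtain x where "x \<in> space X" by auto
  then show "space Y \<noteq> {}" using prob_space.not_empty[OF G_prob[of x]] by simp
qed

lemma law_prob: "prob_space law" and sets_law [measurable_cong, simp]: "sets law = sets (PX \<Otimes>\<^sub>M PY)"
  using hmm_law_in_prob_algebra[OF mu M G] by (auto simp: space_prob_algebra)

lemma space_law [simp]: "space law = space (PX \<Otimes>\<^sub>M PY)"
  using sets_eq_imp_space_eq[OF sets_law] .

lemma sets_chain [measurable_cong, simp]: "sets (chain_law X mu M) = sets PX"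
  using chain_law_in_prob_algebra[OF mu M] by (auto simp: space_prob_algebra)

lemma space_chain [simp]: "space (chain_law X mu M) = space PX"
  using sets_eq_imp_space_eq[OF sets_chain] .

lemmas M_sub [measurable] = measurable_prob_algebraD[OF M]
lemmas G_sub [measurable] = measurable_prob_algebraD[OF G]

section \<open>Kernel integrals and the law of the state chain\<close>

lemma nn_integral_M_measurable:
  assumes "(\<lambda>(z, x'). f z x') \<in> borel_measurable (N \<Otimes>\<^sub>M X)" "h \<in> N \<rightarrow>\<^sub>M X"
  shows "(\<lambda>z. \<integral>\<^sup>+ x'. f z x' \<partial>M (h z)) \<in> borel_measurable N"
  by (rule nn_integral_measurable_subprob_algebra2[OF assms(1) measurable_compose[OF assms(2) M_sub]])

lemma nn_integral_G_measurable:
  assumes "(\<lambda>(z, y'). f z y') \<in> borel_measurable (N \<Otimes>\<^sub>M Y)" "h \<in> N \<rightarrow>\<^sub>M X"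
  shows "(\<lambda>z. \<integral>\<^sup>+ y'. f z y' \<partial>G (h z)) \<in> borel_measurable N"
  by (rule nn_integral_measurable_subprob_algebra2[OF assms(1) measurable_compose[OF assms(2) G_sub]])

text \<open>As \<open>h\<close> reads coordinates up to \<open>n\<close> only, the projective limit
  may be replaced by its marginal on these coordinates, whose last kernel is then split off. The
  sequence \<open>x0\<close> fills the coordinates beyond \<open>n\<close>.\<close>

lemma chain_law_split:
  assumes h[measurable]: "h \<in> borel_measurable PX" and d: "dep n h" and x0: "x0 \<in> space PX"
  shows "(\<integral>\<^sup>+ x. h x \<partial>chain_law X mu M) =
    (\<integral>\<^sup>+ \<omega>. \<integral>\<^sup>+ v. h (\<lambda>i. if i < n then \<omega> i else if i = n then v else x0 i) \<partial>chain_step mu M n \<omega>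
      \<partial>Ionescu_Tulcea.C (chain_step mu M) (\<lambda>_. X) 0 n (\<lambda>_. undefined))"
proof -
  interpret IT: Ionescu_Tulcea "chain_step mu M" "\<lambda>_. X"
    using mu M by (rule Ionescu_Tulcea_chain_step)
  let ?e = "\<lambda>\<omega> i. if i \<le> n then \<omega> i else x0 i"
  let ?u = "\<lambda>\<omega> v i. if i < n then \<omega> i else if i = n then v else x0 i"
  have e [measurable]: "?e \<in> PiM {0..<Suc n} (\<lambda>_. X) \<rightarrow>\<^sub>M PX"
    using extend_measurable[OF x0, of "{0..<Suc n}"] by (simp add: less_Suc_eq_le)
  \<comment> \<open>\<open>CI\<close> is the image of a composition of kernels under restriction to
    its index set; on a full initial segment this restriction is the identity.\<close>
  have CI: "IT.CI {0..<Suc n} = IT.C 0 (Suc n) (\<lambda>_. undefined)"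
  proof (rule measure_eqI)
    show s: "sets (IT.CI {0..<Suc n}) = sets (IT.C 0 (Suc n) (\<lambda>_. undefined))"
      using IT.sets_C[of "\<lambda>_. undefined" 0 "Suc n"] by (simp add: IT.CI_def del: IT.C.simps)
    fix A assume "A \<in> sets (IT.CI {0..<Suc n})"
    then have A: "A \<in> sets (PiM {0..<Suc n} (\<lambda>_. X))" by (simp add: IT.CI_def)
    have "prod_emb {0..<Suc n} (\<lambda>_. X) {0..<Suc n} A = A"
      using sets.sets_into_space[OF A] by (intro prod_emb_id) (auto simp: space_PiM)
    then show "emeasure (IT.CI {0..<Suc n}) A = emeasure (IT.C 0 (Suc n) (\<lambda>_. undefined)) A"
      using IT.emeasure_CI[OF order.refl A] by simp
  qed
  have "(\<integral>\<^sup>+ x. h x \<partial>chain_law X mu M) = (\<integral>\<^sup>+ x. h (?e (restrict x {0..<Suc n})) \<partial>chain_law X mu M)"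
    by (intro nn_integral_cong depD[OF d]) auto
  also have "\<dots> = (\<integral>\<^sup>+ \<omega>. h (?e \<omega>) \<partial>distr (chain_law X mu M) (PiM {0..<Suc n} (\<lambda>_. X)) (\<lambda>x. restrict x {0..<Suc n}))"
    by (subst nn_integral_distr) (auto intro!: measurable_restrict measurable_component_singleton
      simp: measurable_cong_sets[OF sets_chain refl])
  also have "distr (chain_law X mu M) (PiM {0..<Suc n} (\<lambda>_. X)) (\<lambda>x. restrict x {0..<Suc n}) = IT.C 0 (Suc n) (\<lambda>_. undefined)"
    using IT.distr_lim[of "{0..<Suc n}"] CI by (simp add: chain_law_def del: IT.C.simps)
  also have "(\<integral>\<^sup>+ \<omega>. h (?e \<omega>) \<partial>\<dots>) = (\<integral>\<^sup>+ \<omega>. \<integral>\<^sup>+ z. h (?e z) \<partial>IT.eP n \<omega> \<partial>IT.C 0 n (\<lambda>_. undefined))"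
    using IT.measurable_eP[of n] IT.sets_C[of "\<lambda>_. undefined" 0 n]
    by (simp, intro nn_integral_bind[where B="PiM {0..<Suc n} (\<lambda>_. X)"])
      (auto cong: measurable_cong_sets)
  also have "\<dots> = (\<integral>\<^sup>+ \<omega>. \<integral>\<^sup>+ v. h (?u \<omega> v) \<partial>chain_step mu M n \<omega>
      \<partial>IT.C 0 n (\<lambda>_. undefined))"
  proof (rule nn_integral_cong)
    fix \<omega> assume "\<omega> \<in> space (IT.C 0 n (\<lambda>_. undefined))"
    then have w: "\<omega> \<in> space (PiM {0..<n} (\<lambda>_. X))" by (simp add: IT.space_C)
    have "(\<integral>\<^sup>+ z. h (?e z) \<partial>IT.eP n \<omega>) = (\<integral>\<^sup>+ v. h (?e ((\<omega>)(n := v))) \<partial>chain_step mu M n \<omega>)"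
      by (rule IT.nn_integral_eP[OF w]) measurable
    also have "\<dots> = (\<integral>\<^sup>+ v. h (?u \<omega> v) \<partial>chain_step mu M n \<omega>)"
      by (intro nn_integral_cong arg_cong[where f=h]) auto
    finally show "(\<integral>\<^sup>+ z. h (?e z) \<partial>IT.eP n \<omega>) = \<dots>" .
  qed
  finally show ?thesis .
qed

lemma PX_ne: "\<exists>x0. x0 \<in> space PX" and PY_ne: "\<exists>y0. y0 \<in> space PY"
  using X_ne Y_ne by (auto simp: space_PiM PiE_iff intro!: exI[of _ "\<lambda>_. SOME x. x \<in> _"] some_in_eq[THEN iffD2])

lemma chain_law_0:
  assumes h[measurable]: "h \<in> borel_measurable PX" and d: "dep 0 h" and x0: "x0 \<in> space PX"
  shows "(\<integral>\<^sup>+ x. h x \<partial>chain_law X mu M) = (\<integral>\<^sup>+ v. h (x0(0 := v)) \<partial>mu)"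
proof -
  interpret IT: Ionescu_Tulcea "chain_step mu M" "\<lambda>_. X"
    using mu M by (rule Ionescu_Tulcea_chain_step)
  have "prob_space (IT.C 0 0 (\<lambda>_. undefined))" by (rule IT.prob_space_C) simp
  from prob_space.emeasure_space_1[OF this] show ?thesis
    by (subst chain_law_split[OF h d x0]) (simp add: chain_step_def fun_upd_def del: IT.C.simps)
qed

text \<open>Splitting at \<open>Suc n\<close> exposes the last kernel. The integral over the last
  state depends on coordinates up to \<open>n\<close> only, so the splitting at \<open>n\<close>,
  read backwards, restores the full law.\<close>

lemma chain_law_Suc:
  assumes h[measurable]: "h \<in> borel_measurable PX" and d: "dep (Suc n) h"
  shows "(\<integral>\<^sup>+ x. h x \<partial>chain_law X mu M) = (\<integral>\<^sup>+ x. \<integral>\<^sup>+ v. h (x(Suc n := v)) \<partial>M (x n) \<partial>chain_law X mu M)"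
proof -
  interpret IT: Ionescu_Tulcea "chain_step mu M" "\<lambda>_. X"
    using mu M by (rule Ionescu_Tulcea_chain_step)
  obtain x0 where x0: "x0 \<in> space PX" using PX_ne by blast
  let ?k = "\<lambda>x. \<integral>\<^sup>+ v. h (x(Suc n := v)) \<partial>M (x n)"
  have k[measurable]: "?k \<in> borel_measurable PX"
  proof (rule nn_integral_M_measurable)
    have "(\<lambda>z. (fst z)(Suc n := snd z)) \<in> PX \<Otimes>\<^sub>M X \<rightarrow>\<^sub>M PX"
      by (intro measurable_fun_upd_UNIV) auto
    from measurable_compose[OF this h]
    show "(\<lambda>(x, v). h (x(Suc n := v))) \<in> borel_measurable (PX \<Otimes>\<^sub>M X)" by (simp add: case_prod_beta)
  qed measurable
  have dk: "dep n ?k"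
    unfolding dep_def
  proof (intro allI impI)
    fix x x' :: "nat \<Rightarrow> 'x" assume "\<forall>i\<le>n. x i = x' i"
    then show "?k x = ?k x'"
      by (auto intro!: nn_integral_cong depD[OF d])
  qed
  let ?u = "\<lambda>\<omega> i. if i < Suc n then \<omega> i else x0 i"
  have u: "?u \<in> PiM {0..<Suc n} (\<lambda>_. X) \<rightarrow>\<^sub>M PX"
    using extend_measurable[OF x0, of "{0..<Suc n}"] by simp
  from measurable_compose[OF u k] have ku: "(\<lambda>\<omega>. ?k (?u \<omega>)) \<in> borel_measurable (PiM {0..<Suc n} (\<lambda>_. X))" .
  let ?u' = "\<lambda>\<omega> v i. if i < n then \<omega> i else if i = n then v else x0 i"
  have "(\<integral>\<^sup>+ x. h x \<partial>chain_law X mu M) = (\<integral>\<^sup>+ \<omega>. ?k (?u \<omega>) \<partial>IT.C 0 (Suc n) (\<lambda>_. undefined))"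
    by (subst chain_law_split[OF h d x0])
      (auto simp: chain_step_def fun_upd_def simp del: IT.C.simps intro!: nn_integral_cong arg_cong[where f=h])
  also have "\<dots> = (\<integral>\<^sup>+ \<omega>. \<integral>\<^sup>+ z. ?k (?u z) \<partial>IT.eP n \<omega> \<partial>IT.C 0 n (\<lambda>_. undefined))"
    using IT.measurable_eP[of n] IT.sets_C[of "\<lambda>_. undefined" 0 n] ku
    by (simp, intro nn_integral_bind[where B="PiM {0..<Suc n} (\<lambda>_. X)"])
      (auto cong: measurable_cong_sets)
  also have "\<dots> = (\<integral>\<^sup>+ \<omega>. \<integral>\<^sup>+ v. ?k (?u' \<omega> v) \<partial>chain_step mu M n \<omega>
      \<partial>IT.C 0 n (\<lambda>_. undefined))"
  proof (rule nn_integral_cong)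
    fix \<omega> assume "\<omega> \<in> space (IT.C 0 n (\<lambda>_. undefined))"
    then have w: "\<omega> \<in> space (PiM {0..<n} (\<lambda>_. X))" by (simp add: IT.space_C)
    have "(\<integral>\<^sup>+ z. ?k (?u z) \<partial>IT.eP n \<omega>) = (\<integral>\<^sup>+ v. ?k (?u ((\<omega>)(n := v))) \<partial>chain_step mu M n \<omega>)"
      by (rule IT.nn_integral_eP[OF w ku])
    also have "\<dots> = (\<integral>\<^sup>+ v. ?k (?u' \<omega> v) \<partial>chain_step mu M n \<omega>)"
      by (intro nn_integral_cong depD[OF dk]) auto
    finally show "(\<integral>\<^sup>+ z. ?k (?u z) \<partial>IT.eP n \<omega>) = \<dots>" .
  qed
  also have "\<dots> = (\<integral>\<^sup>+ x. ?k x \<partial>chain_law X mu M)"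
    by (rule chain_law_split[OF k dk x0, symmetric])
  finally show ?thesis .
qed

section \<open>Integrating out the observations given the states\<close>

lemma nn_integral_law:
  assumes f[measurable]: "f \<in> borel_measurable (PX \<Otimes>\<^sub>M PY)"
  shows "(\<integral>\<^sup>+ \<omega>. f \<omega> \<partial>law) = (\<integral>\<^sup>+ x. \<integral>\<^sup>+ y. f (x, y) \<partial>PiM UNIV (\<lambda>t. G (x t)) \<partial>chain_law X mu M)"
proof -
  note [measurable] = measurable_PiM_kernel[OF G]
  have K: "(\<lambda>x. PiM UNIV (\<lambda>t. G (x t)) \<bind> (\<lambda>y. return (PX \<Otimes>\<^sub>M PY) (x, y)))
      \<in> PX \<rightarrow>\<^sub>M prob_algebra (PX \<Otimes>\<^sub>M PY)"
    by (rule measurable_bind_prob_space2[where N="PiM UNIV (\<lambda>_. Y)"]) measurable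
  have "(\<integral>\<^sup>+ \<omega>. f \<omega> \<partial>law) = (\<integral>\<^sup>+ x. \<integral>\<^sup>+ z. f z \<partial>(PiM UNIV (\<lambda>t. G (x t)) \<bind>
       (\<lambda>y. return (PX \<Otimes>\<^sub>M PY) (x, y))) \<partial>chain_law X mu M)"
    unfolding hmm_law_def using measurable_prob_algebraD[OF K]
    by (intro nn_integral_bind[where B="PX \<Otimes>\<^sub>M PY"]) (auto cong: measurable_cong_sets)
  also have "\<dots> = (\<integral>\<^sup>+ x. \<integral>\<^sup>+ y. f (x, y) \<partial>PiM UNIV (\<lambda>t. G (x t)) \<partial>chain_law X mu M)"
  proof (rule nn_integral_cong)
    fix x assume x: "x \<in> space (chain_law X mu M)"
    then have [measurable]: "x \<in> space PX" by simp
    have s: "sets (PiM UNIV (\<lambda>t. G (x t))) = sets PY"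
      using x by (intro sets_PiM_cong refl sets_G) (auto simp: space_PiM)
    have "(\<integral>\<^sup>+ z. f z \<partial>(PiM UNIV (\<lambda>t. G (x t)) \<bind> (\<lambda>y. return (PX \<Otimes>\<^sub>M PY) (x, y)))) =
      (\<integral>\<^sup>+ y. \<integral>\<^sup>+ z. f z \<partial>return (PX \<Otimes>\<^sub>M PY) (x, y) \<partial>PiM UNIV (\<lambda>t. G (x t)))"
      using f by (rule nn_integral_bind) (simp add: measurable_cong_sets[OF s refl])
    also have "\<dots> = (\<integral>\<^sup>+ y. f (x, y) \<partial>PiM UNIV (\<lambda>t. G (x t)))"
      using sets_eq_imp_space_eq[OF s] x
      by (intro nn_integral_cong nn_integral_return) (auto simp: space_pair_measure)
    finally show "(\<integral>\<^sup>+ z. f z \<partial>(PiM UNIV (\<lambda>t. G (x t)) \<bind> (\<lambda>y. return (PX \<Otimes>\<^sub>M PY) (x, y)))) = \<dots>" .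
  qed
  finally show ?thesis .
qed

text \<open>The integrand on the right no longer sees the old coordinate \<open>n\<close>, so that
  integrating this coordinate against the probability \<open>K n\<close> contributes a factor one.
  Used to express a change of one state, which alters the law of exactly one observation, as a
  change of the integrand.\<close>

lemma PiM_resample:
  assumes K: "\<And>t. prob_space (K t)" "\<And>t. sets (K t) = sets Y"
    and K': "prob_space K'" "sets K' = sets Y"
    and f[measurable]: "f \<in> borel_measurable PY"
  shows "(\<integral>\<^sup>+ y. f y \<partial>PiM UNIV (K(n := K'))) = (\<integral>\<^sup>+ y. \<integral>\<^sup>+ v. f (y(n := v)) \<partial>K' \<partial>PiM (UNIV::nat set) K)"
proof -
  note [measurable_cong] = K(2) K'(2)
  interpret K': prob_space K' by fact
  let ?R = "PiM (UNIV - {n}) K"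
  interpret Kn: prob_space "K n" by fact
  interpret R: prob_space ?R by (intro prob_space_PiM K)
  interpret K'R: pair_prob_space K' ?R ..
  interpret KR: pair_prob_space "K n" ?R ..
  let ?RY = "PiM (UNIV - {n}) (\<lambda>_. Y)"
  have sR: "sets ?R = sets (?RY)" by (intro sets_PiM_cong K) auto
  have sK: "sets (PiM UNIV K) = sets PY" by (intro sets_PiM_cong K) auto
  have sK': "sets (PiM UNIV (K(n := K'))) = sets PY" by (intro sets_PiM_cong) (auto simp: K K')
  note [measurable_cong] = sR sK sK'
  have upd: "(\<lambda>z. (snd z)(n := fst z)) \<in> Y \<Otimes>\<^sub>M ?RY \<rightarrow>\<^sub>M PY"
    by (rule measurable_fun_upd[where J="UNIV - {n}"]) auto
  have fu[measurable]: "(\<lambda>z. f ((snd z)(n := fst z))) \<in> borel_measurable (Y \<Otimes>\<^sub>M ?RY)"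
    using measurable_compose[OF upd f] .
  have fu2[measurable]: "(\<lambda>z. f ((snd (fst z))(n := snd z))) \<in> borel_measurable ((Y \<Otimes>\<^sub>M ?RY) \<Otimes>\<^sub>M Y)"
    by (rule measurable_compose[OF _ f], rule measurable_fun_upd[where J="UNIV - {n}"]) auto
  have RK': "PiM (UNIV - {n}) (K(n := K')) = ?R" by (intro PiM_cong) auto
  have ins: "insert n (UNIV - {n}) = UNIV" by auto
  have K'': "prob_space ((K(n := K')) i)" for i using K K' by simp
  have D': "distr (K' \<Otimes>\<^sub>M ?R) (PiM UNIV (K(n := K'))) (\<lambda>(x, X). X(n := x)) = PiM UNIV (K(n := K'))"
    using distr_pair_PiM_eq_PiM[of "UNIV - {n}" "K(n := K')" n, OF K'' K''] unfolding ins RK' fun_upd_same .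
  have D: "distr (K n \<Otimes>\<^sub>M ?R) (PiM UNIV K) (\<lambda>(x, X). X(n := x)) = PiM UNIV K"
    using distr_pair_PiM_eq_PiM[of "UNIV - {n}" "K" n, unfolded ins] K by simp
  have hm[measurable]: "(\<lambda>y. \<integral>\<^sup>+ v. f (y(n := v)) \<partial>K') \<in> borel_measurable PY"
  proof (rule K'.borel_measurable_nn_integral)
    have "(\<lambda>z. (fst z)(n := snd z)) \<in> PY \<Otimes>\<^sub>M Y \<rightarrow>\<^sub>M PY"
      by (intro measurable_fun_upd_UNIV) auto
    from measurable_compose[OF this f]
    show "(\<lambda>(y, v). f (y(n := v))) \<in> borel_measurable (PY \<Otimes>\<^sub>M K')" by (simp add: case_prod_beta cong: measurable_cong_sets)
  qed
  have upd': "(\<lambda>(x, X). X(n := x)) \<in> K' \<Otimes>\<^sub>M ?R \<rightarrow>\<^sub>M PY" "(\<lambda>(x, X). X(n := x)) \<in> K n \<Otimes>\<^sub>M ?R \<rightarrow>\<^sub>M PY"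
    using upd by (auto simp: case_prod_beta cong: measurable_cong_sets)
  have "(\<integral>\<^sup>+ y. f y \<partial>PiM UNIV (K(n := K'))) = (\<integral>\<^sup>+ z. f ((snd z)(n := fst z)) \<partial>(K' \<Otimes>\<^sub>M ?R))"
    by (subst D'[symmetric], subst nn_integral_distr)
      (use upd' in \<open>auto simp: case_prod_beta cong: measurable_cong_sets\<close>)
  also have "\<dots> = (\<integral>\<^sup>+ y. \<integral>\<^sup>+ v. f (y(n := v)) \<partial>K' \<partial>?R)"
    by (subst K'R.nn_integral_snd[symmetric]) (auto simp: case_prod_beta cong: measurable_cong_sets)
  also have "\<dots> = (\<integral>\<^sup>+ z. (\<integral>\<^sup>+ v. f ((snd z)(n := v)) \<partial>K') \<partial>(K n \<Otimes>\<^sub>M ?R))"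
    by (subst R.nn_integral_fst[symmetric])
      (auto simp: Kn.emeasure_space_1 case_prod_beta intro!: K'.borel_measurable_nn_integral fu2 cong: measurable_cong_sets)
  also have "\<dots> = (\<integral>\<^sup>+ y. \<integral>\<^sup>+ v. f (y(n := v)) \<partial>K' \<partial>PiM UNIV K)"
    by (rule trans[OF _ arg_cong[where f="\<lambda>L. nn_integral L _", OF D]], subst nn_integral_distr)
      (use upd' hm in \<open>auto simp: case_prod_beta cong: measurable_cong_sets\<close>)
  finally show ?thesis .
qed

lemma PiM_dep_cong:
  assumes K: "\<And>t. prob_space (K t)" "\<And>t. sets (K t) = sets Y"
    and K': "\<And>t. prob_space (K' t)" "\<And>t. sets (K' t) = sets Y"
    and f[measurable]: "f \<in> borel_measurable PY" and d: "dep n f" and eq: "\<And>t. t \<le> n \<Longrightarrow> K t = K' t"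
  shows "(\<integral>\<^sup>+ y. f y \<partial>PiM UNIV K) = (\<integral>\<^sup>+ y. f y \<partial>PiM (UNIV::nat set) K')"
proof -
  obtain y0 where y0: "y0 \<in> space PY" using PY_ne by blast
  let ?e = "\<lambda>y i. if i \<le> n then y i else y0 i"
  have e [measurable]: "?e \<in> PiM {..n} (\<lambda>_. Y) \<rightarrow>\<^sub>M PY"
    using extend_measurable[OF y0, of "{..n}"] by simp
  have *: "(\<integral>\<^sup>+ y. f y \<partial>PiM UNIV L) = (\<integral>\<^sup>+ y. f (?e y) \<partial>PiM {..n} L)"
    if L: "\<And>t. prob_space (L t)" "\<And>t. sets (L t) = sets Y" for L
  proof -
    interpret product_prob_space L UNIV
      using L by (auto simp: product_prob_space_def product_prob_space_axioms_def
        product_sigma_finite_def intro!: prob_space_imp_sigma_finite)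
    have s: "sets (PiM I L) = sets (PiM I (\<lambda>_. Y))" for I by (intro sets_PiM_cong L) auto
    have "(\<integral>\<^sup>+ y. f y \<partial>PiM UNIV L) = (\<integral>\<^sup>+ y. f (?e (restrict y {..n})) \<partial>PiM UNIV L)"
      by (intro nn_integral_cong depD[OF d]) auto
    also have "\<dots> = (\<integral>\<^sup>+ y. f (?e y) \<partial>distr (PiM UNIV L) (PiM {..n} L) (\<lambda>y. restrict y {..n}))"
      using measurable_restrict_subset[of "{..n}" UNIV L]
      by (subst nn_integral_distr) (auto simp: measurable_cong_sets[OF s refl])
    also have "distr (PiM UNIV L) (PiM {..n} L) (\<lambda>y. restrict y {..n}) = PiM {..n} L"
      by (rule distr_PiM_restrict_finite) auto
    finally show ?thesis .
  qed
  have "PiM {..n} K = PiM {..n} K'" using eq by (intro PiM_cong) auto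
  then show ?thesis using *[OF K] *[OF K'] by simp
qed

lemma measurable_PiM_law:
  assumes f[measurable]: "f \<in> borel_measurable (PX \<Otimes>\<^sub>M PY)"
  shows "(\<lambda>x. \<integral>\<^sup>+ y. f (x, y) \<partial>PiM UNIV (\<lambda>t. G (x t))) \<in> borel_measurable PX"
  using measurable_prob_algebraD[OF measurable_PiM_kernel[OF G]]
  by (intro nn_integral_measurable_subprob_algebra2[where N=PY]) auto

lemma dep_PiM_law:
  assumes f[measurable]: "f \<in> borel_measurable (PX \<Otimes>\<^sub>M PY)" and a: "adapted n f"
    and x: "x \<in> space PX" "x' \<in> space PX" "\<And>i. i \<le> n \<Longrightarrow> x i = x' i"
  shows "(\<integral>\<^sup>+ y. f (x, y) \<partial>PiM UNIV (\<lambda>t. G (x t))) = (\<integral>\<^sup>+ y. f (x', y) \<partial>PiM UNIV (\<lambda>t. G (x' t)))"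
proof -
  have xi: "x t \<in> space X" "x' t \<in> space X" for t using x by (auto simp: space_PiM)
  have "(\<integral>\<^sup>+ y. f (x, y) \<partial>PiM UNIV (\<lambda>t. G (x t))) = (\<integral>\<^sup>+ y. f (x', y) \<partial>PiM UNIV (\<lambda>t. G (x t)))"
    by (intro nn_integral_cong adaptedD[OF a] x) auto
  also have "\<dots> = (\<integral>\<^sup>+ y. f (x', y) \<partial>PiM UNIV (\<lambda>t. G (x' t)))"
  proof (rule PiM_dep_cong[where n=n])
    show "(\<lambda>y. f (x', y)) \<in> borel_measurable PY" using x(2) by measurable
    show "dep n (\<lambda>y. f (x', y))" unfolding dep_def by (auto intro!: adaptedD[OF a])
  qed (use xi x in \<open>auto simp: G_prob\<close>)
  finally show ?thesis .
qed

section \<open>One step of states and observations jointly\<close>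

lemma one_step_measurable:
  assumes f[measurable]: "f \<in> borel_measurable (PX \<Otimes>\<^sub>M PY)"
  shows "(\<lambda>(\<omega>, v). \<integral>\<^sup>+ u. f (upd k \<omega> v u) \<partial>G v) \<in> borel_measurable ((PX \<Otimes>\<^sub>M PY) \<Otimes>\<^sub>M X)"
    and "(\<lambda>\<omega>. \<integral>\<^sup>+ v. \<integral>\<^sup>+ u. f (upd k \<omega> v u) \<partial>G v \<partial>M (fst \<omega> n)) \<in> borel_measurable (PX \<Otimes>\<^sub>M PY)"
proof -
  have "(\<lambda>z. upd k (fst (fst z)) (snd (fst z)) (snd z)) \<in> ((PX \<Otimes>\<^sub>M PY) \<Otimes>\<^sub>M X) \<Otimes>\<^sub>M Y \<rightarrow>\<^sub>M PX \<Otimes>\<^sub>M PY"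
    by (intro measurable_Pair measurable_fun_upd_UNIV) auto
  from measurable_compose[OF this f]
  have fu: "(\<lambda>(z, u). f (upd k (fst z) (snd z) u)) \<in> borel_measurable (((PX \<Otimes>\<^sub>M PY) \<Otimes>\<^sub>M X) \<Otimes>\<^sub>M Y)"
    by (simp add: case_prod_beta)
  show 1[measurable]: "(\<lambda>(\<omega>, v). \<integral>\<^sup>+ u. f (upd k \<omega> v u) \<partial>G v) \<in> borel_measurable ((PX \<Otimes>\<^sub>M PY) \<Otimes>\<^sub>M X)"
    using nn_integral_G_measurable[OF fu, of snd] by (simp add: case_prod_beta)
  show "(\<lambda>\<omega>. \<integral>\<^sup>+ v. \<integral>\<^sup>+ u. f (upd k \<omega> v u) \<partial>G v \<partial>M (fst \<omega> n)) \<in> borel_measurable (PX \<Otimes>\<^sub>M PY)"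
    by (rule nn_integral_M_measurable) measurable
qed

text \<open>\<open>dep\<close> speaks about all sequences, while the observation laws are controlled
  only for states in \<open>X\<close>. The map \<open>e\<close> therefore first moves every
  coordinate into the space and leaves sequences in \<open>PX\<close> unchanged; this makes
  \<open>dep n h\<close> hold on all sequences.\<close>

lemma integrate_observations:
  assumes f: "f \<in> borel_measurable (PX \<Otimes>\<^sub>M PY)" and a: "adapted n f"
  obtains h where "h \<in> borel_measurable PX" "dep n h"
    "\<And>x. x \<in> space PX \<Longrightarrow> h x = (\<integral>\<^sup>+ y. f (x, y) \<partial>PiM UNIV (\<lambda>t. G (x t)))"
    "(\<integral>\<^sup>+ \<omega>. f \<omega> \<partial>law) = (\<integral>\<^sup>+ x. h x \<partial>chain_law X mu M)"
proof -
  obtain x0 where x0: "x0 \<in> space PX" using PX_ne by blast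
  define e where "e x = (\<lambda>i. if x i \<in> space X then x i else x0 i)" for x
  define h where "h x = (\<integral>\<^sup>+ y. f (e x, y) \<partial>PiM UNIV (\<lambda>t. G (e x t)))" for x
  have eid: "e x = x" if "x \<in> space PX" for x using that unfolding e_def by (intro ext) (auto simp: space_PiM PiE_iff)
  have esp: "e x \<in> space PX" for x using x0 by (auto simp: space_PiM PiE_iff e_def)
  show ?thesis
  proof
    show "h \<in> borel_measurable PX"
      using measurable_PiM_law[OF f] eid by (simp add: h_def cong: measurable_cong)
    show "dep n h"
      unfolding dep_def h_def by (intro allI impI dep_PiM_law[OF f a] esp) (auto simp: e_def)
    show "h x = (\<integral>\<^sup>+ y. f (x, y) \<partial>PiM UNIV (\<lambda>t. G (x t)))" if "x \<in> space PX" for x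
      by (simp add: h_def eid[OF that])
    then show "(\<integral>\<^sup>+ \<omega>. f \<omega> \<partial>law) = (\<integral>\<^sup>+ x. h x \<partial>chain_law X mu M)"
      unfolding nn_integral_law[OF f] by (intro nn_integral_cong) simp
  qed
qed

text \<open>A new state at time \<open>Suc n\<close> changes a single factor of the product law of
  the observations; resampling that factor puts the new state and its observation into the
  integrand. Given the old states, the remaining observations and the new state are independent, so
  Fubini brings the integrals into the order of the joint law.\<close>

lemma law_Suc:
  assumes f[measurable]: "f \<in> borel_measurable (PX \<Otimes>\<^sub>M PY)" and a: "adapted (Suc n) f"
  shows "(\<integral>\<^sup>+ \<omega>. f \<omega> \<partial>law) =
    (\<integral>\<^sup>+ \<omega>. \<integral>\<^sup>+ v. \<integral>\<^sup>+ u. f (upd (Suc n) \<omega> v u) \<partial>G v \<partial>M (fst \<omega> n) \<partial>law)"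
proof -
  obtain h where h: "h \<in> borel_measurable PX" "dep (Suc n) h"
    and eq: "\<And>x. x \<in> space PX \<Longrightarrow> h x = (\<integral>\<^sup>+ y. f (x, y) \<partial>PiM UNIV (\<lambda>t. G (x t)))"
    and f_h: "(\<integral>\<^sup>+ \<omega>. f \<omega> \<partial>law) = (\<integral>\<^sup>+ x. h x \<partial>chain_law X mu M)"
    by (rule integrate_observations[OF f a]) blast
  note fG = one_step_measurable(1)[OF f, where k="Suc n"]
  note fM = one_step_measurable(2)[OF f, where k="Suc n" and n=n]
  have "(\<integral>\<^sup>+ \<omega>. f \<omega> \<partial>law) = (\<integral>\<^sup>+ x. \<integral>\<^sup>+ v. h (x(Suc n := v)) \<partial>M (x n) \<partial>chain_law X mu M)"
    unfolding f_h by (rule chain_law_Suc[OF h])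
  also have "\<dots> = (\<integral>\<^sup>+ x. \<integral>\<^sup>+ y. \<integral>\<^sup>+ v. \<integral>\<^sup>+ u. f (x(Suc n := v), y(Suc n := u)) \<partial>G v \<partial>M (x n)
      \<partial>PiM UNIV (\<lambda>t. G (x t)) \<partial>chain_law X mu M)"
  proof (rule nn_integral_cong)
    fix x assume "x \<in> space (chain_law X mu M)"
    then have x: "x \<in> space PX" by simp
    then have xi: "x t \<in> space X" for t by (auto simp: space_PiM)
    have s: "sets (PiM UNIV (\<lambda>t. G (x t))) = sets PY" by (intro sets_PiM_cong refl sets_G xi)
    interpret Mx: prob_space "M (x n)" by (rule M_prob[OF xi])
    interpret Gx: prob_space "PiM UNIV (\<lambda>t. G (x t))" by (intro prob_space_PiM G_prob xi)
    interpret MG: pair_prob_space "M (x n)" "PiM UNIV (\<lambda>t. G (x t))" ..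
    have "(\<integral>\<^sup>+ v. h (x(Suc n := v)) \<partial>M (x n)) =
      (\<integral>\<^sup>+ v. \<integral>\<^sup>+ y. \<integral>\<^sup>+ u. f (x(Suc n := v), y(Suc n := u)) \<partial>G v \<partial>PiM UNIV (\<lambda>t. G (x t)) \<partial>M (x n))"
    proof (rule nn_integral_cong)
      fix v assume "v \<in> space (M (x n))"
      then have v: "v \<in> space X" using xi by simp
      have xv: "x(Suc n := v) \<in> space PX" using x v by (auto simp: space_PiM)
      have "h (x(Suc n := v)) = (\<integral>\<^sup>+ y. f (x(Suc n := v), y) \<partial>PiM UNIV ((\<lambda>t. G (x t))(Suc n := G v)))"
        unfolding eq[OF xv] by (intro arg_cong2[where f=nn_integral] PiM_cong) auto
      also have "\<dots> = (\<integral>\<^sup>+ y. \<integral>\<^sup>+ u. f (x(Suc n := v), y(Suc n := u)) \<partial>G v \<partial>PiM UNIV (\<lambda>t. G (x t)))"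
        using xv v xi by (intro PiM_resample) (auto simp: G_prob)
      finally show "h (x(Suc n := v)) = \<dots>" .
    qed
    also have "\<dots> = (\<integral>\<^sup>+ y. \<integral>\<^sup>+ v. \<integral>\<^sup>+ u. f (x(Suc n := v), y(Suc n := u)) \<partial>G v \<partial>M (x n) \<partial>PiM UNIV (\<lambda>t. G (x t)))"
    proof (rule MG.Fubini'[symmetric])
      have "(\<lambda>z. ((x, snd z), fst z)) \<in> X \<Otimes>\<^sub>M PY \<rightarrow>\<^sub>M (PX \<Otimes>\<^sub>M PY) \<Otimes>\<^sub>M X" using x by measurable
      from measurable_compose[OF this fG]
      show "(\<lambda>(v, y). \<integral>\<^sup>+ u. f (x(Suc n := v), y(Suc n := u)) \<partial>G v) \<in> borel_measurable (M (x n) \<Otimes>\<^sub>M PiM UNIV (\<lambda>t. G (x t)))"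
        using xi[of n] s by (simp add: case_prod_beta cong: measurable_cong_sets sets_pair_measure_cong)
    qed
    finally show "(\<integral>\<^sup>+ v. h (x(Suc n := v)) \<partial>M (x n)) = \<dots>" .
  qed
  also have "\<dots> = (\<integral>\<^sup>+ \<omega>. \<integral>\<^sup>+ v. \<integral>\<^sup>+ u. f (upd (Suc n) \<omega> v u) \<partial>G v \<partial>M (fst \<omega> n) \<partial>law)"
    by (subst nn_integral_law[OF fM]) simp
  finally show ?thesis .
qed

lemma law_0:
  assumes f[measurable]: "f \<in> borel_measurable (PX \<Otimes>\<^sub>M PY)" and a: "adapted 0 f"
    and x0: "x0 \<in> space PX" and y0: "y0 \<in> space PY"
  shows "(\<integral>\<^sup>+ \<omega>. f \<omega> \<partial>law) = (\<integral>\<^sup>+ v. \<integral>\<^sup>+ u. f (x0(0 := v), y0(0 := u)) \<partial>G v \<partial>mu)"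
proof -
  have x0i: "x0 i \<in> space X" for i using x0 by (auto simp: space_PiM)
  obtain h where h: "h \<in> borel_measurable PX" "dep 0 h"
    and eq: "\<And>x. x \<in> space PX \<Longrightarrow> h x = (\<integral>\<^sup>+ y. f (x, y) \<partial>PiM UNIV (\<lambda>t. G (x t)))"
    and f_h: "(\<integral>\<^sup>+ \<omega>. f \<omega> \<partial>law) = (\<integral>\<^sup>+ x. h x \<partial>chain_law X mu M)"
    by (rule integrate_observations[OF f a]) blast
  have "(\<integral>\<^sup>+ \<omega>. f \<omega> \<partial>law) = (\<integral>\<^sup>+ v. h (x0(0 := v)) \<partial>mu)"
    unfolding f_h by (rule chain_law_0[OF h x0])
  also have "\<dots> = (\<integral>\<^sup>+ v. \<integral>\<^sup>+ u. f (x0(0 := v), y0(0 := u)) \<partial>G v \<partial>mu)"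
  proof (rule nn_integral_cong)
    fix v assume "v \<in> space mu"
    then have v: "v \<in> space X" by simp
    have xv: "x0(0 := v) \<in> space PX" using x0 v by (auto simp: space_PiM)
    interpret G0: prob_space "PiM (UNIV::nat set) (\<lambda>t. G (x0 t))" by (intro prob_space_PiM G_prob x0i)
    have "h (x0(0 := v)) = (\<integral>\<^sup>+ y. f (x0(0 := v), y) \<partial>PiM UNIV ((\<lambda>t. G (x0 t))(0 := G v)))"
      unfolding eq[OF xv] by (intro arg_cong2[where f=nn_integral] PiM_cong) auto
    also have "\<dots> = (\<integral>\<^sup>+ y. \<integral>\<^sup>+ u. f (x0(0 := v), y(0 := u)) \<partial>G v \<partial>PiM UNIV (\<lambda>t. G (x0 t)))"
      using xv v x0i by (intro PiM_resample) (auto simp: G_prob)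
    \<comment> \<open>Beyond time 0 the observations may be replaced by those of \<open>y0\<close>,
      as \<open>f\<close> is adapted to time 0; the outer integral then has a constant integrand and
      total mass one.\<close>
    also have "\<dots> = (\<integral>\<^sup>+ y. \<integral>\<^sup>+ u. f (x0(0 := v), y0(0 := u)) \<partial>G v \<partial>PiM UNIV (\<lambda>t. G (x0 t)))"
      by (intro nn_integral_cong adaptedD[OF a]) auto
    also have "\<dots> = (\<integral>\<^sup>+ u. f (x0(0 := v), y0(0 := u)) \<partial>G v)"
      by (simp add: G0.emeasure_space_1)
    finally show "h (x0(0 := v)) = \<dots>" .
  qed
  finally show ?thesis .
qed

lemma law_initial:
  assumes f[measurable]: "f \<in> borel_measurable X"
  shows "(\<integral>\<^sup>+ \<omega>. f (fst \<omega> 0) \<partial>law) = (\<integral>\<^sup>+ x. f x \<partial>mu)"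
proof -
  obtain x0 y0 where x0: "x0 \<in> space PX" and y0: "y0 \<in> space PY"
    using PX_ne PY_ne by blast
  have "(\<integral>\<^sup>+ \<omega>. f (fst \<omega> 0) \<partial>law) = (\<integral>\<^sup>+ v. \<integral>\<^sup>+ u. f v \<partial>G v \<partial>mu)"
    by (subst law_0[OF _ _ x0 y0]) (auto simp: adapted_def)
  also have "\<dots> = (\<integral>\<^sup>+ v. f v \<partial>mu)"
    using prob_space.emeasure_space_1[OF G_prob] by (intro nn_integral_cong) simp
  finally show ?thesis .
qed

lemma AE_law_initial:
  assumes [measurable]: "Measurable.pred X P"
  shows "(AE \<omega> in law. P (fst \<omega> 0)) \<longleftrightarrow> (AE x in mu. P x)"
proof -
  let ?f = "\<lambda>x. if P x then 0 else 1 :: ennreal"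
  have "(AE \<omega> in law. P (fst \<omega> 0)) \<longleftrightarrow> (\<integral>\<^sup>+ \<omega>. ?f (fst \<omega> 0) \<partial>law) = 0"
    by (subst nn_integral_0_iff_AE) (auto intro!: AE_cong)
  also have "\<dots> \<longleftrightarrow> (\<integral>\<^sup>+ x. ?f x \<partial>mu) = 0"
    by (subst law_initial) auto
  also have "\<dots> \<longleftrightarrow> (AE x in mu. P x)"
    by (subst nn_integral_0_iff_AE) (auto intro!: AE_cong)
  finally show ?thesis .
qed

end

section \<open>Likelihoods as iterated integrals\<close>

definition mix :: "nat set \<Rightarrow> (nat \<Rightarrow> 'a) \<Rightarrow> (nat \<Rightarrow> 'a) \<Rightarrow> nat \<Rightarrow> 'a" where
  "mix J y z = (\<lambda>i. if i \<in> J then z i else y i)"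

text \<open>The result is again a function on the full sequence space. Integrals over disjoint sets
  of times can therefore be nested and reordered without changing the domain of the
  functions.\<close>

definition Iint :: "'y measure \<Rightarrow> nat set \<Rightarrow> ((nat \<Rightarrow> 'y) \<Rightarrow> ennreal) \<Rightarrow> (nat \<Rightarrow> 'y) \<Rightarrow> ennreal" where
  "Iint kappa J h y = (\<integral>\<^sup>+ z. h (mix J y z) \<partial>PiM J (\<lambda>_. kappa))"

lemma mix_measurable:
  assumes "sets kappa = sets Y"
  shows "(\<lambda>(y, z). mix J y z) \<in> PiM UNIV (\<lambda>_. Y) \<Otimes>\<^sub>M PiM J (\<lambda>_. kappa) \<rightarrow>\<^sub>M PiM UNIV (\<lambda>_. Y)"
proof (rule measurable_PiM_single')
  have s: "sets (PiM J (\<lambda>_. kappa)) = sets (PiM J (\<lambda>_. Y))" by (intro sets_PiM_cong refl assms)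
  note [measurable_cong] = s
  fix i :: nat
  show "(\<lambda>\<omega>. (case \<omega> of (y, z) \<Rightarrow> mix J y z) i) \<in> PiM UNIV (\<lambda>_. Y) \<Otimes>\<^sub>M PiM J (\<lambda>_. kappa) \<rightarrow>\<^sub>M Y"
    by (cases "i \<in> J") (auto simp: mix_def case_prod_beta)
  show "(\<lambda>\<omega> i. (case \<omega> of (y, z) \<Rightarrow> mix J y z) i) \<in> space (PiM UNIV (\<lambda>_. Y) \<Otimes>\<^sub>M PiM J (\<lambda>_. kappa)) \<rightarrow> (\<Pi>\<^sub>E i\<in>UNIV. space Y)"
    using sets_eq_imp_space_eq[OF assms] by (auto simp: mix_def space_pair_measure space_PiM PiE_iff)
qed

locale kappa_measure =
  fixes Y kappa :: "'y measure"
  assumes kappa_sigma_finite: "sigma_finite_measure kappa"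
    and sets_kappa: "sets kappa = sets Y"
begin

abbreviation "PYk \<equiv> PiM (UNIV :: nat set) (\<lambda>_. Y)"

lemma space_kappa: "space kappa = space Y"
  using sets_eq_imp_space_eq[OF sets_kappa] .

sublocale K: product_sigma_finite "\<lambda>_ :: nat. kappa"
  by (simp add: product_sigma_finite_def kappa_sigma_finite)

lemma sigma_finite_PiM_kappa: "finite (J :: nat set) \<Longrightarrow> sigma_finite_measure (PiM J (\<lambda>_. kappa))"
  using K.sigma_finite[of J] .

lemma mix_space: "y \<in> space PYk \<Longrightarrow> z \<in> space (PiM J (\<lambda>_. kappa)) \<Longrightarrow> mix J y z \<in> space PYk"
  using measurable_space[OF mix_measurable[OF sets_kappa, of J], of "(y, z)"] by (simp add: space_pair_measure)

lemma mix_measurable1: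
  assumes "y \<in> space PYk"
  shows "(\<lambda>z. mix J y z) \<in> PiM J (\<lambda>_. kappa) \<rightarrow>\<^sub>M PYk"
  using measurable_compose[OF measurable_Pair1'[OF assms] mix_measurable[OF sets_kappa, of J]] by simp

lemma mix_measurable_comp:
  assumes "a \<in> N \<rightarrow>\<^sub>M PYk" "b \<in> N \<rightarrow>\<^sub>M PiM J (\<lambda>_. kappa)"
  shows "(\<lambda>t. mix J (a t) (b t)) \<in> N \<rightarrow>\<^sub>M PYk"
  using measurable_compose[OF measurable_Pair[OF assms] mix_measurable[OF sets_kappa, of J]] by simp

lemma Iint_measurable_param:
  assumes f: "(\<lambda>(a, y). f a y) \<in> borel_measurable (W \<Otimes>\<^sub>M PYk)" and J: "finite J"
  shows "(\<lambda>(a, y). Iint kappa J (f a) y) \<in> borel_measurable (W \<Otimes>\<^sub>M PYk)"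
proof -
  interpret PK: sigma_finite_measure "PiM J (\<lambda>_. kappa)" using J by (rule sigma_finite_PiM_kappa)
  have "(\<lambda>t. (fst (fst t), mix J (snd (fst t)) (snd t))) \<in> (W \<Otimes>\<^sub>M PYk) \<Otimes>\<^sub>M PiM J (\<lambda>_. kappa) \<rightarrow>\<^sub>M W \<Otimes>\<^sub>M PYk"
    by (intro measurable_Pair mix_measurable_comp) auto
  from measurable_compose[OF this f] show ?thesis
    unfolding Iint_def case_prod_beta by (intro PK.borel_measurable_nn_integral) (simp add: case_prod_beta)
qed

lemma Iint_measurable [measurable]:
  assumes "f \<in> borel_measurable PYk" and J: "finite J"
  shows "Iint kappa J f \<in> borel_measurable PYk"
proof -
  have "(\<lambda>(a, y). f y) \<in> borel_measurable (count_space (UNIV::unit set) \<Otimes>\<^sub>M PYk)"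
    using assms by measurable
  from measurable_compose[OF measurable_Pair1'[of "()"] Iint_measurable_param[OF this J]] show ?thesis by simp
qed

lemma Iint_mono: "y \<in> space PYk \<Longrightarrow> (\<And>y'. y' \<in> space PYk \<Longrightarrow> (\<And>i. i \<notin> J \<Longrightarrow> y' i = y i) \<Longrightarrow> f y' \<le> h y') \<Longrightarrow> Iint kappa J f y \<le> Iint kappa J h y"
  unfolding Iint_def by (intro nn_integral_mono) (metis mix_space mix_def)

lemma Iint_cong: "y \<in> space PYk \<Longrightarrow> (\<And>y'. y' \<in> space PYk \<Longrightarrow> (\<And>i. i \<notin> J \<Longrightarrow> y' i = y i) \<Longrightarrow> f y' = h y') \<Longrightarrow> Iint kappa J f y = Iint kappa J h y"
  by (intro antisym Iint_mono) auto

lemma Iint_cmult: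
  assumes f: "f \<in> borel_measurable PYk" and y: "y \<in> space PYk"
    and c: "\<And>y'. (\<And>i. i \<notin> J \<Longrightarrow> y' i = y i) \<Longrightarrow> c y' = c y"
  shows "Iint kappa J (\<lambda>y. c y * f y) y = c y * Iint kappa J f y"
proof -
  have "c (mix J y z) = c y" for z by (rule c) (auto simp: mix_def)
  then show ?thesis
    unfolding Iint_def using measurable_compose[OF mix_measurable1[OF y] f]
    by (simp add: nn_integral_cmult)
qed

lemma Iint_empty [simp]: "Iint kappa {} f y = f y"
  by (simp add: Iint_def mix_def PiM_empty nn_integral_count_space_finite)

lemma Iint_singleton:
  assumes f: "f \<in> borel_measurable PYk" and y: "y \<in> space PYk"
  shows "Iint kappa {k} f y = (\<integral>\<^sup>+ v. f (y(k := v)) \<partial>kappa)"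
proof -
  have 1: "(\<lambda>v. y(k := v)) \<in> kappa \<rightarrow>\<^sub>M PYk"
    using y by (intro measurable_fun_upd_UNIV) (auto simp: measurable_cong_sets[OF sets_kappa refl])
  have "Iint kappa {k} f y = (\<integral>\<^sup>+ z. f (y(k := z k)) \<partial>PiM {k} (\<lambda>_. kappa))"
    unfolding Iint_def by (intro nn_integral_cong arg_cong[where f=f]) (auto simp: mix_def)
  also have "\<dots> = (\<integral>\<^sup>+ v. f (y(k := v)) \<partial>kappa)"
    using measurable_compose[OF 1 f] by (rule K.product_nn_integral_singleton)
  finally show ?thesis .
qed

lemma Iint_union:
  assumes f: "f \<in> borel_measurable PYk" and y: "y \<in> space PYk"
    and J: "finite J" "finite L" "J \<inter> L = {}"
  shows "Iint kappa (J \<union> L) f y = Iint kappa J (Iint kappa L f) y"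
proof -
  have m: "(\<lambda>z. f (mix (J \<union> L) y z)) \<in> borel_measurable (PiM (J \<union> L) (\<lambda>_. kappa))"
    using measurable_compose[OF mix_measurable1[OF y] f] .
  show ?thesis
    unfolding Iint_def K.product_nn_integral_fold[OF J(3,1,2) m]
    using J(3) by (intro nn_integral_cong arg_cong[where f=f]) (auto simp: mix_def merge_def fun_eq_iff)
qed

lemma Iint_insert:
  assumes f: "f \<in> borel_measurable PYk" and y: "y \<in> space PYk" and J: "finite J" "k \<notin> J"
  shows "Iint kappa (insert k J) f y = (\<integral>\<^sup>+ v. Iint kappa J f (y(k := v)) \<partial>kappa)"
  using Iint_union[OF f y, of "{k}" J] Iint_singleton[OF Iint_measurable[OF f J(1)] y, of k] J by simp

lemma Iint_swap:
  assumes W: "sigma_finite_measure W" and f: "(\<lambda>(a, y). f a y) \<in> borel_measurable (W \<Otimes>\<^sub>M PYk)"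
    and y: "y \<in> space PYk" and J: "finite J"
  shows "(\<integral>\<^sup>+ a. Iint kappa J (f a) y \<partial>W) = Iint kappa J (\<lambda>y. \<integral>\<^sup>+ a. f a y \<partial>W) y"
proof -
  interpret W: sigma_finite_measure W by fact
  interpret PK: sigma_finite_measure "PiM J (\<lambda>_. kappa)" using J by (rule sigma_finite_PiM_kappa)
  interpret P: pair_sigma_finite "PiM J (\<lambda>_. kappa)" W ..
  have "(\<lambda>t. (snd t, mix J y (fst t))) \<in> PiM J (\<lambda>_. kappa) \<Otimes>\<^sub>M W \<rightarrow>\<^sub>M W \<Otimes>\<^sub>M PYk"
    by (intro measurable_Pair mix_measurable_comp) (use y in auto)
  from measurable_compose[OF this f] show ?thesis
    unfolding Iint_def by (intro P.Fubini') (simp add: case_prod_beta)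
qed

end

locale hmm_density = hmm X Y mu M G + kappa_measure Y kappa
  for X :: "'x measure" and Y :: "'y measure" and kappa :: "'y measure" and mu :: "'x measure"
    and M :: "'x \<Rightarrow> 'x measure" and G :: "'x \<Rightarrow> 'y measure" +
  fixes g :: "'x \<Rightarrow> 'y \<Rightarrow> real"
  assumes g_measurable: "(\<lambda>(x, y). g x y) \<in> borel_measurable (X \<Otimes>\<^sub>M Y)"
    and g_nonneg: "\<And>x y. x \<in> space X \<Longrightarrow> y \<in> space Y \<Longrightarrow> 0 \<le> g x y"
    and g_density: "\<And>x. x \<in> space X \<Longrightarrow> G x = density kappa (\<lambda>y. ennreal (g x y))"
begin

lemma g_measurable_comp [measurable (raw)]:
  "f \<in> N \<rightarrow>\<^sub>M X \<Longrightarrow> h \<in> N \<rightarrow>\<^sub>M Y \<Longrightarrow> (\<lambda>a. g (f a) (h a)) \<in> borel_measurable N"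
  using measurable_compose[OF measurable_Pair g_measurable] by simp

lemma PY_comp: "y \<in> space PY \<Longrightarrow> y i \<in> space Y" by (auto simp: space_PiM)

lemma PY_upd: "y \<in> space PY \<Longrightarrow> v \<in> space Y \<Longrightarrow> y(i := v) \<in> space PY"
  by (auto simp: space_PiM)

section \<open>Recursions for the compositions of likelihood kernels\<close>

lemma nn_integral_G:
  assumes x: "x \<in> space X" and f: "f \<in> borel_measurable Y"
  shows "(\<integral>\<^sup>+ u. f u \<partial>G x) = (\<integral>\<^sup>+ u. ennreal (g x u) * f u \<partial>kappa)"
  unfolding g_density[OF x] using x f
  by (intro nn_integral_density) (auto simp: measurable_cong_sets[OF sets_kappa refl])

lemma nn_integral_g: "x \<in> space X \<Longrightarrow> (\<integral>\<^sup>+ u. ennreal (g x u) \<partial>kappa) = 1"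
  using nn_integral_G[of x "\<lambda>_. 1"] prob_space.emeasure_space_1[OF G_prob[of x]] by simp

text \<open>Measurability appears as an assumption because it is itself proved by induction through
  this recursion.\<close>

lemma Q_one_Suc_aux:
  assumes "(\<lambda>x'. Q_one M g y (Suc s) n x') \<in> borel_measurable X" "x \<in> space X" "y \<in> space PY"
  shows "Q_one M g y s (Suc n) x = (\<integral>\<^sup>+ x'. ennreal (g x' (y s)) * Q_one M g y (Suc s) n x' \<partial>M x)"
  unfolding Q_one.simps Q_ker_def using assms measurable_cong_sets[OF sets_M[OF assms(2)] refl]
  by (intro nn_integral_density) (auto simp: PY_comp)

lemma Q_one_measurable: "(\<lambda>(x, y). Q_one M g y s n x) \<in> borel_measurable (X \<Otimes>\<^sub>M PY)"
proof (induction n arbitrary: s)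
  case (Suc n)
  have [measurable]: "(\<lambda>t. Q_one M g (snd (fst t)) (Suc s) n (snd t)) \<in> borel_measurable ((X \<Otimes>\<^sub>M PY) \<Otimes>\<^sub>M X)"
    using measurable_compose[OF _ Suc[of "Suc s"], of "\<lambda>t. (snd t, snd (fst t))" "(X \<Otimes>\<^sub>M PY) \<Otimes>\<^sub>M X"] by simp
  have 1: "(\<lambda>w. \<integral>\<^sup>+ x'. ennreal (g x' (snd w s)) * Q_one M g (snd w) (Suc s) n x' \<partial>M (fst w)) \<in> borel_measurable (X \<Otimes>\<^sub>M PY)"
    by (rule nn_integral_M_measurable) (auto simp: case_prod_beta)
  have 2: "(\<lambda>x'. Q_one M g y (Suc s) n x') \<in> borel_measurable X" if "y \<in> space PY" for y
    using measurable_compose[OF measurable_Pair2'[OF that] Suc[of "Suc s"]] by simp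
  show ?case
    by (rule measurable_cong[THEN iffD1, OF _ 1])
      (auto simp: Q_one_Suc_aux[OF 2] space_pair_measure simp del: Q_one.simps)
qed simp

lemma Q_one_Suc: "x \<in> space X \<Longrightarrow> y \<in> space PY \<Longrightarrow>
    Q_one M g y s (Suc n) x = (\<integral>\<^sup>+ x'. ennreal (g x' (y s)) * Q_one M g y (Suc s) n x' \<partial>M x)"
  using measurable_compose[OF measurable_Pair2' Q_one_measurable[of "Suc s" n], of y]
  by (intro Q_one_Suc_aux) auto

declare Q_one.simps(2) [simp del]

lemma Q_one_measurable_comp [measurable (raw)]:
  "f \<in> N \<rightarrow>\<^sub>M X \<Longrightarrow> h \<in> N \<rightarrow>\<^sub>M PY \<Longrightarrow> (\<lambda>a. Q_one M g (h a) s n (f a)) \<in> borel_measurable N"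
  using measurable_compose[OF measurable_Pair Q_one_measurable] by simp

lemma Q_one_cong: "(\<And>i. s \<le> i \<Longrightarrow> i < s + n \<Longrightarrow> y i = y' i) \<Longrightarrow> Q_one M g y s n x = Q_one M g y' s n x"
proof (induction n arbitrary: s x)
  case (Suc n)
  have "Q_one M g y (Suc s) n = Q_one M g y' (Suc s) n"
    using Suc.prems by (intro ext Suc.IH) auto
  moreover have "y s = y' s" using Suc.prems by auto
  ultimately show ?case by (simp add: Q_one.simps)
qed simp

text \<open>Carries the measurability of the sup norms, which the model provides for start time 0,
  to every start time.\<close>

lemma Q_one_shift: "Q_one M g y (s + k) n x = Q_one M g (\<lambda>i. y (i + k)) s n x"
proof (induction n arbitrary: s x)
  case (Suc n)
  have "Q_one M g y (Suc s + k) n = Q_one M g (\<lambda>i. y (i + k)) (Suc s) n"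
    by (intro ext Suc.IH)
  then show ?case by (simp add: Q_one.simps)
qed simp

lemma nn_integral_swap_M:
  assumes x: "x \<in> space X" and f: "(\<lambda>(a, v). f a v) \<in> borel_measurable (X \<Otimes>\<^sub>M Y)"
  shows "(\<integral>\<^sup>+ v. \<integral>\<^sup>+ a. f a v \<partial>M x \<partial>kappa) = (\<integral>\<^sup>+ a. \<integral>\<^sup>+ v. f a v \<partial>kappa \<partial>M x)"
proof -
  interpret Mx: prob_space "M x" by (rule M_prob[OF x])
  interpret kappa: sigma_finite_measure kappa by (rule kappa_sigma_finite)
  interpret P: pair_sigma_finite "M x" kappa ..
  show ?thesis
    using f x by (intro P.Fubini') (auto simp: measurable_cong_sets[OF sets_pair_measure_cong[OF sets_M[OF x] sets_kappa] refl])
qed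

text \<open>\<open>W\<close> is kept general because the same computation serves a transition
  kernel, the initial law and \<lambda>. The factor \<open>g x (y j)\<close> does not involve the
  updated observation, so Tonelli moves the integral over that observation directly to the
  kernels.\<close>

lemma integrate_last_aux:
  assumes W: "sigma_finite_measure W" "sets W = sets X" and y: "y \<in> space PY"
    and last: "\<And>x. x \<in> space X \<Longrightarrow> (\<integral>\<^sup>+ v. Q_one M g (y(s + n := v)) s (Suc n) x \<partial>kappa) = Q_one M g y s n x"
  shows "(\<integral>\<^sup>+ v. \<integral>\<^sup>+ x. ennreal (g x (y j)) * Q_one M g (y(s + n := v)) s (Suc n) x \<partial>W \<partial>kappa) =
    (\<integral>\<^sup>+ x. ennreal (g x (y j)) * Q_one M g y s n x \<partial>W)"
proof -
  interpret W: sigma_finite_measure W by fact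
  interpret kappa: sigma_finite_measure kappa by (rule kappa_sigma_finite)
  interpret P: pair_sigma_finite W kappa ..
  have [measurable]: "(\<lambda>v. y(k := v)) \<in> Y \<rightarrow>\<^sub>M PY" "y k \<in> space Y" for k
    using y PY_comp by (auto intro!: measurable_fun_upd_UNIV)
  have "(\<integral>\<^sup>+ v. \<integral>\<^sup>+ x. ennreal (g x (y j)) * Q_one M g (y(s + n := v)) s (Suc n) x \<partial>W \<partial>kappa) =
    (\<integral>\<^sup>+ x. \<integral>\<^sup>+ v. ennreal (g x (y j)) * Q_one M g (y(s + n := v)) s (Suc n) x \<partial>kappa \<partial>W)"
  proof (rule P.Fubini')
    have "(\<lambda>z. Q_one M g (y(s + n := snd z)) s (Suc n) (fst z)) \<in> borel_measurable (X \<Otimes>\<^sub>M Y)"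
      by measurable
    then show "(\<lambda>(x, v). ennreal (g x (y j)) * Q_one M g (y(s + n := v)) s (Suc n) x) \<in> borel_measurable (W \<Otimes>\<^sub>M kappa)"
      unfolding case_prod_beta measurable_cong_sets[OF sets_pair_measure_cong[OF W(2) sets_kappa] refl]
      by measurable
  qed
  also have "\<dots> = (\<integral>\<^sup>+ x. ennreal (g x (y j)) * Q_one M g y s n x \<partial>W)"
  proof (rule nn_integral_cong)
    fix x assume "x \<in> space W"
    then have x: "x \<in> space X" using sets_eq_imp_space_eq[OF W(2)] by simp
    have "(\<integral>\<^sup>+ v. ennreal (g x (y j)) * Q_one M g (y(s + n := v)) s (Suc n) x \<partial>kappa) =
       ennreal (g x (y j)) * (\<integral>\<^sup>+ v. Q_one M g (y(s + n := v)) s (Suc n) x \<partial>kappa)"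
      using x by (intro nn_integral_cmult) (simp add: measurable_cong_sets[OF sets_kappa refl])
    then show "(\<integral>\<^sup>+ v. ennreal (g x (y j)) * Q_one M g (y(s + n := v)) s (Suc n) x \<partial>kappa) =
       ennreal (g x (y j)) * Q_one M g y s n x" by (simp only: last[OF x])
  qed
  finally show ?thesis .
qed

text \<open>Observation densities have total mass one, so integrating over the last observation
  turns the last kernel into the probability \<open>M\<close>, while the earlier kernels are
  untouched. All martingale properties used below come from this identity.\<close>

lemma Q_one_last:
  "x \<in> space X \<Longrightarrow> y \<in> space PY \<Longrightarrow> (\<integral>\<^sup>+ v. Q_one M g (y(s + n := v)) s (Suc n) x \<partial>kappa) = Q_one M g y s n x"
proof (induction n arbitrary: s x)
  case 0
  have "(\<integral>\<^sup>+ v. Q_one M g (y(s + 0 := v)) s (Suc 0) x \<partial>kappa) = (\<integral>\<^sup>+ v. \<integral>\<^sup>+ a. ennreal (g a v) \<partial>M x \<partial>kappa)"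
    using 0 by (intro nn_integral_cong) (simp add: Q_one_Suc PY_upd space_kappa)
  also have "\<dots> = (\<integral>\<^sup>+ a. 1 \<partial>M x)"
    using 0(1) by (subst nn_integral_swap_M) (auto simp: nn_integral_g simp del: nn_integral_const intro!: nn_integral_cong)
  also have "\<dots> = 1" using prob_space.emeasure_space_1[OF M_prob[OF 0(1)]] by simp
  finally show ?case by (simp only: Q_one.simps(1))
next
  case (Suc n)
  interpret Mx: prob_space "M x" by (rule M_prob[OF Suc.prems(1)])
  have "(\<integral>\<^sup>+ v. Q_one M g (y(s + Suc n := v)) s (Suc (Suc n)) x \<partial>kappa) =
      (\<integral>\<^sup>+ v. \<integral>\<^sup>+ a. ennreal (g a (y s)) * Q_one M g (y(Suc s + n := v)) (Suc s) (Suc n) a \<partial>M x \<partial>kappa)"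
    using Suc.prems by (intro nn_integral_cong) (simp add: Q_one_Suc PY_upd space_kappa)
  also have "\<dots> = (\<integral>\<^sup>+ a. ennreal (g a (y s)) * Q_one M g y (Suc s) n a \<partial>M x)"
    using Suc.prems by (intro integrate_last_aux Mx.sigma_finite_measure_axioms sets_M Suc.IH)
  also have "\<dots> = Q_one M g y s (Suc n) x"
    using Suc.prems by (simp add: Q_one_Suc)
  finally show ?case .
qed

section \<open>The likelihood as joint density of the observations\<close>

lemma lik_measurable [measurable]: "(\<lambda>y. lik mu M g y n) \<in> borel_measurable PY"
proof -
  interpret mu: prob_space mu by (rule mu_prob)
  show ?thesis unfolding lik_def
    by (rule mu.borel_measurable_nn_integral) (auto simp: case_prod_beta)
qed

lemma dep_lik: "dep n (\<lambda>y. lik mu M g y n)"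
proof -
  have "Q_one M g y 1 n = Q_one M g y' 1 n" if "\<forall>i\<le>n. y i = y' i" for y y'
    using that by (intro ext Q_one_cong) auto
  then show ?thesis unfolding dep_def lik_def by (intro allI impI nn_integral_cong) (metis le0)
qed

lemma lik_last:
  assumes y: "y \<in> space PY"
  shows "(\<integral>\<^sup>+ v. lik mu M g (y(Suc n := v)) (Suc n) \<partial>kappa) = lik mu M g y n"
  unfolding lik_def using y
    integrate_last_aux[OF prob_space_imp_sigma_finite[OF mu_prob] sets_mu y, of 1 n 0, OF Q_one_last[OF _ y]]
  by simp

text \<open>Tonelli for one state against the observations at other times: as \<open>k\<close> lies
  outside \<open>J\<close>, the density \<open>g v (y k)\<close> is constant for the integral over
  \<open>J\<close>.\<close>

lemma Iint_kernel:
  assumes P: "prob_space P" "sets P = sets X" and k: "k \<notin> J" and J: "finite J" and y: "y \<in> space PY"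
    and f[measurable]: "f \<in> borel_measurable PY"
    and q: "(\<lambda>(v, y). q v y) \<in> borel_measurable (X \<Otimes>\<^sub>M PY)"
  shows "(\<integral>\<^sup>+ v. ennreal (g v (y k)) * Iint kappa J (\<lambda>y. f y * q v y) y \<partial>P)
    = Iint kappa J (\<lambda>y. f y * (\<integral>\<^sup>+ v. ennreal (g v (y k)) * q v y \<partial>P)) y"
proof -
  interpret P: prob_space P by fact
  have [measurable]: "(\<lambda>a. q (b a) (h a)) \<in> borel_measurable L" if "b \<in> L \<rightarrow>\<^sub>M X" "h \<in> L \<rightarrow>\<^sub>M PY" for b h L
    using measurable_compose[OF measurable_Pair[OF that] q] by simp
  have "(\<integral>\<^sup>+ v. ennreal (g v (y k)) * Iint kappa J (\<lambda>y. f y * q v y) y \<partial>P) =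
    (\<integral>\<^sup>+ v. Iint kappa J (\<lambda>y. ennreal (g v (y k)) * (f y * q v y)) y \<partial>P)"
  proof (rule nn_integral_cong)
    fix v assume "v \<in> space P"
    then have v[measurable]: "v \<in> space X" using sets_eq_imp_space_eq[OF P(2)] by simp
    show "ennreal (g v (y k)) * Iint kappa J (\<lambda>y. f y * q v y) y = Iint kappa J (\<lambda>y. ennreal (g v (y k)) * (f y * q v y)) y"
      using y k by (subst Iint_cmult) auto
  qed
  also have "\<dots> = Iint kappa J (\<lambda>y. \<integral>\<^sup>+ v. ennreal (g v (y k)) * (f y * q v y) \<partial>P) y"
    using y J by (intro Iint_swap P.sigma_finite_measure_axioms)
      (auto simp: case_prod_beta measurable_cong_sets[OF sets_pair_measure_cong[OF P(2) refl] refl])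
  also have "\<dots> = Iint kappa J (\<lambda>y. f y * (\<integral>\<^sup>+ v. ennreal (g v (y k)) * q v y \<partial>P)) y"
  proof (rule Iint_cong[OF y])
    fix y' assume y': "y' \<in> space PY"
    have [measurable]: "y' k \<in> space Y" by (rule PY_comp[OF y'])
    have [measurable]: "(\<lambda>v. q v y') \<in> borel_measurable X"
      using measurable_compose[OF measurable_Pair2'[OF y'] q] by simp
    show "(\<integral>\<^sup>+ v. ennreal (g v (y' k)) * (f y' * q v y') \<partial>P) = f y' * (\<integral>\<^sup>+ v. ennreal (g v (y' k)) * q v y' \<partial>P)"
      by (subst nn_integral_cmult[symmetric]) (auto simp: ac_simps measurable_cong_sets[OF P(2) refl])
  qed
  finally show ?thesis .
qed

text \<open>Given the history up to \<open>n\<close>, the next \<open>j\<close> observations have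
  density \<open>Q_one\<close> started at the current state. The induction keeps \<open>n\<close>
  arbitrary: its hypothesis is used at \<open>Suc n\<close>, and the one-step recursion of the law
  trades the state and observation at \<open>Suc n\<close> for one more kernel and one more integral
  over \<open>kappa\<close>.\<close>

lemma law_density_aux:
  assumes f[measurable]: "f \<in> borel_measurable PY" and d: "dep (n + j) f"
  shows "(\<integral>\<^sup>+ \<omega>. f (snd \<omega>) \<partial>law) =
    (\<integral>\<^sup>+ \<omega>. Iint kappa {Suc n..n + j} (\<lambda>y. f y * Q_one M g y (Suc n) j (fst \<omega> n)) (snd \<omega>) \<partial>law)"
  using d
proof (induction j arbitrary: n)
  case (Suc j)
  let ?J = "{Suc (Suc n)..Suc n + j}"
  let ?H = "\<lambda>x. Iint kappa ?J (\<lambda>y. f y * Q_one M g y (Suc (Suc n)) j x)"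
  have Hm: "(\<lambda>(x, y). ?H x y) \<in> borel_measurable (X \<Otimes>\<^sub>M PY)"
    by (rule Iint_measurable_param) (auto simp: case_prod_beta)
  have Hm'[measurable (raw)]: "(\<lambda>w. ?H (a w) (b w)) \<in> borel_measurable N"
    if "a \<in> N \<rightarrow>\<^sub>M X" "b \<in> N \<rightarrow>\<^sub>M PY" for a b N
    using measurable_compose[OF measurable_Pair[OF that] Hm] by simp
  have d': "dep (Suc n + j) f" using Suc.prems by simp
  have "(\<integral>\<^sup>+ \<omega>. f (snd \<omega>) \<partial>law) = (\<integral>\<^sup>+ \<omega>. ?H (fst \<omega> (Suc n)) (snd \<omega>) \<partial>law)"
    by (rule Suc.IH[OF d'])
  also have "\<dots> = (\<integral>\<^sup>+ \<omega>. \<integral>\<^sup>+ v. \<integral>\<^sup>+ u. ?H v ((snd \<omega>)(Suc n := u)) \<partial>G v \<partial>M (fst \<omega> n) \<partial>law)"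
  proof (subst law_Suc[of _ n])
    show "adapted (Suc n) (\<lambda>\<omega>. ?H (fst \<omega> (Suc n)) (snd \<omega>))"
      unfolding adapted_def
    proof (intro allI impI)
      fix x x' :: "nat \<Rightarrow> 'x" and y y' :: "nat \<Rightarrow> 'y" assume "\<forall>i\<le>Suc n. x i = x' i \<and> y i = y' i"
      then have eq: "x (Suc n) = x' (Suc n)" "\<And>i. i \<le> Suc n \<Longrightarrow> y i = y' i" by auto
      have "f (mix ?J y z) = f (mix ?J y' z)" for z by (rule depD[OF d']) (auto simp: mix_def eq)
      moreover have "Q_one M g (mix ?J y z) (Suc (Suc n)) j x = Q_one M g (mix ?J y' z) (Suc (Suc n)) j x" for z x
        by (rule Q_one_cong) (auto simp: mix_def)
      ultimately show "?H (fst (x, y) (Suc n)) (snd (x, y)) = ?H (fst (x', y') (Suc n)) (snd (x', y'))"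
        by (simp add: Iint_def eq)
    qed
    show "(\<lambda>\<omega>. ?H (fst \<omega> (Suc n)) (snd \<omega>)) \<in> borel_measurable (PX \<Otimes>\<^sub>M PY)"
      by (rule Hm') measurable
  qed simp
  also have "\<dots> = (\<integral>\<^sup>+ \<omega>. Iint kappa {Suc n..n + Suc j} (\<lambda>y. f y * Q_one M g y (Suc n) (Suc j) (fst \<omega> n)) (snd \<omega>) \<partial>law)"
  proof (rule nn_integral_cong)
    fix \<omega> assume "\<omega> \<in> space law"
    then obtain xs y where w: "\<omega> = (xs, y)" and xs: "xs \<in> space PX" and y: "y \<in> space PY"
      by (auto simp: space_pair_measure)
    define x where "x = xs n"
    have x: "x \<in> space X" using xs by (auto simp: space_PiM x_def)
    interpret Mx: prob_space "M x" by (rule M_prob[OF x])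
    have [measurable]: "(\<lambda>v. y(k := v)) \<in> Y \<rightarrow>\<^sub>M PY" for k
      using y by (intro measurable_fun_upd_UNIV) auto
    let ?Q = "\<lambda>y. f y * Q_one M g y (Suc n) (Suc j) x"
    have "(\<integral>\<^sup>+ v. \<integral>\<^sup>+ u. ?H v (y(Suc n := u)) \<partial>G v \<partial>M x) =
       (\<integral>\<^sup>+ v. \<integral>\<^sup>+ u. ennreal (g v u) * ?H v (y(Suc n := u)) \<partial>kappa \<partial>M x)"
      using x by (intro nn_integral_cong nn_integral_G) auto
    also have "\<dots> = (\<integral>\<^sup>+ u. \<integral>\<^sup>+ v. ennreal (g v u) * ?H v (y(Suc n := u)) \<partial>M x \<partial>kappa)"
    proof (rule nn_integral_swap_M[OF x, symmetric])
      have "(\<lambda>t. ?H (fst t) (y(Suc n := snd t))) \<in> borel_measurable (X \<Otimes>\<^sub>M Y)"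
        by (rule Hm') measurable
      then show "(\<lambda>(v, u). ennreal (g v u) * ?H v (y(Suc n := u))) \<in> borel_measurable (X \<Otimes>\<^sub>M Y)"
        unfolding case_prod_beta by measurable
    qed
    also have "\<dots> = (\<integral>\<^sup>+ u. Iint kappa ?J ?Q (y(Suc n := u)) \<partial>kappa)"
    proof (rule nn_integral_cong)
      fix u assume "u \<in> space kappa"
      then have u: "u \<in> space Y" by (simp add: space_kappa)
      let ?y = "y(Suc n := u)"
      have y': "?y \<in> space PY" by (rule PY_upd[OF y u])
      show "(\<integral>\<^sup>+ v. ennreal (g v u) * ?H v ?y \<partial>M x) = Iint kappa ?J ?Q ?y"
        using Iint_kernel[OF M_prob[OF x] sets_M[OF x], of "Suc n" ?J ?y f "\<lambda>v y. Q_one M g y (Suc (Suc n)) j v"] x y'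
        by (simp add: Q_one_measurable case_prod_beta Q_one_Suc cong: Iint_cong)
    qed
    also have "\<dots> = Iint kappa (insert (Suc n) ?J) ?Q y"
      using x y by (intro Iint_insert[symmetric]) auto
    also have "insert (Suc n) ?J = {Suc n..n + Suc j}" by auto
    finally show "(\<integral>\<^sup>+ v. \<integral>\<^sup>+ u. ?H v ((snd \<omega>)(Suc n := u)) \<partial>G v \<partial>M (fst \<omega> n)) =
      Iint kappa {Suc n..n + Suc j} (\<lambda>y. f y * Q_one M g y (Suc n) (Suc j) (fst \<omega> n)) (snd \<omega>)"
      unfolding w x_def fst_conv snd_conv .
  qed
  finally show ?case .
qed simp

text \<open>\<open>law_density_aux\<close> started at time 0 leaves only the first state and the
  first observation under the law, and these are drawn from \<open>mu\<close> and \<open>G\<close>.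
  The point \<open>y\<close> supplies the coordinates beyond \<open>n\<close>.\<close>

lemma law_density:
  assumes f[measurable]: "f \<in> borel_measurable PY" and d: "dep n f" and y: "y \<in> space PY"
  shows "(\<integral>\<^sup>+ \<omega>. f (snd \<omega>) \<partial>law) = Iint kappa {..n} (\<lambda>y. f y * lik mu M g y n) y"
proof -
  interpret mu: prob_space mu by (rule mu_prob)
  interpret kappa: sigma_finite_measure kappa by (rule kappa_sigma_finite)
  interpret P: pair_sigma_finite mu kappa ..
  obtain x0 where x0: "x0 \<in> space PX" using PX_ne by blast
  let ?H = "\<lambda>x. Iint kappa {Suc 0..n} (\<lambda>y. f y * Q_one M g y (Suc 0) n x)"
  have Hm: "(\<lambda>(x, y). ?H x y) \<in> borel_measurable (X \<Otimes>\<^sub>M PY)"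
    by (rule Iint_measurable_param) (auto simp: case_prod_beta)
  have Hm'[measurable (raw)]: "(\<lambda>w. ?H (a w) (b w)) \<in> borel_measurable N"
    if "a \<in> N \<rightarrow>\<^sub>M X" "b \<in> N \<rightarrow>\<^sub>M PY" for a b N
    using measurable_compose[OF measurable_Pair[OF that] Hm] by simp
  have [measurable]: "(\<lambda>v. y(k := v)) \<in> Y \<rightarrow>\<^sub>M PY" for k
    using y by (intro measurable_fun_upd_UNIV) auto
  have "(\<integral>\<^sup>+ \<omega>. f (snd \<omega>) \<partial>law) = (\<integral>\<^sup>+ \<omega>. ?H (fst \<omega> 0) (snd \<omega>) \<partial>law)"
    using law_density_aux[of f 0 n] d by simp
  also have "\<dots> = (\<integral>\<^sup>+ v. \<integral>\<^sup>+ u. ?H v (y(0 := u)) \<partial>G v \<partial>mu)"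
  proof (subst law_0[OF _ _ x0 y])
    show "adapted 0 (\<lambda>\<omega>. ?H (fst \<omega> 0) (snd \<omega>))"
      unfolding adapted_def
    proof (intro allI impI)
      fix x x' :: "nat \<Rightarrow> 'x" and y y' :: "nat \<Rightarrow> 'y" assume eq: "\<forall>i\<le>0. x i = x' i \<and> y i = y' i"
      have "f (mix {Suc 0..n} y z) = f (mix {Suc 0..n} y' z)" for z
        using eq by (intro depD[OF d]) (auto simp: mix_def not_less_eq_eq)
      moreover have "Q_one M g (mix {Suc 0..n} y z) (Suc 0) n x = Q_one M g (mix {Suc 0..n} y' z) (Suc 0) n x" for z x
        by (rule Q_one_cong) (auto simp: mix_def)
      ultimately show "?H (fst (x, y) 0) (snd (x, y)) = ?H (fst (x', y') 0) (snd (x', y'))"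
        using eq by (simp add: Iint_def)
    qed
    show "(\<lambda>\<omega>. ?H (fst \<omega> 0) (snd \<omega>)) \<in> borel_measurable (PX \<Otimes>\<^sub>M PY)"
      by (rule Hm') measurable
  qed simp
  also have "\<dots> = (\<integral>\<^sup>+ v. \<integral>\<^sup>+ u. ennreal (g v u) * ?H v (y(0 := u)) \<partial>kappa \<partial>mu)"
    by (intro nn_integral_cong nn_integral_G) auto
  also have "\<dots> = (\<integral>\<^sup>+ u. \<integral>\<^sup>+ v. ennreal (g v u) * ?H v (y(0 := u)) \<partial>mu \<partial>kappa)"
  proof (rule P.Fubini'[symmetric])
    have "(\<lambda>t. ?H (fst t) (y(0 := snd t))) \<in> borel_measurable (X \<Otimes>\<^sub>M Y)"
      by (rule Hm') measurable
    then show "(\<lambda>(v, u). ennreal (g v u) * ?H v (y(0 := u))) \<in> borel_measurable (mu \<Otimes>\<^sub>M kappa)"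
      unfolding case_prod_beta measurable_cong_sets[OF sets_pair_measure_cong[OF sets_mu sets_kappa] refl] by measurable
  qed
  also have "\<dots> = (\<integral>\<^sup>+ u. Iint kappa {Suc 0..n} (\<lambda>y. f y * lik mu M g y n) (y(0 := u)) \<partial>kappa)"
  proof (rule nn_integral_cong)
    fix u assume "u \<in> space kappa"
    then have u: "u \<in> space Y" by (simp add: space_kappa)
    let ?y = "y(0 := u)"
    have y': "?y \<in> space PY" by (rule PY_upd[OF y u])
    show "(\<integral>\<^sup>+ v. ennreal (g v u) * ?H v ?y \<partial>mu) = Iint kappa {Suc 0..n} (\<lambda>y. f y * lik mu M g y n) ?y"
      using Iint_kernel[OF mu_prob sets_mu, of 0 "{Suc 0..n}" ?y f "\<lambda>v y. Q_one M g y (Suc 0) n v"] y'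
      by (simp add: Q_one_measurable case_prod_beta lik_def)
  qed
  also have "\<dots> = Iint kappa (insert 0 {Suc 0..n}) (\<lambda>y. f y * lik mu M g y n) y"
    using y by (intro Iint_insert[symmetric]) auto
  also have "insert 0 {Suc 0..n} = {..n}" by auto
  finally show ?thesis .
qed

lemma marg_lik_eq: "marg_lik kappa mu M g y s t = Iint kappa {..<s} (\<lambda>y. lik mu M g y t) y"
  by (simp add: marg_lik_def Iint_def mix_def)

lemma Iint_lik:
  assumes y: "y \<in> space PY"
  shows "Iint kappa {..n} (\<lambda>y. lik mu M g y n) y = 1"
  using law_density[of "\<lambda>_. 1" n y] y prob_space.emeasure_space_1[OF law_prob] by (simp add: dep_def)

end

section \<open>A weak-type inequality for likelihood ratios\<close>

lemma pred_le_ennreal [measurable (raw)]: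
  fixes f g :: "'a \<Rightarrow> ennreal"
  assumes "f \<in> borel_measurable N" "g \<in> borel_measurable N"
  shows "Measurable.pred N (\<lambda>x. f x \<le> g x)"
  using assms unfolding pred_def by (rule borel_measurable_le)

section \<open>A maximal inequality for families of densities\<close>

context hmm_density
begin

text \<open>A function with finite integral is finite almost everywhere, so the comparison of
  \<open>f\<close> and \<open>h\<close> may presuppose that \<open>m\<close> is finite. It is
  applied with a marginal likelihood as \<open>m\<close>, by which the functions divide.\<close>

lemma Iint_mono_AE:
  assumes y: "y \<in> space PY" and m: "m \<in> borel_measurable PY" and fin: "Iint kappa J m y \<noteq> \<infinity>"
    and le: "\<And>y'. y' \<in> space PY \<Longrightarrow> m y' \<noteq> \<infinity> \<Longrightarrow> f y' \<le> h y'"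
  shows "Iint kappa J f y \<le> Iint kappa J h y"
proof -
  have "(\<lambda>z. m (mix J y z)) \<in> borel_measurable (PiM J (\<lambda>_. kappa))"
    using measurable_compose[OF mix_measurable1[OF y] m] .
  from nn_integral_noteq_infinite[OF this] fin
  have "AE z in PiM J (\<lambda>_. kappa). m (mix J y z) \<noteq> \<infinity>" by (simp add: Iint_def)
  then have "AE z in PiM J (\<lambda>_. kappa). f (mix J y z) \<le> h (mix J y z)"
    using AE_space by eventually_elim (use y in \<open>auto simp: mix_space intro: le\<close>)
  then show ?thesis
    unfolding Iint_def by (rule nn_integral_mono_AE)
qed

lemma Iint_last:
  assumes p[measurable]: "\<And>n. p n \<in> borel_measurable PY"
    and int: "\<And>n y. a \<le> n \<Longrightarrow> n < b \<Longrightarrow> y \<in> space PY \<Longrightarrow> (\<integral>\<^sup>+ v. p (Suc n) (y(Suc n := v)) \<partial>kappa) = p n y"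
    and ab: "a \<le> b"
  shows "y \<in> space PY \<Longrightarrow> Iint kappa {Suc a..b} (p b) y = p a y"
  using ab int
proof (induction a arbitrary: y rule: inc_induct)
  case base
  show ?case by simp
next
  case (step n)
  have "{Suc n..b} = insert (Suc n) {Suc (Suc n)..b}" using step by auto
  then have "Iint kappa {Suc n..b} (p b) y = (\<integral>\<^sup>+ v. Iint kappa {Suc (Suc n)..b} (p b) (y(Suc n := v)) \<partial>kappa)"
    using step.prems by (simp add: Iint_insert)
  also have "\<dots> = (\<integral>\<^sup>+ v. p (Suc n) (y(Suc n := v)) \<partial>kappa)"
    using step.prems by (intro nn_integral_cong step.IH PY_upd) (auto simp: space_kappa simp del: fun_upd_apply)
  also have "\<dots> = p n y" by (rule step.prems) (use step in auto)
  finally show ?case .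
qed

lemma ville_maximal_inequality:
  assumes p[measurable]: "\<And>n. p n \<in> borel_measurable PY" and F[measurable]: "\<And>n. F n \<in> borel_measurable PY"
    and dp: "\<And>n. dep n (p n)" and dF: "\<And>n. dep n (F n)"
    and ip: "\<And>n y. a \<le> n \<Longrightarrow> n < b \<Longrightarrow> y \<in> space PY \<Longrightarrow> (\<integral>\<^sup>+ v. p (Suc n) (y(Suc n := v)) \<partial>kappa) = p n y"
    and iF: "\<And>n y. a \<le> n \<Longrightarrow> n < b \<Longrightarrow> y \<in> space PY \<Longrightarrow> (\<integral>\<^sup>+ v. F (Suc n) (y(Suc n := v)) \<partial>kappa) = F n y"
    and ab: "a \<le> b" and y: "y \<in> space PY"
  shows "Iint kappa {Suc a..b} (\<lambda>y. (if \<exists>n\<in>{a..b}. p n y \<le> F n y then 1 else 0) * p b y) y \<le> min (p a y) (F a y)"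
proof -
  define ind where "ind a y = (if \<exists>n\<in>{a..b}. p n y \<le> F n y then 1 else 0 :: ennreal)" for a y
  have [measurable]: "ind a \<in> borel_measurable PY" for a unfolding ind_def by measurable
  have le_p: "Iint kappa {Suc a..b} (\<lambda>y. ind a y * p b y) y \<le> p a y"
    if "a \<le> b" "y \<in> space PY" "\<And>n y. a \<le> n \<Longrightarrow> n < b \<Longrightarrow> y \<in> space PY \<Longrightarrow> (\<integral>\<^sup>+ v. p (Suc n) (y(Suc n := v)) \<partial>kappa) = p n y" for a y
  proof -
    have "Iint kappa {Suc a..b} (\<lambda>y. ind a y * p b y) y \<le> Iint kappa {Suc a..b} (p b) y"
      by (intro Iint_mono that) (auto simp: ind_def)
    also have "\<dots> = p a y" using that(1,2) by (intro Iint_last p that(3))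
    finally show ?thesis .
  qed
  have le_F: "Iint kappa {Suc a..b} (\<lambda>y. ind a y * p b y) y \<le> F a y"
    using ab y ip iF
  proof (induction a arbitrary: y rule: inc_induct)
    case base
    show ?case by (simp add: ind_def)
  next
    case (step n)
    show ?case
    proof (cases "p n y \<le> F n y")
      case True
      then show ?thesis using le_p[of n y] step by force
    next
      case False
      have eq: "{Suc n..b} = insert (Suc n) {Suc (Suc n)..b}" using step by auto
      have "Iint kappa {Suc n..b} (\<lambda>y. ind n y * p b y) y = Iint kappa {Suc n..b} (\<lambda>y. ind (Suc n) y * p b y) y"
      proof (rule Iint_cong)
        fix y' assume y': "\<And>i. i \<notin> {Suc n..b} \<Longrightarrow> y' i = y i"
        have "p n y' = p n y" "F n y' = F n y"
          using y' by (auto intro!: depD[OF dp] depD[OF dF])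
        with False have "\<not> p n y' \<le> F n y'" by simp
        moreover have "{n..b} = insert n {Suc n..b}" using step by auto
        ultimately have "ind n y' = ind (Suc n) y'" unfolding ind_def by simp
        then show "ind n y' * p b y' = ind (Suc n) y' * p b y'" by simp
      qed (use step in auto)
      also have "\<dots> = (\<integral>\<^sup>+ v. Iint kappa {Suc (Suc n)..b} (\<lambda>y. ind (Suc n) y * p b y) (y(Suc n := v)) \<partial>kappa)"
        using step.prems by (simp add: eq Iint_insert)
      also have "\<dots> \<le> (\<integral>\<^sup>+ v. F (Suc n) (y(Suc n := v)) \<partial>kappa)"
        using step.prems by (intro nn_integral_mono step.IH PY_upd) (auto simp: space_kappa simp del: fun_upd_apply)
      also have "\<dots> = F n y" by (rule step.prems) (use step in auto)
      finally show ?thesis .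
    qed
  qed
  show ?thesis using le_p[OF ab y ip] le_F unfolding ind_def by simp
qed

lemma emeasure_pos_integral:
  assumes "prob_space P" "f \<in> borel_measurable P" "\<And>x. x \<in> space P \<Longrightarrow> 0 < (f x :: ennreal)"
  shows "0 < (\<integral>\<^sup>+ x. f x \<partial>P)"
proof (rule ccontr)
  interpret prob_space P by fact
  assume "\<not> 0 < (\<integral>\<^sup>+ x. f x \<partial>P)"
  then have "AE x in P. f x = 0" using assms(2) by (simp add: nn_integral_0_iff_AE)
  moreover have "AE x in P. f x \<noteq> 0" using assms(3) by (auto intro!: AE_I2 simp: zero_less_iff_neq_zero)
  ultimately have "AE x in P. False" by eventually_elim auto
  then show False by simp
qed

lemma Q_one_pos:
  assumes g_pos: "\<And>x y. x \<in> space X \<Longrightarrow> y \<in> space Y \<Longrightarrow> 0 < g x y" and y: "y \<in> space PY"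
  shows "x \<in> space X \<Longrightarrow> 0 < Q_one M g y s n x"
proof (induction n arbitrary: s x)
  case (Suc n)
  show ?case unfolding Q_one_Suc[OF Suc.prems y]
  proof (rule emeasure_pos_integral[OF M_prob[OF Suc.prems]])
    show "(\<lambda>x'. ennreal (g x' (y s)) * Q_one M g y (Suc s) n x') \<in> borel_measurable (M x)"
      using y by (simp add: measurable_cong_sets[OF sets_M[OF Suc.prems] refl] PY_comp)
    fix x' assume "x' \<in> space (M x)"
    then have "x' \<in> space X" using Suc.prems by simp
    then show "0 < ennreal (g x' (y s)) * Q_one M g y (Suc s) n x'"
      using Suc.IH[of x' "Suc s"] g_pos[of x' "y s"] y by (simp add: ennreal_zero_less_mult_iff PY_comp)
  qed
qed simp

text \<open>Allows division by the likelihood of the past in conditional likelihoods.\<close>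

lemma lik_pos:
  assumes g_pos: "\<And>x y. x \<in> space X \<Longrightarrow> y \<in> space Y \<Longrightarrow> 0 < g x y" and y: "y \<in> space PY"
  shows "0 < lik mu M g y n"
  unfolding lik_def
proof (rule emeasure_pos_integral[OF mu_prob])
  show "(\<lambda>x. ennreal (g x (y 0)) * Q_one M g y 1 n x) \<in> borel_measurable mu"
    using y by (simp add: measurable_cong_sets[OF sets_mu refl] PY_comp)
qed (use y Q_one_pos[OF g_pos y] g_pos in \<open>simp add: ennreal_zero_less_mult_iff PY_comp\<close>)

lemma cond_lik_measurable [measurable]: "(\<lambda>y. cond_lik mu M g y s t) \<in> borel_measurable PY"
  unfolding cond_lik_def by measurable

end

text \<open>Clears the nested quotient in the exceedance event. Likelihoods are extended reals, so
  infinite values of \<open>V\<close>, \<open>L\<close> and \<open>l0\<close> are separate cases;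
  for infinite \<open>l0\<close> the right-hand side is infinite because \<open>V\<close> cannot
  vanish.\<close>

lemma ennreal_ratio_gt:
  fixes V L l0 :: ennreal
  assumes l0: "l0 \<noteq> 0" and c: "0 < c" and gt: "ennreal c < V / (L / l0)"
  shows "L \<le> V * l0 / ennreal c"
proof (cases V)
  case V: (real v)
  show ?thesis
  proof (cases l0)
    case l: (real l)
    show ?thesis
    proof (cases L)
      case L: (real r)
      have l': "0 < l" using l l0 by (auto simp: zero_less_iff_neq_zero less_le)
      show ?thesis
      proof (cases "r = 0")
        case False
        then have "0 < r" using L by simp
        then have "c < v / (r / l)" using gt V l L l' c by (simp add: divide_ennreal ennreal_less_iff)
        then have "r \<le> v * l / c" using \<open>0 < r\<close> l' c by (simp add: field_simps)
        then show ?thesis using V l L l' c by (simp add: divide_ennreal ennreal_mult[symmetric])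
      qed (use L in simp)
    next
      case top
      then show ?thesis using gt l by (simp add: ennreal_top_divide split: if_splits)
    qed
  next
    case top
    have "V \<noteq> 0" using gt by auto
    then show ?thesis using top by (simp add: ennreal_mult_top ennreal_top_divide)
  qed
next
  case top
  then show ?thesis using l0 c by (simp add: ennreal_top_mult ennreal_top_divide)
qed

text \<open>This is the bound of \<open>min 1 x\<close> by \<open>x powr \<alpha>\<close> at
  \<open>x = V / (m * c)\<close>, multiplied by \<open>m\<close>. It fails for infinite
  \<open>m\<close>, where the quotient \<open>V / m\<close> vanishes for finite
  \<open>V\<close>.\<close>

lemma ennreal_powr_cmult_le:
  fixes m V :: ennreal
  assumes c: "0 < c" and \<alpha>: "0 < \<alpha>" "\<alpha> < 1" and m: "m \<noteq> \<infinity>"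
  shows "min m (V / ennreal c) \<le> ennreal (c powr - \<alpha>) * (ennreal_powr (V / m) \<alpha> * m)"
proof (cases m)
  case (real r)
  show ?thesis
  proof (cases "r = 0")
    case False
    then have r: "0 < r" using real by simp
    show ?thesis
    proof (cases V)
      case V: (real v)
      have "min r (v / c) \<le> c powr - \<alpha> * ((v / r) powr \<alpha> * r)"
      proof -
        have *: "c powr - \<alpha> * ((v / r) powr \<alpha> * r) = (v / r / c) powr \<alpha> * r"
          using c V r by (simp add: powr_divide powr_minus powr_mult field_simps)
        show ?thesis
        proof (cases "v / r / c \<le> 1")
          case True
          then have "v / r / c \<le> (v / r / c) powr \<alpha>"
            using powr_mono'[of \<alpha> 1 "v / r / c"] \<alpha> c V r by (cases "v = 0") auto
          then have "(v / r / c) * r \<le> (v / r / c) powr \<alpha> * r" using r by (intro mult_right_mono) auto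
          then show ?thesis unfolding * using r by simp
        next
          case False
          then have "1 \<le> (v / r / c) powr \<alpha>" using \<alpha> by (intro ge_one_powr_ge_zero) auto
          then have "1 * r \<le> (v / r / c) powr \<alpha> * r" using r by (intro mult_right_mono) auto
          then show ?thesis unfolding * by simp
        qed
      qed
      moreover have "min m (V / ennreal c) = ennreal (min r (v / c))"
        using real V c by (simp add: divide_ennreal min_def ennreal_le_iff)
      moreover have "ennreal (c powr - \<alpha>) * (ennreal_powr (V / m) \<alpha> * m) = ennreal (c powr - \<alpha> * ((v / r) powr \<alpha> * r))"
        using real V r by (simp add: divide_ennreal ennreal_powr_def ennreal_mult)
      ultimately show ?thesis by (metis ennreal_leI)
    next
      case top
      then show ?thesis using real r c
        by (simp add: ennreal_powr_def ennreal_top_divide ennreal_top_mult ennreal_mult_top)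
    qed
  qed (use real in simp)
qed (use m in simp)

lemma measurable_ennreal_powr [measurable (raw)]:
  assumes [measurable]: "f \<in> borel_measurable N"
  shows "(\<lambda>x. ennreal_powr (f x) a) \<in> borel_measurable N"
  unfolding ennreal_powr_def by measurable

context hmm_density
begin

text \<open>The event says that \<open>V l y\<close> times the likelihood of the past is at least \<open>c\<close> times the
  likelihood up to time \<open>t + l\<close>. Integrating out the future by the maximal inequality and then the
  past leaves the minimum of the marginal likelihood and \<open>V a y / c\<close>; finally
  \<open>min 1 x \<le> x powr \<alpha>\<close>.\<close>

lemma weak_type:
  fixes V :: "nat \<Rightarrow> (nat \<Rightarrow> 'y) \<Rightarrow> ennreal"
  assumes g_pos: "\<And>x y. x \<in> space X \<Longrightarrow> y \<in> space Y \<Longrightarrow> 0 < g x y"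
    and V[measurable]: "\<And>l. V l \<in> borel_measurable PY"
    and Vdep: "\<And>l y y'. (\<And>i. t \<le> i \<Longrightarrow> i \<le> t + l \<Longrightarrow> y i = y' i) \<Longrightarrow> V l y = V l y'"
    and Vint: "\<And>l y. a \<le> l \<Longrightarrow> l < b \<Longrightarrow> y \<in> space PY \<Longrightarrow> (\<integral>\<^sup>+ v. V (Suc l) (y(Suc (t + l) := v)) \<partial>kappa) = V l y"
    and ab: "a \<le> b" and c: "0 < c" and \<alpha>: "0 < \<alpha>" "\<alpha> < 1"
  shows "emeasure law {\<omega> \<in> space law. \<exists>l\<in>{a..b}. ennreal c < V l (snd \<omega>) / cond_lik mu M g (snd \<omega>) t (t + l)}
    \<le> ennreal (c powr - \<alpha>) * (\<integral>\<^sup>+ \<omega>. ennreal_powr (V a (snd \<omega>) / marg_lik kappa mu M g (snd \<omega>) t (t + a)) \<alpha> \<partial>law)"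
proof -
  \<comment> \<open>With the value 1 at \<open>t = 0\<close>, the conditional likelihood is the
    quotient of \<open>p (t + l)\<close> by \<open>l0\<close> for every \<open>t\<close>.\<close>
  define l0 where "l0 y = (if t = 0 then 1 else lik mu M g y (t - 1))" for y
  define p where "p n y = lik mu M g y n" for n y
  \<comment> \<open>Exceeding \<open>c\<close> at look-ahead \<open>l\<close> becomes
    \<open>p n y \<le> F n y\<close> at the absolute time \<open>n = t + l\<close>. Both families
    keep their form when the observation at time \<open>n\<close> is integrated out, as the maximal
    inequality requires.\<close>
  define F where "F n y = V (n - t) y * l0 y / ennreal c" for n y
  define ind where "ind y = (if \<exists>n\<in>{t + a..t + b}. p n y \<le> F n y then 1 else 0 :: ennreal)" for y
  define m where "m y = Iint kappa {..<t} (p (t + a)) y" for y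
  obtain y0 where y0: "y0 \<in> space PY" using PY_ne by blast
  have [measurable]: "l0 \<in> borel_measurable PY" unfolding l0_def[abs_def] by (cases "t = 0") auto
  have [measurable]: "p n \<in> borel_measurable PY" "F n \<in> borel_measurable PY" for n
    unfolding p_def[abs_def] F_def[abs_def] by measurable
  have [measurable]: "ind \<in> borel_measurable PY" unfolding ind_def[abs_def] by measurable
  have m_meas[measurable]: "m \<in> borel_measurable PY" unfolding m_def[abs_def] by measurable
  have l0_dep: "l0 y = l0 y'" if "\<And>i. i < t \<Longrightarrow> y i = y' i" for y y'
    unfolding l0_def using that by (auto intro!: depD[OF dep_lik])
  have p_dep: "dep n (p n)" for n unfolding p_def[abs_def] by (rule dep_lik)
  have F_dep: "dep n (F n)" if "t \<le> n" for n
    unfolding dep_def F_def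
  proof (intro allI impI)
    fix y y' :: "nat \<Rightarrow> 'y" assume eq: "\<forall>i\<le>n. y i = y' i"
    have "V (n - t) y = V (n - t) y'" using eq that by (intro Vdep) auto
    moreover have "l0 y = l0 y'" using eq that by (intro l0_dep) auto
    ultimately show "V (n - t) y * l0 y / ennreal c = V (n - t) y' * l0 y' / ennreal c" by simp
  qed
  have p_int: "(\<integral>\<^sup>+ v. p (Suc n) (y(Suc n := v)) \<partial>kappa) = p n y" if "y \<in> space PY" for n y
    unfolding p_def using lik_last[OF that] .
  have F_int: "(\<integral>\<^sup>+ v. F (Suc n) (y(Suc n := v)) \<partial>kappa) = F n y" if "t + a \<le> n" "n < t + b" "y \<in> space PY" for n y
  proof -
    define l where "l = n - t"
    have n: "n = t + l" "a \<le> l" "l < b" using that by (auto simp: l_def)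
    have [measurable]: "(\<lambda>v. y(k := v)) \<in> kappa \<rightarrow>\<^sub>M PY" for k
      using that unfolding measurable_cong_sets[OF sets_kappa refl] by (intro measurable_fun_upd_UNIV) auto
    have "(\<integral>\<^sup>+ v. F (Suc n) (y(Suc n := v)) \<partial>kappa) = (\<integral>\<^sup>+ v. V (Suc l) (y(Suc (t + l) := v)) * (l0 y / ennreal c) \<partial>kappa)"
    proof (rule nn_integral_cong)
      fix v
      have "l0 (y(Suc n := v)) = l0 y" using n by (intro l0_dep) auto
      then show "F (Suc n) (y(Suc n := v)) = V (Suc l) (y(Suc (t + l) := v)) * (l0 y / ennreal c)"
        using n by (simp add: F_def ennreal_times_divide Suc_diff_le)
    qed
    also have "\<dots> = V l y * (l0 y / ennreal c)"
      using Vint[OF n(2,3) that(3)] by (subst nn_integral_multc) auto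
    finally show ?thesis using n by (simp add: F_def ennreal_times_divide)
  qed
  \<comment> \<open>The likelihood of the past is a probability density. This is what removes it
    from the bound and leaves the marginal likelihood.\<close>
  have l0_int: "Iint kappa {..<t} l0 y = 1" if "y \<in> space PY" for y
  proof (cases t)
    case 0
    then show ?thesis by (simp add: l0_def)
  next
    case (Suc k)
    then have "{..<t} = {..k}" by auto
    moreover have "l0 = (\<lambda>y. lik mu M g y k)" using Suc by (auto simp: l0_def)
    ultimately show ?thesis using Iint_lik[OF that, of k] by simp
  qed
  have union1: "Iint kappa {..t + b} f y0 = Iint kappa {..t + a} (Iint kappa {Suc (t + a)..t + b} f) y0"
    if [measurable]: "f \<in> borel_measurable PY" for f
  proof -
    have "{..t + b} = {..t + a} \<union> {Suc (t + a)..t + b}" using ab by auto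
    then show ?thesis by (simp only:) (rule Iint_union, use y0 in auto)
  qed
  \<comment> \<open>The past is the inner integral. The factor \<open>V a\<close> reads observations
    from \<open>t\<close> on only, hence is constant there.\<close>
  have union2: "Iint kappa {..t + a} f y0 = Iint kappa {t..t + a} (Iint kappa {..<t} f) y0"
    if [measurable]: "f \<in> borel_measurable PY" for f
  proof -
    have "{..t + a} = {t..t + a} \<union> {..<t}" by auto
    then show ?thesis by (simp only:) (rule Iint_union, use y0 in auto)
  qed
  let ?min = "\<lambda>y. min (p (t + a) y) (F (t + a) y)"
  define h where "h y = ennreal_powr (V a y / m y) \<alpha>" for y
  have h_meas[measurable]: "h \<in> borel_measurable PY" unfolding h_def[abs_def] by measurable
  have m_out: "m y = m y'" if "\<And>i. t \<le> i \<Longrightarrow> i \<le> t + a \<Longrightarrow> y i = y' i" for y y'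
  proof -
    have "p (t + a) (mix {..<t} y z) = p (t + a) (mix {..<t} y' z)" for z
      using that by (intro depD[OF p_dep]) (auto simp: mix_def)
    then show ?thesis by (simp add: m_def Iint_def)
  qed
  have h_out: "h y = h y'" if "\<And>i. t \<le> i \<Longrightarrow> i \<le> t + a \<Longrightarrow> y i = y' i" for y y'
    using m_out[OF that] Vdep[OF that] by (simp add: h_def)
  have "emeasure law {\<omega> \<in> space law. \<exists>l\<in>{a..b}. ennreal c < V l (snd \<omega>) / cond_lik mu M g (snd \<omega>) t (t + l)}
    \<le> emeasure law {\<omega> \<in> space law. \<exists>n\<in>{t + a..t + b}. p n (snd \<omega>) \<le> F n (snd \<omega>)}"
  proof (rule emeasure_mono)
    show "{\<omega> \<in> space law. \<exists>n\<in>{t + a..t + b}. p n (snd \<omega>) \<le> F n (snd \<omega>)} \<in> sets law"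
      by measurable
    show "{\<omega> \<in> space law. \<exists>l\<in>{a..b}. ennreal c < V l (snd \<omega>) / cond_lik mu M g (snd \<omega>) t (t + l)}
      \<subseteq> {\<omega> \<in> space law. \<exists>n\<in>{t + a..t + b}. p n (snd \<omega>) \<le> F n (snd \<omega>)}"
    proof safe
      fix x y l assume xy: "(x, y) \<in> space law" and l: "l \<in> {a..b}"
        and gt: "ennreal c < V l (snd (x, y)) / cond_lik mu M g (snd (x, y)) t (t + l)"
      have y: "y \<in> space PY" using xy by (simp add: space_pair_measure)
      have l0: "l0 y \<noteq> 0" using lik_pos[OF g_pos y, of "t - 1"] by (auto simp: l0_def)
      have "cond_lik mu M g y t (t + l) = p (t + l) y / l0 y"
        using l0 by (cases "t = 0") (simp_all add: cond_lik_def p_def l0_def divide_ennreal_def)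
      then have "p (t + l) y \<le> F (t + l) y"
        using ennreal_ratio_gt[OF l0 c, of "V l y" "p (t + l) y"] gt by (simp add: F_def)
      then show "\<exists>n\<in>{t + a..t + b}. p n (snd (x, y)) \<le> F n (snd (x, y))"
        using l by (intro bexI[of _ "t + l"]) auto
    qed
  qed
  also have "\<dots> = (\<integral>\<^sup>+ \<omega>. indicator {\<omega> \<in> space law. \<exists>n\<in>{t + a..t + b}. p n (snd \<omega>) \<le> F n (snd \<omega>)} \<omega> \<partial>law)"
    by (subst nn_integral_indicator) auto
  also have "\<dots> = (\<integral>\<^sup>+ \<omega>. ind (snd \<omega>) \<partial>law)"
    by (intro nn_integral_cong) (auto simp: ind_def indicator_def)
  also have "\<dots> = Iint kappa {..t + b} (\<lambda>y. ind y * lik mu M g y (t + b)) y0"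
  proof (rule law_density[OF _ _ y0])
    show "dep (t + b) ind"
      unfolding dep_def
    proof (intro allI impI)
      fix y y' :: "nat \<Rightarrow> 'y" assume eq: "\<forall>i\<le>t + b. y i = y' i"
      have "p n y = p n y' \<and> F n y = F n y'" if "n \<in> {t + a..t + b}" for n
        using eq that by (auto intro!: depD[OF p_dep] depD[OF F_dep])
      then show "ind y = ind y'" by (simp add: ind_def)
    qed
  qed measurable
  also have "\<dots> = Iint kappa {..t + a} (Iint kappa {Suc (t + a)..t + b} (\<lambda>y. ind y * p (t + b) y)) y0"
    unfolding p_def[symmetric] by (rule union1) measurable
  also have "\<dots> \<le> Iint kappa {..t + a} ?min y0"
  proof (rule Iint_mono[OF y0])
    fix y assume y: "y \<in> space PY"
    \<comment> \<open>For \<open>n < t\<close> the index \<open>n - t\<close> truncates to 0, and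
      \<open>F n\<close> may read the observation at time \<open>t\<close>, which lies after
      \<open>n\<close>. The maximal inequality asks for dependence on the first \<open>n\<close>
      observations at every \<open>n\<close>, so \<open>F\<close> is cut off below
      \<open>t\<close>.\<close>
    define F' where "F' n = (if t \<le> n then F n else (\<lambda>_. 0))" for n
    have F': "F' n = F n" if "t \<le> n" for n using that by (simp add: F'_def)
    have "Iint kappa {Suc (t + a)..t + b} (\<lambda>y. (if \<exists>n\<in>{t + a..t + b}. p n y \<le> F' n y then 1 else 0) * p (t + b) y) y
       \<le> min (p (t + a) y) (F' (t + a) y)"
    proof (rule ville_maximal_inequality)
      show "F' n \<in> borel_measurable PY" "dep n (F' n)" for n
        using F_dep[of n] by (auto simp: F'_def dep_def)
      show "(\<integral>\<^sup>+ v. F' (Suc n) (y(Suc n := v)) \<partial>kappa) = F' n y" if "t + a \<le> n" "n < t + b" "y \<in> space PY" for n y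
        using F_int[OF that] that by (simp add: F'_def)
    qed (use p_dep p_int ab y in auto)
    then show "Iint kappa {Suc (t + a)..t + b} (\<lambda>y. ind y * p (t + b) y) y \<le> min (p (t + a) y) (F (t + a) y)"
      by (simp add: ind_def F' cong: bex_cong_simp)
  qed
  also have "\<dots> = Iint kappa {t..t + a} (Iint kappa {..<t} ?min) y0"
    by (rule union2) measurable
  also have "\<dots> \<le> Iint kappa {t..t + a} (\<lambda>y. min (m y) (V a y / ennreal c)) y0"
  proof (rule Iint_mono[OF y0])
    fix y assume y: "y \<in> space PY"
    have "Iint kappa {..<t} ?min y \<le> m y"
      unfolding m_def by (rule Iint_mono[OF y]) simp
    moreover have "Iint kappa {..<t} ?min y \<le> V a y / ennreal c"
    proof -
      have "Iint kappa {..<t} ?min y \<le> Iint kappa {..<t} (\<lambda>y. (V a y / ennreal c) * l0 y) y"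
        by (rule Iint_mono[OF y]) (simp add: F_def ennreal_times_divide mult.commute min.coboundedI2)
      also have "\<dots> = (V a y / ennreal c) * Iint kappa {..<t} l0 y"
      proof (rule Iint_cmult[OF _ y])
        show "V a y' / ennreal c = V a y / ennreal c" if "\<And>i. i \<notin> {..<t} \<Longrightarrow> y' i = y i" for y'
          using that by (simp add: Vdep[of a y' y])
      qed measurable
      finally show ?thesis using l0_int[OF y] by simp
    qed
    ultimately show "Iint kappa {..<t} ?min y \<le> min (m y) (V a y / ennreal c)"
      by simp
  qed
  \<comment> \<open>The power bound holds where \<open>m\<close> is finite, hence almost everywhere:
    its total mass is one.\<close>
  also have "\<dots> \<le> Iint kappa {t..t + a} (\<lambda>y. ennreal (c powr - \<alpha>) * (h y * m y)) y0"
  proof (rule Iint_mono_AE[OF y0 m_meas])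
    have "Iint kappa {t..t + a} m y0 = Iint kappa {..t + a} (p (t + a)) y0"
      unfolding m_def[abs_def] by (rule union2[symmetric]) measurable
    also have "\<dots> = 1" unfolding p_def[abs_def] by (rule Iint_lik[OF y0])
    finally show "Iint kappa {t..t + a} m y0 \<noteq> \<infinity>" by simp
  qed (unfold h_def, rule ennreal_powr_cmult_le[OF c \<alpha>])
  also have "\<dots> = ennreal (c powr - \<alpha>) * Iint kappa {t..t + a} (\<lambda>y. h y * m y) y0"
    by (rule Iint_cmult[OF _ y0]) auto
  also have "Iint kappa {t..t + a} (\<lambda>y. h y * m y) y0 = Iint kappa {t..t + a} (Iint kappa {..<t} (\<lambda>y. h y * p (t + a) y)) y0"
  proof (rule Iint_cong[OF y0])
    fix y assume y: "y \<in> space PY"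
    show "h y * m y = Iint kappa {..<t} (\<lambda>y. h y * p (t + a) y) y"
      unfolding m_def using y by (intro Iint_cmult[symmetric] h_out) auto
  qed
  also have "\<dots> = Iint kappa {..t + a} (\<lambda>y. h y * p (t + a) y) y0"
    by (rule union2[symmetric]) measurable
  also have "\<dots> = (\<integral>\<^sup>+ \<omega>. h (snd \<omega>) \<partial>law)"
    unfolding p_def by (rule law_density[symmetric, OF _ _ y0]) (auto simp: dep_def intro!: h_out)
  also have "\<dots> = (\<integral>\<^sup>+ \<omega>. ennreal_powr (V a (snd \<omega>) / marg_lik kappa mu M g (snd \<omega>) t (t + a)) \<alpha> \<partial>law)"
    by (simp add: h_def m_def marg_lik_eq p_def[abs_def])
  finally show ?thesis .
qed

end

section \<open>Tails of the minorization constants\<close>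

sublocale hmm_with_proposals \<subseteq> hmm_density X Y kappa mu M G g
  by (intro hmm_density.intro hmm.intro kappa_measure.intro hmm_density_axioms.intro)
    (fact kappa_sigma_finite sets_kappa mu M G g_measurable g_nonneg g_density)+

context hmm_with_proposals
begin

lemma w_norm_measurable': "w_norm X g d0 w t \<in> borel_measurable Y"
proof (cases "t = 0")
  case True
  then show ?thesis using w0_norm_measurable by simp
next
  case False
  then have "w_norm X g d0 w t = w_norm X g d0 w 1" by (auto simp: w_norm_def)
  then show ?thesis using w_norm_measurable by simp
qed

lemma w_norm_comp [measurable]: "(\<lambda>y. w_norm X g d0 w t (y t)) \<in> borel_measurable PY"
  by (rule measurable_compose[OF _ w_norm_measurable']) measurable

lemma Q_norm_comp [measurable]: "(\<lambda>y. Q_norm X M g y s n) \<in> borel_measurable PY"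
proof -
  have "(\<lambda>y i. y (i + s)) \<in> PY \<rightarrow>\<^sub>M PY"
    by (rule measurable_PiM_single') (auto simp: space_PiM)
  from measurable_compose[OF this Q_norm_measurable, of n] show ?thesis
    using Q_one_shift[of _ 0 s n] by (simp add: Q_norm_def)
qed

lemma Q_norm_cong: "(\<And>i. s \<le> i \<Longrightarrow> i < s + n \<Longrightarrow> y i = y' i) \<Longrightarrow> Q_norm X M g y s n = Q_norm X M g y' s n"
  unfolding Q_norm_def by (simp cong: Q_one_cong)

lemma B_const_measurable [measurable]: "(\<lambda>y. B_const X mu M g d0 w t T y) \<in> borel_measurable PY"
  unfolding B_const_def by measurable

lemma nn_integral_M_le:
  assumes lambda: "sets lambda = sets X"
    and bound: "\<And>x A. x \<in> space X \<Longrightarrow> A \<in> sets X \<Longrightarrow> emeasure (M x) A \<le> ennreal \<sigma> * emeasure lambda A"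
    and x: "x \<in> space X" and f: "f \<in> borel_measurable X"
  shows "(\<integral>\<^sup>+ x'. f x' \<partial>M x) \<le> ennreal \<sigma> * (\<integral>\<^sup>+ x'. f x' \<partial>lambda)"
proof -
  have s: "sets (M x) = sets (scale_measure (ennreal \<sigma>) lambda)" using x lambda by simp
  then have "M x \<le> scale_measure (ennreal \<sigma>) lambda"
    using bound x by (subst le_measure) auto
  from nn_integral_mono_measure[OF s this, of f] f lambda show ?thesis
    by (subst (asm) nn_integral_scale_measure) (auto simp: measurable_cong_sets[OF lambda refl])
qed

text \<open>Lengths below \<open>lstar\<close> enter through a union bound, which gives the term
  \<open>real lstar * KB\<close>. All longer ones are treated together: there \<open>VB\<close> is
  at most \<sigma> times the martingale-type quantity \<open>VC\<close>, started at
  \<open>lstar\<close>. Lowering the threshold from \<open>c\<close> to \<open>c / \<sigma>\<close>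
  accounts for the factor \<open>\<sigma> powr \<alpha>\<close>.\<close>

lemma B_const_tail:
  assumes g_pos: "\<And>x y. x \<in> space X \<Longrightarrow> y \<in> space Y \<Longrightarrow> 0 < g x y"
    and lambda: "sigma_finite_measure lambda" "sets lambda = sets X" and \<sigma>: "0 < \<sigma>"
    and bound: "\<And>x A. x \<in> space X \<Longrightarrow> A \<in> sets X \<Longrightarrow> emeasure (M x) A \<le> ennreal \<sigma> * emeasure lambda A"
    and \<alpha>: "0 < \<alpha>" "\<alpha> < 1" and c: "0 < c" and lstar: "1 \<le> lstar"
    and KB: "\<And>l. l < lstar \<Longrightarrow> (\<integral>\<^sup>+ \<omega>. ennreal_powr (B_tilde X kappa mu M g d0 w t l (snd \<omega>)) \<alpha> \<partial>law) \<le> ennreal KB"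
    and KC: "(\<integral>\<^sup>+ \<omega>. ennreal_powr (C_tilde X lambda kappa mu M g d0 w t lstar (snd \<omega>)) \<alpha> \<partial>law) \<le> ennreal KC"
    and K0: "0 \<le> KB" "0 \<le> KC"
  shows "emeasure law {\<omega> \<in> space law. ennreal c < B_const X mu M g d0 w t T (snd \<omega>)}
    \<le> ennreal ((real lstar * KB + \<sigma> powr \<alpha> * KC) * c powr - \<alpha>)"
proof -
  interpret lambda: sigma_finite_measure lambda by fact
  note [measurable_cong] = lambda(2)
  have space_lambda: "space lambda = space X" using sets_eq_imp_space_eq[OF lambda(2)] .
  define VB where "VB l y = w_norm X g d0 w t (y t) * Q_norm X M g y (t + 1) l" for l y
  define I where "I l y = (\<integral>\<^sup>+ x. ennreal (g x (y (t + 1))) * Q_one M g y (t + 2) (l - 1) x \<partial>lambda)" for l y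
  define VC where "VC l y = w_norm X g d0 w t (y t) * I l y" for l y
  have [measurable]: "VB l \<in> borel_measurable PY" for l unfolding VB_def[abs_def] by measurable
  have I_meas[measurable]: "I l \<in> borel_measurable PY" for l
    unfolding I_def[abs_def] by (rule lambda.borel_measurable_nn_integral) (auto simp: case_prod_beta)
  have [measurable]: "VC l \<in> borel_measurable PY" for l unfolding VC_def[abs_def] by measurable
  have VB_dep: "VB l y = VB l y'" if "\<And>i. t \<le> i \<Longrightarrow> i \<le> t + l \<Longrightarrow> y i = y' i" for l y y'
    unfolding VB_def using that by (simp cong: Q_norm_cong)
  \<comment> \<open>An integral over the state instead of a supremum makes integration over the last
    observation exact. It starts at \<open>l = 1\<close>: for \<open>l = 0\<close> the truncated
    \<open>l - 1\<close> makes \<open>I 0\<close> coincide with \<open>I 1\<close>.\<close>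
  have I_int: "(\<integral>\<^sup>+ v. I (Suc l) (y(Suc (t + l) := v)) \<partial>kappa) = I l y" if "1 \<le> l" "y \<in> space PY" for l y
  proof -
    obtain n where l: "l = Suc n" using \<open>1 \<le> l\<close> by (cases l) auto
    show ?thesis
      using integrate_last_aux[OF lambda that(2), of "t + 2" n "t + 1", OF Q_one_last[OF _ that(2)]]
      by (simp add: I_def l)
  qed
  have VC_dep: "VC l y = VC l y'" if "1 \<le> l" "\<And>i. t \<le> i \<Longrightarrow> i \<le> t + l \<Longrightarrow> y i = y' i" for l y y'
  proof -
    have "Q_one M g y (t + 2) (l - 1) = Q_one M g y' (t + 2) (l - 1)"
      using that by (intro ext Q_one_cong) auto
    then show ?thesis using that by (simp add: VC_def I_def)
  qed
  have VC_int: "(\<integral>\<^sup>+ v. VC (Suc l) (y(Suc (t + l) := v)) \<partial>kappa) = VC l y" if "1 \<le> l" "y \<in> space PY" for l y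
  proof -
    have [measurable]: "(\<lambda>v. y(k := v)) \<in> kappa \<rightarrow>\<^sub>M PY" for k
      using that unfolding measurable_cong_sets[OF sets_kappa refl] by (intro measurable_fun_upd_UNIV) auto
    have "(\<integral>\<^sup>+ v. VC (Suc l) (y(Suc (t + l) := v)) \<partial>kappa) = (\<integral>\<^sup>+ v. w_norm X g d0 w t (y t) * I (Suc l) (y(Suc (t + l) := v)) \<partial>kappa)"
      by (intro nn_integral_cong) (simp add: VC_def)
    also have "\<dots> = VC l y"
      using I_int[OF that] by (subst nn_integral_cmult) (auto simp: VC_def)
    finally show ?thesis .
  qed
  \<comment> \<open>The bound by \<lambda> does not depend on the starting state, so it survives the
    supremum over that state.\<close>
  have VB_le: "VB l y \<le> ennreal \<sigma> * VC l y" if "1 \<le> l" "y \<in> space PY" for l y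
  proof -
    obtain n where l: "l = Suc n" using \<open>1 \<le> l\<close> by (cases l) auto
    have "Q_norm X M g y (t + 1) l \<le> ennreal \<sigma> * I l y"
      unfolding Q_norm_def
    proof (rule SUP_least)
      fix x assume x: "x \<in> space X"
      show "Q_one M g y (t + 1) l x \<le> ennreal \<sigma> * I l y"
        unfolding l Q_one_Suc[OF x that(2)] I_def using that(2)
        by (intro order.trans[OF nn_integral_M_le[OF lambda(2) bound x]]) (auto simp: PY_comp)
    qed
    then show ?thesis unfolding VB_def VC_def
      by (subst mult.left_commute) (rule mult_left_mono, auto)
  qed
  let ?P = "\<lambda>c' V l \<omega>. ennreal c' < V l (snd \<omega>) / cond_lik mu M g (snd \<omega>) t (t + l)"
  let ?E = "{\<omega> \<in> space law. ennreal c < B_const X mu M g d0 w t T (snd \<omega>)}"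
  let ?EB = "\<lambda>l. {\<omega> \<in> space law. ?P c VB l \<omega>}" and ?EC = "{\<omega> \<in> space law. \<exists>l\<in>{lstar..T - t}. ?P (c / \<sigma>) VC l \<omega>}"
  \<comment> \<open>On the one-element range from \<open>l\<close> to \<open>l\<close> the
    martingale condition is vacuous; this admits the supremum norm, which is no martingale.\<close>
  have B: "emeasure law (?EB l) \<le> ennreal (c powr - \<alpha> * KB)" if "l < lstar" for l
  proof -
    have "emeasure law {\<omega> \<in> space law. \<exists>l\<in>{l..l}. ?P c VB l \<omega>} \<le> ennreal (c powr - \<alpha>) *
      (\<integral>\<^sup>+ \<omega>. ennreal_powr (VB l (snd \<omega>) / marg_lik kappa mu M g (snd \<omega>) t (t + l)) \<alpha> \<partial>law)"
      by (rule weak_type[OF g_pos _ VB_dep _ _ c \<alpha>]) auto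
    also have "\<dots> \<le> ennreal (c powr - \<alpha>) * ennreal KB"
      using KB[OF that] by (intro mult_left_mono) (auto simp: VB_def B_tilde_def)
    finally show ?thesis using K0 by (simp add: ennreal_mult)
  qed
  have C: "emeasure law ?EC \<le> ennreal ((c / \<sigma>) powr - \<alpha> * KC)"
  proof (cases "lstar \<le> T - t")
    case True
    \<comment> \<open>\<open>VC 0\<close> reads the observation at time \<open>t + 1\<close>,
      outside the window from \<open>t\<close> to \<open>t\<close>. Replacing it by zero yields the
      dependence condition for all \<open>l\<close> and changes nothing from \<open>lstar\<close>
      on.\<close>
    define VC' where "VC' l = (if 1 \<le> l then VC l else (\<lambda>_. 0))" for l
    have eq: "VC' l = VC l" if "lstar \<le> l" for l using that lstar by (simp add: VC'_def)
    have "emeasure law {\<omega> \<in> space law. \<exists>l\<in>{lstar..T - t}. ?P (c / \<sigma>) VC' l \<omega>} \<le> ennreal ((c / \<sigma>) powr - \<alpha>) *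
      (\<integral>\<^sup>+ \<omega>. ennreal_powr (VC' lstar (snd \<omega>) / marg_lik kappa mu M g (snd \<omega>) t (t + lstar)) \<alpha> \<partial>law)"
    proof (rule weak_type[OF g_pos _ _ _ True _ \<alpha>])
      show "VC' l \<in> borel_measurable PY" for l by (simp add: VC'_def)
      show "VC' l y = VC' l y'" if "\<And>i. t \<le> i \<Longrightarrow> i \<le> t + l \<Longrightarrow> y i = y' i" for l y y'
        using VC_dep[OF _ that] by (simp add: VC'_def)
      show "(\<integral>\<^sup>+ v. VC' (Suc l) (y(Suc (t + l) := v)) \<partial>kappa) = VC' l y" if "lstar \<le> l" "y \<in> space PY" for l y
        using VC_int[of l y] that lstar unfolding VC'_def by simp
    qed (use c \<sigma> in auto)
    also have "\<dots> \<le> ennreal ((c / \<sigma>) powr - \<alpha>) * ennreal KC"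
      using KC by (intro mult_left_mono) (auto simp: VC_def C_tilde_def I_def eq)
    also have "{\<omega> \<in> space law. \<exists>l\<in>{lstar..T - t}. ?P (c / \<sigma>) VC' l \<omega>} = ?EC"
      using eq by auto
    finally show ?thesis using K0 by (simp add: ennreal_mult)
  qed simp
  have "?E \<subseteq>
    (\<Union>l<lstar. ?EB l) \<union> ?EC"
  proof
    fix \<omega> assume "\<omega> \<in> ?E"
    then have w: "\<omega> \<in> space law" and gt: "ennreal c < B_const X mu M g d0 w t T (snd \<omega>)" by auto
    have y: "snd \<omega> \<in> space PY" using w by (auto simp: space_pair_measure)
    from gt obtain l where l: "l \<le> T - t" "?P c VB l \<omega>"
      unfolding B_const_def less_SUP_iff VB_def by auto
    show "\<omega> \<in> (\<Union>l<lstar. ?EB l) \<union> ?EC"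
    proof (cases "l < lstar")
      case True
      then show ?thesis using w l by auto
    next
      case False
      let ?L = "cond_lik mu M g (snd \<omega>) t (t + l)"
      have "ennreal c < VB l (snd \<omega>) / ?L" by (rule l)
      also have "\<dots> \<le> (ennreal \<sigma> * VC l (snd \<omega>)) / ?L"
        using False lstar y by (intro divide_right_mono_ennreal VB_le) auto
      also have "\<dots> = ennreal \<sigma> * (VC l (snd \<omega>) / ?L)" by (simp add: ennreal_times_divide)
      finally have gt: "ennreal c < ennreal \<sigma> * (VC l (snd \<omega>) / ?L)" .
      have "?P (c / \<sigma>) VC l \<omega>"
      proof (rule ccontr)
        assume "\<not> ?P (c / \<sigma>) VC l \<omega>"
        then have "ennreal \<sigma> * (VC l (snd \<omega>) / ?L) \<le> ennreal \<sigma> * ennreal (c / \<sigma>)"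
          by (intro mult_left_mono) auto
        also have "\<dots> = ennreal c" using \<sigma> c by (simp add: ennreal_mult[symmetric])
        finally show False using gt by simp
      qed
      then show ?thesis using w l False by auto
    qed
  qed
  then have "emeasure law ?E \<le>
    emeasure law ((\<Union>l<lstar. ?EB l) \<union> ?EC)"
    by (rule emeasure_mono) measurable
  also have "\<dots> \<le> emeasure law (\<Union>l<lstar. ?EB l) + emeasure law ?EC"
    by (rule emeasure_subadditive) measurable
  also have "\<dots> \<le> (\<Sum>l<lstar. ennreal (c powr - \<alpha> * KB)) + ennreal ((c / \<sigma>) powr - \<alpha> * KC)"
  proof (rule add_mono[OF _ C])
    have "emeasure law (\<Union>l<lstar. ?EB l) \<le> (\<Sum>l<lstar. emeasure law (?EB l))"
      by (rule emeasure_subadditive_finite) auto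
    also have "\<dots> \<le> (\<Sum>l<lstar. ennreal (c powr - \<alpha> * KB))" by (intro sum_mono B) auto
    finally show "emeasure law (\<Union>l<lstar. ?EB l) \<le> \<dots>" .
  qed
  also have "\<dots> = ennreal (\<Sum>l<lstar. c powr - \<alpha> * KB) + ennreal ((c / \<sigma>) powr - \<alpha> * KC)"
    using K0 by (subst sum_ennreal) auto
  also have "\<dots> = ennreal ((\<Sum>l<lstar. c powr - \<alpha> * KB) + (c / \<sigma>) powr - \<alpha> * KC)"
    using K0 by (intro ennreal_plus[symmetric]) auto
  also have "(\<Sum>l<lstar. c powr - \<alpha> * KB) + (c / \<sigma>) powr - \<alpha> * KC = (real lstar * KB + \<sigma> powr \<alpha> * KC) * c powr - \<alpha>"
    using c \<sigma> by (simp add: powr_divide powr_minus field_simps)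
  finally show ?thesis .
qed

end

section \<open>Sums of variables with heavy tails\<close>

text \<open>Comparison with the integral of \<open>x powr - \<alpha>\<close>: by the mean value
  theorem, the increment of \<open>x powr (1 - \<alpha>)\<close> over a unit interval is at least
  \<open>1 - \<alpha>\<close> times the value of \<open>x powr - \<alpha>\<close> at the right
  end.\<close>

lemma sum_powr_le:
  fixes \<alpha> :: real
  assumes \<alpha>: "0 < \<alpha>" "\<alpha> < 1"
  shows "(\<Sum>k=1..n. real k powr - \<alpha>) \<le> real n powr (1 - \<alpha>) / (1 - \<alpha>)"
proof (induction n)
  case (Suc n)
  have step: "real n powr (1 - \<alpha>) + (1 - \<alpha>) * real (Suc n) powr - \<alpha> \<le> real (Suc n) powr (1 - \<alpha>)"
  proof (cases "n = 0")
    case True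
    then show ?thesis using \<alpha> by simp
  next
    case False
    have "\<exists>z. real n < z \<and> z < real (Suc n) \<and>
      real (Suc n) powr (1 - \<alpha>) - real n powr (1 - \<alpha>) = (real (Suc n) - real n) * ((1 - \<alpha>) * z powr (1 - \<alpha> - 1))"
      using False by (intro MVT2 has_real_derivative_powr) auto
    then obtain z where z: "real n < z" "z < real (Suc n)"
      and eq: "real (Suc n) powr (1 - \<alpha>) - real n powr (1 - \<alpha>) = (1 - \<alpha>) * z powr - \<alpha>" by auto
    have "real (Suc n) powr - \<alpha> \<le> z powr - \<alpha>"
      using z False \<alpha> by (intro powr_mono2') auto
    then have "(1 - \<alpha>) * real (Suc n) powr - \<alpha> \<le> (1 - \<alpha>) * z powr - \<alpha>"
      using \<alpha> by (intro mult_left_mono) auto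
    then show ?thesis using eq by linarith
  qed
  have "(\<Sum>k=1..Suc n. real k powr - \<alpha>) \<le> real n powr (1 - \<alpha>) / (1 - \<alpha>) + real (Suc n) powr - \<alpha>"
    using Suc by simp
  also have "\<dots> \<le> real (Suc n) powr (1 - \<alpha>) / (1 - \<alpha>)"
    using divide_right_mono[OF step, of "1 - \<alpha>"] \<alpha> by (simp add: add_divide_distrib)
  finally show ?case .
qed (use \<alpha> in simp)

text \<open>A discrete layer-cake bound: the truncated value, up to rounding by one, counts the
  integer levels below it. Tail bounds at integer levels thereby control the truncated mean.\<close>

lemma min_le_sum_indicator:
  fixes b :: ennreal
  shows "min b (of_nat (Suc n)) \<le> 1 + (\<Sum>k=1..n. if of_nat k < b then 1 else 0)"
proof (induction n)
  case (Suc n)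
  have "min b (of_nat (Suc (Suc n))) \<le> min b (of_nat (Suc n)) + (if of_nat (Suc n) < b then 1 else 0)"
  proof (cases "of_nat (Suc n) < b")
    case True
    have "min b (of_nat (Suc n)) = of_nat (Suc n)" by (rule min.absorb2[OF less_imp_le[OF True]])
    then show ?thesis using True by (simp add: min.coboundedI2 add.commute)
  qed (auto simp: min_def)
  also have "\<dots> \<le> 1 + (\<Sum>k=1..n. if of_nat k < b then 1 else 0) + (if of_nat (Suc n) < b then 1 else 0)"
    by (intro add_right_mono Suc)
  finally show ?case by (simp add: add.assoc)
qed simp

text \<open>Either some variable exceeds \<open>n\<close>, or the sum of the variables truncated at \<open>n\<close> does; the
  mean of a truncated variable is at most one plus the sum of its tails.\<close>

lemma sum_tail_bound:
  fixes B :: "'i \<Rightarrow> 'a \<Rightarrow> ennreal"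
  assumes P: "prob_space P" and B[measurable]: "\<And>t. t \<in> I \<Longrightarrow> B t \<in> borel_measurable P" and I: "finite I"
    and K: "0 \<le> K" and \<alpha>: "0 < \<alpha>" "\<alpha> < 1"
    and tail: "\<And>t k. t \<in> I \<Longrightarrow> 1 \<le> k \<Longrightarrow> emeasure P {x \<in> space P. of_nat k < B t x} \<le> ennreal (K * real k powr - \<alpha>)"
    and n: "1 \<le> n"
  shows "emeasure P {x \<in> space P. of_nat n < (\<Sum>t\<in>I. B t x)} \<le> ennreal (real (card I) * ((K + 1 + K / (1 - \<alpha>)) * real n powr - \<alpha>))"
proof -
  interpret prob_space P by fact
  let ?A = "\<lambda>t. {x \<in> space P. of_nat n < B t x}" and ?E = "{x \<in> space P. of_nat n < (\<Sum>t\<in>I. B t x)}"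
  let ?D = "{x \<in> space P. 1 \<le> (1 / of_nat n) * (\<Sum>t\<in>I. min (B t x) (of_nat n))}"
  obtain m where m: "n = Suc m" using n by (cases n) auto
  define E where "E = K * real n powr - \<alpha>"
  \<comment> \<open>\<open>F\<close> bounds the mean of one truncated variable. Since \<alpha> < 1,
    the sum of the tails up to \<open>n\<close> is of order \<open>n powr (1 - \<alpha>)\<close>;
    after division by \<open>n\<close> in Markov's inequality it has the same order as the
    probability \<open>E\<close> of a single exceedance.\<close>
  define F where "F = 1 + K * (real n powr (1 - \<alpha>) / (1 - \<alpha>))"
  have EF: "0 \<le> E" "0 \<le> F" using K \<alpha> by (auto simp: E_def F_def)
  have E_min: "(\<integral>\<^sup>+ x. min (B t x) (of_nat n) \<partial>P) \<le> ennreal F" if t: "t \<in> I" for t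
  proof -
    note [measurable] = B[OF t]
    have "(\<integral>\<^sup>+ x. min (B t x) (of_nat n) \<partial>P) \<le> (\<integral>\<^sup>+ x. 1 + (\<Sum>k=1..m. indicator {x \<in> space P. of_nat k < B t x} x) \<partial>P)"
    proof (rule nn_integral_mono)
      fix x assume x: "x \<in> space P"
      have "(\<Sum>k=1..m. if of_nat k < B t x then 1 else 0) = (\<Sum>k=1..m. indicator {x \<in> space P. of_nat k < B t x} x :: ennreal)"
        using x by (intro sum.cong) (auto simp: indicator_def)
      then show "min (B t x) (of_nat n) \<le> 1 + (\<Sum>k=1..m. indicator {x \<in> space P. of_nat k < B t x} x)"
        unfolding m using min_le_sum_indicator[of "B t x" m] by simp
    qed
    also have "\<dots> = 1 + (\<Sum>k=1..m. emeasure P {x \<in> space P. of_nat k < B t x})"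
      by (subst nn_integral_add) (auto simp: nn_integral_sum emeasure_space_1)
    also have "\<dots> \<le> 1 + (\<Sum>k=1..m. ennreal (K * real k powr - \<alpha>))"
      by (intro add_left_mono sum_mono tail t) auto
    also have "\<dots> = ennreal (1 + K * (\<Sum>k=1..m. real k powr - \<alpha>))"
      using K by (subst ennreal_plus) (auto simp: sum_ennreal sum_nonneg sum_distrib_left)
    also have "\<dots> \<le> ennreal F"
    proof -
      have "(\<Sum>k=1..m. real k powr - \<alpha>) \<le> real n powr (1 - \<alpha>) / (1 - \<alpha>)"
        by (rule order.trans[OF sum_powr_le[OF \<alpha>]]) (use \<alpha> m in \<open>auto intro!: divide_right_mono powr_mono2\<close>)
      then show ?thesis unfolding F_def using K by (intro ennreal_leI add_left_mono mult_left_mono) auto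
    qed
    finally show ?thesis .
  qed
  have [measurable]: "?D \<in> sets P"
    by measurable
  have [simp]: "?A t \<in> sets P" if "t \<in> I" for t
    using B[OF that] by measurable
  have "?E \<subseteq>
    (\<Union>t\<in>I. ?A t) \<union> ?D"
  proof safe
    fix x assume x: "x \<in> space P" and gt: "of_nat n < (\<Sum>t\<in>I. B t x)"
      and small: "x \<notin> (\<Union>t\<in>I. ?A t)"
    have "(\<Sum>t\<in>I. B t x) = (\<Sum>t\<in>I. min (B t x) (of_nat n))"
      using small x by (intro sum.cong) (auto simp: min_def not_less)
    then have "of_nat n \<le> (\<Sum>t\<in>I. min (B t x) (of_nat n))" using gt by simp
    then have "(1 / of_nat n) * of_nat n \<le> (1 / of_nat n) * (\<Sum>t\<in>I. min (B t x) (of_nat n))"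
      by (rule mult_left_mono) simp
    moreover have "(1 / of_nat n) * of_nat n = (1::ennreal)"
      using n by (simp add: ennreal_of_nat_eq_real_of_nat divide_ennreal ennreal_1[symmetric] ennreal_mult[symmetric] del: ennreal_1)
    ultimately show "1 \<le> (1 / of_nat n) * (\<Sum>t\<in>I. min (B t x) (of_nat n))" by simp
  qed
  then have "emeasure P ?E \<le>
    emeasure P ((\<Union>t\<in>I. ?A t) \<union> ?D)"
    using I by (intro emeasure_mono sets.Un sets.finite_UN) auto
  also have "\<dots> \<le> emeasure P (\<Union>t\<in>I. ?A t) +
     emeasure P ?D"
    using I by (intro emeasure_subadditive sets.finite_UN) auto
  also have "\<dots> \<le> (\<Sum>t\<in>I. ennreal E) + (1 / of_nat n) * (\<Sum>t\<in>I. ennreal F)"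
  proof (rule add_mono)
    have "emeasure P (\<Union>t\<in>I. ?A t) \<le> (\<Sum>t\<in>I. emeasure P (?A t))"
      using I by (intro emeasure_subadditive_finite) auto
    also have "\<dots> \<le> (\<Sum>t\<in>I. ennreal E)"
      unfolding E_def by (intro sum_mono tail n)
    finally show "emeasure P (\<Union>t\<in>I. ?A t) \<le> \<dots>" .
    have "emeasure P ?D \<le>
      (1 / of_nat n) * (\<integral>\<^sup>+ x. (\<Sum>t\<in>I. min (B t x) (of_nat n)) \<partial>P)"
      using nn_integral_Markov_inequality[where u="\<lambda>x. \<Sum>t\<in>I. min (B t x) (of_nat n)" and M=P and A="space P" and c="1 / of_nat n"]
      by (simp cong: nn_integral_cong)
    also have "(\<integral>\<^sup>+ x. (\<Sum>t\<in>I. min (B t x) (of_nat n)) \<partial>P) = (\<Sum>t\<in>I. \<integral>\<^sup>+ x. min (B t x) (of_nat n) \<partial>P)"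
      by (rule nn_integral_sum) measurable
    also have "(1 / of_nat n) * \<dots> \<le> (1 / of_nat n) * (\<Sum>t\<in>I. ennreal F)"
      by (intro mult_left_mono sum_mono E_min) auto
    finally show "emeasure P ?D \<le> \<dots>" .
  qed
  also have "\<dots> = ennreal (real (card I) * E + (1 / real n) * (real (card I) * F))"
  proof -
    have "(1 / of_nat n :: ennreal) = ennreal (1 / real n)"
      using n by (simp add: ennreal_of_nat_eq_real_of_nat divide_ennreal ennreal_1[symmetric] del: ennreal_1)
    then show ?thesis using EF
      by (simp add: ennreal_of_nat_eq_real_of_nat ennreal_mult[symmetric] ennreal_plus[symmetric] del: ennreal_plus)
  qed
  also have "\<dots> \<le> ennreal (real (card I) * ((K + 1 + K / (1 - \<alpha>)) * real n powr - \<alpha>))"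
  proof (rule ennreal_leI)
    have 1: "real n powr (1 - \<alpha>) = real n * real n powr - \<alpha>"
      using n by (simp add: powr_diff powr_minus field_simps)
    \<comment> \<open>The constant 1 in \<open>F\<close> becomes \<open>1 / n\<close>, which is
      absorbed into \<open>n powr - \<alpha>\<close>. It accounts for the middle summand of
      \<open>K + 1 + K / (1 - \<alpha>)\<close>.\<close>
    have "real n powr -1 \<le> real n powr - \<alpha>" using n \<alpha> by (intro powr_mono) auto
    then have 2: "1 / real n \<le> real n powr - \<alpha>" using n by (simp add: powr_minus divide_inverse)
    have "(1 / real n) * F = 1 / real n + K * real n powr - \<alpha> / (1 - \<alpha>)"
      unfolding F_def 1 using n by (simp add: field_simps)
    then have "E + (1 / real n) * F \<le> (K + 1 + K / (1 - \<alpha>)) * real n powr - \<alpha>"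
      using 2 by (simp add: E_def distrib_right)
    from mult_left_mono[OF this, of "real (card I)"]
    show "real (card I) * E + (1 / real n) * (real (card I) * F) \<le> real (card I) * ((K + 1 + K / (1 - \<alpha>)) * real n powr - \<alpha>)"
      by (simp add: distrib_left mult.left_commute)
  qed
  finally show ?thesis .
qed

lemma inverse_ennreal_antimono: "a \<le> b \<Longrightarrow> inverse b \<le> inverse (a::ennreal)"
  by (cases a rule: ennreal_cases; cases b rule: ennreal_cases; cases "a = 0"; cases "b = 0")
    (auto simp: inverse_ennreal less_le top_unique intro!: ennreal_leI)

text \<open>Raising \<open>N - 2\<close> to \<open>N - 1\<close> in the denominator gives each
  factor the lower bound \<open>1 / (1 + x)\<close> with \<open>x = 2 * b t / (N - 1)\<close>, hence
  \<open>exp (- x)\<close>. The exponents add up to at most \<open>2 * s * N / (N - 1)\<close>, and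
  \<open>N \<ge> 2\<close> turns this into \<open>4 * s\<close>.\<close>

lemma prod_ratio_bound:
  fixes B :: "'i \<Rightarrow> ennreal"
  assumes I: "finite I" and N: "2 \<le> N" and s: "0 \<le> s" and sum: "(\<Sum>t\<in>I. B t) \<le> ennreal (s * real N)"
  shows "inverse (\<Prod>t\<in>I. ennreal (real N - 1) / (2 * B t + ennreal (real N - 2))) \<le> ennreal (exp (4 * s))"
proof -
  define b where "b t = enn2real (B t)" for t
  have Bb: "B t = ennreal (b t)" if "t \<in> I" for t
  proof -
    have "B t \<le> (\<Sum>t\<in>I. B t)" using I that by (intro member_le_sum) auto
    then have "B t < \<infinity>" using sum by (metis ennreal_less_top infinity_ennreal_def order.strict_trans1)
    then show ?thesis by (simp add: b_def)
  qed
  have b0: "0 \<le> b t" for t by (simp add: b_def)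
  have "(\<Sum>t\<in>I. B t) = ennreal (\<Sum>t\<in>I. b t)"
    using b0 Bb by (simp add: sum_ennreal cong: sum.cong)
  then have sb: "(\<Sum>t\<in>I. b t) \<le> s * real N"
    using sum s by (simp add: ennreal_le_iff)
  have factor: "ennreal (exp (- (2 * b t / (real N - 1)))) \<le> ennreal (real N - 1) / (2 * B t + ennreal (real N - 2))" if t: "t \<in> I" for t
  proof -
    have "exp (- (2 * b t / (real N - 1))) \<le> 1 / (1 + 2 * b t / (real N - 1))"
      using exp_ge_add_one_self[of "2 * b t / (real N - 1)"] b0[of t] N
      by (simp add: exp_minus inverse_eq_divide frac_le add_pos_nonneg)
    also have "\<dots> = (real N - 1) / (2 * b t + (real N - 1))" using N b0[of t] by (simp add: field_simps)
    finally have "ennreal (exp (- (2 * b t / (real N - 1)))) \<le> ennreal ((real N - 1) / (2 * b t + (real N - 1)))"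
      by (rule ennreal_leI)
    also have "\<dots> = ennreal (real N - 1) / (2 * B t + ennreal (real N - 1))"
      using N b0[of t] Bb[OF t] by (simp add: divide_ennreal[symmetric] add_nonneg_pos ennreal_mult')
    also have "\<dots> \<le> ennreal (real N - 1) / (2 * B t + ennreal (real N - 2))"
      unfolding divide_ennreal_def by (intro mult_left_mono inverse_ennreal_antimono add_left_mono ennreal_leI) auto
    finally show ?thesis .
  qed
  have "exp (- (4 * s)) \<le> exp (- (\<Sum>t\<in>I. 2 * b t / (real N - 1)))"
  proof -
    have "(\<Sum>t\<in>I. 2 * b t / (real N - 1)) = 2 * (\<Sum>t\<in>I. b t) / (real N - 1)"
      by (simp add: sum_distrib_left sum_divide_distrib)
    also have "\<dots> \<le> 2 * (s * real N) / (real N - 1)" using sb N by (intro divide_right_mono) auto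
    also have "\<dots> \<le> 4 * s"
    proof -
      have "s * 2 \<le> s * real N" using s N by (intro mult_left_mono) auto
      then show ?thesis using N by (simp add: field_simps)
    qed
    finally show ?thesis by simp
  qed
  also have "\<dots> = (\<Prod>t\<in>I. exp (- (2 * b t / (real N - 1))))"
    using I by (simp add: exp_sum sum_negf[symmetric])
  finally have "ennreal (exp (- (4 * s))) \<le> ennreal (\<Prod>t\<in>I. exp (- (2 * b t / (real N - 1))))"
    by (rule ennreal_leI)
  also have "\<dots> = (\<Prod>t\<in>I. ennreal (exp (- (2 * b t / (real N - 1)))))"
    by (rule prod_ennreal[symmetric]) auto
  also have "\<dots> \<le> (\<Prod>t\<in>I. ennreal (real N - 1) / (2 * B t + ennreal (real N - 2)))"
    by (intro prod_mono_ennreal factor)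
  finally have "inverse (\<Prod>t\<in>I. ennreal (real N - 1) / (2 * B t + ennreal (real N - 2))) \<le> inverse (ennreal (exp (- (4 * s))))"
    by (rule inverse_ennreal_antimono)
  also have "\<dots> = ennreal (exp (4 * s))" by (simp add: inverse_ennreal exp_minus)
  finally show ?thesis .
qed

lemma growth_bound:
  fixes N :: "nat \<Rightarrow> nat" and \<alpha> \<gamma> :: real
  assumes gamma: "0 < \<gamma>" "\<gamma> < \<alpha>"
    and N_ge_2: "\<And>T. 1 \<le> T \<Longrightarrow> 2 \<le> N T"
    and N_asymp: "(\<lambda>T. real (N T)) \<sim>[at_top] (\<lambda>T. real T powr (1 / \<gamma>))"
  shows "\<exists>C. \<forall>T\<ge>1. real (Suc T) * real (N T) powr - \<alpha> \<le> C"
proof -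
  have "eventually (\<lambda>T. real T powr (1 / \<gamma>) \<noteq> 0) at_top"
    using eventually_gt_at_top[of "0::nat"] by eventually_elim auto
  then have "((\<lambda>T. real (N T) / real T powr (1 / \<gamma>)) \<longlongrightarrow> 1) at_top"
    by (intro asymp_equivD_strong[OF N_asymp]) (elim eventually_mono, simp)
  then have "eventually (\<lambda>T. real (N T) / real T powr (1 / \<gamma>) > 1 / 2) at_top"
    by (rule order_tendstoD) simp
  then obtain T1 where T1: "\<And>T. T1 \<le> T \<Longrightarrow> real (N T) / real T powr (1 / \<gamma>) > 1 / 2"
    unfolding eventually_at_top_linorder by auto
  \<comment> \<open>The first bound covers \<open>T < T1\<close>, where the negative power of
    \<open>N T\<close> is at most 1. The second covers larger \<open>T\<close>: there
    \<open>N T\<close> is at least half of \<open>T powr (1 / \<gamma>)\<close>, and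
    \<open>Suc T\<close> is at most \<open>2 * T\<close>.\<close>
  have "real (Suc T) * real (N T) powr - \<alpha> \<le> max (real (Suc T1)) (2 * 2 powr \<alpha>)" if T: "1 \<le> T" for T
  proof (cases "T1 \<le> T")
    case True
    have "real T powr (1 / \<gamma>) / 2 \<le> real (N T)"
      using T1[OF True] T by (simp add: field_simps)
    then have "real (N T) powr - \<alpha> \<le> (real T powr (1 / \<gamma>) / 2) powr - \<alpha>"
      using T gamma by (intro powr_mono2') auto
    also have "\<dots> = 2 powr \<alpha> * real T powr (- \<alpha> / \<gamma>)"
      by (simp add: powr_divide powr_powr powr_minus field_simps)
    also have "\<dots> \<le> 2 powr \<alpha> * real T powr (- 1)"
      using T gamma by (intro mult_left_mono powr_mono) (auto simp: field_simps)
    finally have "real (N T) powr - \<alpha> \<le> 2 powr \<alpha> / real T"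
      using T by (simp add: powr_minus divide_inverse)
    then have "real (Suc T) * real (N T) powr - \<alpha> \<le> (2 * real T) * (2 powr \<alpha> / real T)"
      using T by (intro mult_mono) auto
    then show ?thesis using T by simp
  next
    case False
    have "real (N T) powr - \<alpha> \<le> real (N T) powr 0"
      using N_ge_2[OF T] gamma by (intro powr_mono) auto
    then have "real (N T) powr - \<alpha> \<le> 1" using N_ge_2[OF T] by simp
    then have "real (Suc T) * real (N T) powr - \<alpha> \<le> real (Suc T1) * 1"
      using False by (intro mult_mono) auto
    then show ?thesis by simp
  qed
  then show ?thesis by blast
qed

section \<open>Change of measure\<close>

text \<open>\<open>S\<close>, with unprimed densities, carries the law to which a bound is
  transferred, and \<open>R\<close>, with primed densities, the law under which it is proved. The
  initial laws \<open>nu\<close> and \<open>mu\<close> may differ, which \<open>rho\<close> accounts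
  for; stationarity of \<open>nu\<close> is added where it is used.\<close>

locale hmm_pair =
  S: hmm_density X Y kappa nu M G g + R: hmm_density X Y kappa mu M' G' g'
  for X :: "'x measure" and Y :: "'y measure" and kappa nu M G g mu M' G' g' +
  fixes lambda :: "'x measure" and m m' :: "'x \<Rightarrow> 'x \<Rightarrow> real" and rho :: "'x \<Rightarrow> ennreal"
  assumes lambda: "sigma_finite_measure lambda" "sets lambda = sets X"
    and m_measurable: "(\<lambda>(x, x'). m x x') \<in> borel_measurable (X \<Otimes>\<^sub>M X)"
    and m'_measurable: "(\<lambda>(x, x'). m' x x') \<in> borel_measurable (X \<Otimes>\<^sub>M X)"
    and m_density: "\<And>x. x \<in> space X \<Longrightarrow> M x = density lambda (\<lambda>x'. ennreal (m x x'))"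
    and m'_density: "\<And>x. x \<in> space X \<Longrightarrow> M' x = density lambda (\<lambda>x'. ennreal (m' x x'))"
    and m_pos: "\<And>x x'. x \<in> space X \<Longrightarrow> x' \<in> space X \<Longrightarrow> 0 < m x x'"
    and m'_pos: "\<And>x x'. x \<in> space X \<Longrightarrow> x' \<in> space X \<Longrightarrow> 0 < m' x x'"
    and g_pos: "\<And>x y. x \<in> space X \<Longrightarrow> y \<in> space Y \<Longrightarrow> 0 < g x y"
    and g'_pos: "\<And>x y. x \<in> space X \<Longrightarrow> y \<in> space Y \<Longrightarrow> 0 < g' x y"
    and rho_measurable [measurable]: "rho \<in> borel_measurable X"
    and rho: "density mu rho = nu"
begin

definition ratio :: "'x \<Rightarrow> 'x \<Rightarrow> 'y \<Rightarrow> real" where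
  "ratio x x' y = (m x x' * g x' y) / (m' x x' * g' x' y)"

abbreviation "\<Omega> \<equiv> S.PX \<Otimes>\<^sub>M S.PY"

abbreviation "step_ratio s \<omega> \<equiv> ratio (fst \<omega> s) (fst \<omega> (Suc s)) (snd \<omega> (Suc s))"

text \<open>The density of the first law with respect to the second on states and observations up to
  time \<open>n\<close>. The observation at time 0 has a factor of its own because no transition
  precedes it.\<close>

definition lratio :: "nat \<Rightarrow> (nat \<Rightarrow> 'x) \<times> (nat \<Rightarrow> 'y) \<Rightarrow> ennreal" where
  "lratio n \<omega> = rho (fst \<omega> 0) * ennreal (g (fst \<omega> 0) (snd \<omega> 0) / g' (fst \<omega> 0) (snd \<omega> 0))
     * (\<Prod>s<n. ennreal (step_ratio s \<omega>))"

lemma m_measurable_comp [measurable (raw)]: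
  "f \<in> N \<rightarrow>\<^sub>M X \<Longrightarrow> h \<in> N \<rightarrow>\<^sub>M X \<Longrightarrow> (\<lambda>a. m (f a) (h a)) \<in> borel_measurable N"
  using measurable_compose[OF measurable_Pair m_measurable] by simp

lemma m'_measurable_comp [measurable (raw)]:
  "f \<in> N \<rightarrow>\<^sub>M X \<Longrightarrow> h \<in> N \<rightarrow>\<^sub>M X \<Longrightarrow> (\<lambda>a. m' (f a) (h a)) \<in> borel_measurable N"
  using measurable_compose[OF measurable_Pair m'_measurable] by simp

lemma ratio_measurable_comp [measurable (raw)]:
  "f \<in> N \<rightarrow>\<^sub>M X \<Longrightarrow> h \<in> N \<rightarrow>\<^sub>M X \<Longrightarrow> k \<in> N \<rightarrow>\<^sub>M Y \<Longrightarrow> (\<lambda>a. ratio (f a) (h a) (k a)) \<in> borel_measurable N"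
  unfolding ratio_def
  by (intro borel_measurable_divide borel_measurable_times m_measurable_comp m'_measurable_comp
      S.g_measurable_comp R.g_measurable_comp)

lemma ratio_pos: "x \<in> space X \<Longrightarrow> x' \<in> space X \<Longrightarrow> y \<in> space Y \<Longrightarrow> 0 < ratio x x' y"
  unfolding ratio_def by (simp add: m_pos m'_pos g_pos g'_pos)

lemma coord [measurable]:
  "(\<lambda>\<omega>. fst \<omega> i) \<in> \<Omega> \<rightarrow>\<^sub>M X" "(\<lambda>\<omega>. snd \<omega> i) \<in> \<Omega> \<rightarrow>\<^sub>M Y"
  by measurable

lemma coord_space: "\<omega> \<in> space \<Omega> \<Longrightarrow> fst \<omega> i \<in> space X" "\<omega> \<in> space \<Omega> \<Longrightarrow> snd \<omega> i \<in> space Y"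
  by (auto simp: space_pair_measure space_PiM)

lemma lratio_measurable [measurable]: "lratio n \<in> borel_measurable \<Omega>"
  unfolding lratio_def by measurable

text \<open>One step of either model is written over the common dominating measures \<lambda> and
  \<open>kappa\<close>, where positivity of all densities permits the division.\<close>

lemma kernel_change:
  assumes x: "x \<in> space X" and F[measurable]: "(\<lambda>(v, u). F v u) \<in> borel_measurable (X \<Otimes>\<^sub>M Y)"
  shows "(\<integral>\<^sup>+ v. \<integral>\<^sup>+ u. F v u \<partial>G v \<partial>M x) = (\<integral>\<^sup>+ v. \<integral>\<^sup>+ u. F v u * ennreal (ratio x v u) \<partial>G' v \<partial>M' x)"
proof -
  interpret kappa: sigma_finite_measure kappa by (rule S.kappa_sigma_finite)
  have [measurable]: "(\<lambda>a. F (f a) (h a)) \<in> borel_measurable N" if "f \<in> N \<rightarrow>\<^sub>M X" "h \<in> N \<rightarrow>\<^sub>M Y" for f h N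
    using measurable_compose[OF measurable_Pair[OF that] F] by simp
  note [measurable_cong] = lambda(2) S.sets_kappa
  note [measurable] = x
  have space_lambda: "space lambda = space X" using sets_eq_imp_space_eq[OF lambda(2)] .
  have "(\<integral>\<^sup>+ v. \<integral>\<^sup>+ u. F v u \<partial>G v \<partial>M x) = (\<integral>\<^sup>+ v. \<integral>\<^sup>+ u. ennreal (g v u) * F v u \<partial>kappa \<partial>M x)"
    using x by (intro nn_integral_cong S.nn_integral_G) auto
  also have "\<dots> = (\<integral>\<^sup>+ v. ennreal (m x v) * (\<integral>\<^sup>+ u. ennreal (g v u) * F v u \<partial>kappa) \<partial>lambda)"
    unfolding m_density[OF x] by (rule nn_integral_density) measurable
  also have "\<dots> = (\<integral>\<^sup>+ v. ennreal (m' x v) * (\<integral>\<^sup>+ u. ennreal (g' v u) * (F v u * ennreal (ratio x v u)) \<partial>kappa) \<partial>lambda)"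
  proof (rule nn_integral_cong)
    fix v assume "v \<in> space lambda"
    then have v[measurable]: "v \<in> space X" by (simp add: space_lambda)
    have "ennreal (m x v) * (\<integral>\<^sup>+ u. ennreal (g v u) * F v u \<partial>kappa) = (\<integral>\<^sup>+ u. ennreal (m x v) * (ennreal (g v u) * F v u) \<partial>kappa)"
      by (rule nn_integral_cmult[symmetric]) measurable
    also have "\<dots> = (\<integral>\<^sup>+ u. ennreal (m' x v) * (ennreal (g' v u) * (F v u * ennreal (ratio x v u))) \<partial>kappa)"
    proof (rule nn_integral_cong)
      fix u assume "u \<in> space kappa"
      then have u: "u \<in> space Y" by (simp add: S.space_kappa)
      have "ennreal (m x v) * ennreal (g v u) = ennreal (m' x v) * ennreal (g' v u) * ennreal (ratio x v u)"
        using m_pos[OF x v] m'_pos[OF x v] g_pos[OF v u] g'_pos[OF v u]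
        by (simp add: ratio_def ennreal_mult[symmetric])
      then show "ennreal (m x v) * (ennreal (g v u) * F v u) = ennreal (m' x v) * (ennreal (g' v u) * (F v u * ennreal (ratio x v u)))"
        by (metis mult.assoc mult.commute)
    qed
    also have "\<dots> = ennreal (m' x v) * (\<integral>\<^sup>+ u. ennreal (g' v u) * (F v u * ennreal (ratio x v u)) \<partial>kappa)"
      by (rule nn_integral_cmult) measurable
    finally show "ennreal (m x v) * (\<integral>\<^sup>+ u. ennreal (g v u) * F v u \<partial>kappa) = \<dots>" .
  qed
  also have "\<dots> = (\<integral>\<^sup>+ v. \<integral>\<^sup>+ u. ennreal (g' v u) * (F v u * ennreal (ratio x v u)) \<partial>kappa \<partial>M' x)"
    unfolding m'_density[OF x] by (rule nn_integral_density[symmetric]) measurable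
  also have "\<dots> = (\<integral>\<^sup>+ v. \<integral>\<^sup>+ u. F v u * ennreal (ratio x v u) \<partial>G' v \<partial>M' x)"
    using x by (intro nn_integral_cong R.nn_integral_G[symmetric]) auto
  finally show ?thesis .
qed

lemma lratio_upd: "lratio (Suc n) (upd (Suc n) \<omega> v u) = lratio n \<omega> * ennreal (ratio (fst \<omega> n) v u)"
proof -
  have "(\<Prod>s<n. ennreal (ratio (((fst \<omega>)(Suc n := v)) s) (((fst \<omega>)(Suc n := v)) (Suc s)) (((snd \<omega>)(Suc n := u)) (Suc s))))
    = (\<Prod>s<n. ennreal (step_ratio s \<omega>))"
    by (intro prod.cong) auto
  then show ?thesis by (simp add: lratio_def mult.assoc)
qed

lemma adapted_lratio: "adapted n (lratio n)"
  unfolding adapted_def lratio_def by (auto intro!: prod.cong arg_cong2[where f="(*)"])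

text \<open>The identity concerns adapted integrands: on the whole sequence space the two laws may
  be mutually singular. In the induction step, the last draw is written as a kernel integral, which
  is adapted to \<open>n\<close>; after the induction hypothesis, \<open>kernel_change\<close>
  supplies the missing factor.\<close>

lemma change_of_measure:
  "f \<in> borel_measurable \<Omega> \<Longrightarrow> adapted n f \<Longrightarrow>
    (\<integral>\<^sup>+ \<omega>. f \<omega> \<partial>S.law) = (\<integral>\<^sup>+ \<omega>. f \<omega> * lratio n \<omega> \<partial>R.law)"
proof (induction n arbitrary: f)
  case 0
  note [measurable] = 0(1)
  obtain x0 y0 where x0[measurable]: "x0 \<in> space S.PX" and y0[measurable]: "y0 \<in> space S.PY"
    using S.PX_ne S.PY_ne by blast
  have [measurable]: "(\<lambda>v. y0(k := v)) \<in> Y \<rightarrow>\<^sub>M S.PY" "(\<lambda>v. x0(k := v)) \<in> X \<rightarrow>\<^sub>M S.PX" for k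
    by (auto intro!: measurable_fun_upd_UNIV x0 y0)
  let ?p = "\<lambda>v u. (x0(0 := v), y0(0 := u))"
  have nu: "(\<integral>\<^sup>+ v. h v \<partial>nu) = (\<integral>\<^sup>+ v. rho v * h v \<partial>mu)" if "h \<in> borel_measurable X" for h
    unfolding rho[symmetric] using that by (intro nn_integral_density) auto
  have fm: "(\<lambda>z. f (x0(0 := fst z), y0(0 := snd z))) \<in> borel_measurable (X \<Otimes>\<^sub>M Y)"
    by measurable
  have "(\<integral>\<^sup>+ \<omega>. f \<omega> \<partial>S.law) = (\<integral>\<^sup>+ v. \<integral>\<^sup>+ u. f (?p v u) \<partial>G v \<partial>nu)"
    by (rule S.law_0[OF 0 x0 y0])
  also have "\<dots> = (\<integral>\<^sup>+ v. rho v * (\<integral>\<^sup>+ u. f (?p v u) \<partial>G v) \<partial>mu)"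
    using S.nn_integral_G_measurable[of "\<lambda>v u. f (?p v u)" X "\<lambda>x. x"] fm
    by (intro nu) (auto simp: case_prod_beta)
  also have "\<dots> = (\<integral>\<^sup>+ v. \<integral>\<^sup>+ u. f (?p v u) * lratio 0 (?p v u) \<partial>G' v \<partial>mu)"
  proof (rule nn_integral_cong)
    fix v assume "v \<in> space mu"
    then have v[measurable]: "v \<in> space X" by simp
    note [measurable_cong] = S.sets_kappa
    have fv[measurable]: "(\<lambda>u. f (?p v u)) \<in> borel_measurable Y"
      by measurable
    have "rho v * (\<integral>\<^sup>+ u. f (?p v u) \<partial>G v) = rho v * (\<integral>\<^sup>+ u. ennreal (g v u) * f (?p v u) \<partial>kappa)"
      by (subst S.nn_integral_G[OF v]) auto
    also have "\<dots> = (\<integral>\<^sup>+ u. rho v * (ennreal (g v u) * f (?p v u)) \<partial>kappa)"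
      by (rule nn_integral_cmult[symmetric]) measurable
    also have "\<dots> = (\<integral>\<^sup>+ u. ennreal (g' v u) * (f (?p v u) * lratio 0 (?p v u)) \<partial>kappa)"
    proof (rule nn_integral_cong)
      fix u assume "u \<in> space kappa"
      then have u: "u \<in> space Y" by (simp add: S.space_kappa)
      have "ennreal (g v u) = ennreal (g' v u) * ennreal (g v u / g' v u)"
        using g_pos[OF v u] g'_pos[OF v u] by (simp add: ennreal_mult[symmetric])
      then show "rho v * (ennreal (g v u) * f (?p v u)) =
          ennreal (g' v u) * (f (?p v u) * lratio 0 (?p v u))"
        by (simp add: lratio_def ac_simps)
    qed
    also have "\<dots> = (\<integral>\<^sup>+ u. f (?p v u) * lratio 0 (?p v u) \<partial>G' v)"
      by (subst R.nn_integral_G[OF v]) auto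
    finally show "rho v * (\<integral>\<^sup>+ u. f (?p v u) \<partial>G v) = \<dots>" .
  qed
  also have "\<dots> = (\<integral>\<^sup>+ \<omega>. f \<omega> * lratio 0 \<omega> \<partial>R.law)"
  proof (rule R.law_0[OF _ _ x0 y0, symmetric])
    show "adapted 0 (\<lambda>\<omega>. f \<omega> * lratio 0 \<omega>)"
      using 0(2) adapted_lratio[of 0] unfolding adapted_def by metis
  qed measurable
  finally show ?case .
next
  case (Suc n)
  note [measurable] = Suc.prems(1)
  let ?k = "\<lambda>\<omega>. \<integral>\<^sup>+ v. \<integral>\<^sup>+ u. f (upd (Suc n) \<omega> v u) \<partial>G v \<partial>M (fst \<omega> n)"
  have k: "?k \<in> borel_measurable \<Omega>"
    by (rule S.one_step_measurable) fact
  have ka: "adapted n ?k"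
    unfolding adapted_def
  proof (intro allI impI)
    fix x x' :: "nat \<Rightarrow> 'x" and y y' :: "nat \<Rightarrow> 'y" assume eq: "\<forall>i\<le>n. x i = x' i \<and> y i = y' i"
    have "f (x(Suc n := v), y(Suc n := u)) = f (x'(Suc n := v), y'(Suc n := u))" for v u
      using eq by (intro adaptedD[OF Suc.prems(2)]) (auto simp: le_Suc_eq)
    then show "?k (x, y) = ?k (x', y')" using eq by simp
  qed
  have "(\<integral>\<^sup>+ \<omega>. f \<omega> \<partial>S.law) = (\<integral>\<^sup>+ \<omega>. ?k \<omega> \<partial>S.law)"
    by (rule S.law_Suc[OF Suc.prems])
  also have "\<dots> = (\<integral>\<^sup>+ \<omega>. ?k \<omega> * lratio n \<omega> \<partial>R.law)"
    by (rule Suc.IH[OF k ka])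
  also have "\<dots> = (\<integral>\<^sup>+ \<omega>. \<integral>\<^sup>+ v. \<integral>\<^sup>+ u. f (upd (Suc n) \<omega> v u) *
      lratio (Suc n) (upd (Suc n) \<omega> v u) \<partial>G' v \<partial>M' (fst \<omega> n) \<partial>R.law)"
  proof (rule nn_integral_cong)
    fix \<omega> assume "\<omega> \<in> space R.law"
    then have w: "\<omega> \<in> space \<Omega>" by simp
    have x: "fst \<omega> n \<in> space X" by (rule coord_space[OF w])
    have "(\<lambda>z. ((fst \<omega>)(Suc n := fst z), (snd \<omega>)(Suc n := snd z))) \<in> X \<Otimes>\<^sub>M Y \<rightarrow>\<^sub>M \<Omega>"
      using w by (intro measurable_Pair measurable_fun_upd_UNIV) (auto simp: space_pair_measure)
    from measurable_compose[OF this Suc.prems(1)]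
    have F[measurable]: "(\<lambda>z. f ((fst \<omega>)(Suc n := fst z), (snd \<omega>)(Suc n := snd z))) \<in> borel_measurable (X \<Otimes>\<^sub>M Y)" .
    have F': "(\<lambda>(v, u). lratio n \<omega> * f (upd (Suc n) \<omega> v u)) \<in> borel_measurable (X \<Otimes>\<^sub>M Y)"
      unfolding case_prod_beta by measurable
    have F1: "(\<lambda>v. \<integral>\<^sup>+ u. f (upd (Suc n) \<omega> v u) \<partial>G v) \<in> borel_measurable (M (fst \<omega> n))"
      using S.nn_integral_G_measurable[of "\<lambda>v u. f (upd (Suc n) \<omega> v u)" X "\<lambda>v. v"] F x
      by (simp add: case_prod_beta measurable_cong_sets[OF S.sets_M[OF x] refl])
    have "?k \<omega> * lratio n \<omega> = (\<integral>\<^sup>+ v. lratio n \<omega> * (\<integral>\<^sup>+ u. f (upd (Suc n) \<omega> v u) \<partial>G v) \<partial>M (fst \<omega> n))"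
      using F1 by (subst nn_integral_cmult) (auto simp: mult.commute)
    also have "\<dots> = (\<integral>\<^sup>+ v. \<integral>\<^sup>+ u. lratio n \<omega> * f (upd (Suc n) \<omega> v u) \<partial>G v \<partial>M (fst \<omega> n))"
    proof (rule nn_integral_cong)
      fix v assume "v \<in> space (M (fst \<omega> n))"
      then have v: "v \<in> space X" using x by simp
      have "(\<lambda>u. f (upd (Suc n) \<omega> v u)) \<in> borel_measurable (G v)"
        using measurable_compose[OF measurable_Pair1'[OF v] F] by (simp add: measurable_cong_sets[OF S.sets_G[OF v] refl])
      then show "lratio n \<omega> * (\<integral>\<^sup>+ u. f (upd (Suc n) \<omega> v u) \<partial>G v) =
        (\<integral>\<^sup>+ u. lratio n \<omega> * f (upd (Suc n) \<omega> v u) \<partial>G v)"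
        by (rule nn_integral_cmult[symmetric])
    qed
    also have "\<dots> = (\<integral>\<^sup>+ v. \<integral>\<^sup>+ u. (lratio n \<omega> * f (upd (Suc n) \<omega> v u)) * ennreal (ratio (fst \<omega> n) v u) \<partial>G' v \<partial>M' (fst \<omega> n))"
      by (rule kernel_change[OF x F'])
    also have "\<dots> = (\<integral>\<^sup>+ v. \<integral>\<^sup>+ u. f (upd (Suc n) \<omega> v u) *
      lratio (Suc n) (upd (Suc n) \<omega> v u) \<partial>G' v \<partial>M' (fst \<omega> n))"
      unfolding lratio_upd by (simp only: ac_simps)
    finally show "?k \<omega> * lratio n \<omega> = \<dots>" .
  qed
  also have "\<dots> = (\<integral>\<^sup>+ \<omega>. f \<omega> * lratio (Suc n) \<omega> \<partial>R.law)"
  proof (rule R.law_Suc[symmetric])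
    show "adapted (Suc n) (\<lambda>\<omega>. f \<omega> * lratio (Suc n) \<omega>)"
      using Suc.prems(2) adapted_lratio[of "Suc n"] unfolding adapted_def by metis
  qed measurable
  finally show ?case .
qed

text \<open>Where the likelihood ratio is at most \<open>K\<close> it is replaced by
  \<open>K\<close>; the rest is an event under the target law itself. Transfer thus needs tightness
  of the ratio under that law and no moment.\<close>

lemma change_of_measure_event:
  assumes P[measurable]: "Measurable.pred \<Omega> P" and a: "adapted n P"
  shows "emeasure S.law {\<omega> \<in> space S.law. P \<omega>} \<le>
    emeasure S.law {\<omega> \<in> space S.law. ennreal K < lratio n \<omega>} + ennreal K * emeasure R.law {\<omega> \<in> space R.law. P \<omega>}"
proof -
  define f where "f c \<omega> = (if c \<omega> then 1 else 0 :: ennreal)" for c :: "(nat \<Rightarrow> 'x) \<times> (nat \<Rightarrow> 'y) \<Rightarrow> bool" and \<omega>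
  have em: "emeasure L {\<omega> \<in> space L. c \<omega>} = (\<integral>\<^sup>+ \<omega>. f c \<omega> \<partial>L)"
    if [measurable]: "Measurable.pred L c" for c L
  proof -
    have "emeasure L {\<omega> \<in> space L. c \<omega>} = (\<integral>\<^sup>+ \<omega>. indicator {\<omega> \<in> space L. c \<omega>} \<omega> \<partial>L)"
      by (subst nn_integral_indicator) auto
    also have "\<dots> = (\<integral>\<^sup>+ \<omega>. f c \<omega> \<partial>L)" by (intro nn_integral_cong) (auto simp: f_def indicator_def)
    finally show ?thesis .
  qed
  let ?Q = "\<lambda>\<omega>. ennreal K < lratio n \<omega>"
  have [measurable]: "f c \<in> borel_measurable \<Omega>" if "Measurable.pred \<Omega> c" for c
    using that unfolding f_def[abs_def] by measurable
  have fP: "adapted n (f P)" using a unfolding adapted_def f_def by metis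
  have fQ: "adapted n (f ?Q)" using adapted_lratio[of n] unfolding adapted_def f_def by metis
  have "emeasure S.law {\<omega> \<in> space S.law. P \<omega>} = (\<integral>\<^sup>+ \<omega>. f P \<omega> * lratio n \<omega> \<partial>R.law)"
    by (subst em, measurable, rule change_of_measure[OF _ fP]) measurable
  also have "\<dots> \<le> (\<integral>\<^sup>+ \<omega>. f ?Q \<omega> * lratio n \<omega> + ennreal K * f P \<omega> \<partial>R.law)"
    by (intro nn_integral_mono) (auto simp: f_def not_less intro: order.trans)
  also have "\<dots> = (\<integral>\<^sup>+ \<omega>. f ?Q \<omega> * lratio n \<omega> \<partial>R.law) + ennreal K * (\<integral>\<^sup>+ \<omega>. f P \<omega> \<partial>R.law)"
    by (subst nn_integral_add) (auto simp: nn_integral_cmult)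
  also have "(\<integral>\<^sup>+ \<omega>. f ?Q \<omega> * lratio n \<omega> \<partial>R.law) = emeasure S.law {\<omega> \<in> space S.law. ?Q \<omega>}"
    by (subst em, measurable, rule change_of_measure[OF _ fQ, symmetric]) measurable
  also have "(\<integral>\<^sup>+ \<omega>. f P \<omega> \<partial>R.law) = emeasure R.law {\<omega> \<in> space R.law. P \<omega>}"
    by (subst em) measurable
  finally show ?thesis .
qed

end

text \<open>The embedding \<open>ennreal\<close> sends a real to its positive part, which is
  monotone and subadditive.\<close>

lemma ennreal_add_le: "a \<le> b + c \<Longrightarrow> ennreal a \<le> ennreal b + ennreal c"
proof -
  assume "a \<le> b + c"
  then have "a \<le> max 0 b + max 0 c" by linarith
  then have "ennreal a \<le> ennreal (max 0 b + max 0 c)" by (rule ennreal_leI)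
  also have "\<dots> = ennreal (max 0 b) + ennreal (max 0 c)" by (rule ennreal_plus) auto
  also have "\<dots> = ennreal b + ennreal c" by (simp add: max_def ennreal_neg)
  finally show ?thesis .
qed

lemma emeasure_ge_le:
  assumes f[measurable]: "f \<in> borel_measurable P" and c: "0 < c" and int: "(\<integral>\<^sup>+ x. ennreal (f x) \<partial>P) \<le> ennreal C" and C: "0 \<le> C"
  shows "emeasure P {x \<in> space P. c \<le> f x} \<le> ennreal (C / c)"
proof -
  have "emeasure P {x \<in> space P. c \<le> f x} \<le> emeasure P {x \<in> space P. 1 \<le> ennreal (1 / c) * ennreal (f x)}"
  proof (rule emeasure_mono)
    show "{x \<in> space P. c \<le> f x} \<subseteq> {x \<in> space P. 1 \<le> ennreal (1 / c) * ennreal (f x)}"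
    proof safe
      fix x assume "c \<le> f x"
      then have "ennreal 1 \<le> ennreal ((1 / c) * f x)" using c by (intro ennreal_leI) (simp add: field_simps)
      also have "ennreal ((1 / c) * f x) = ennreal (1 / c) * ennreal (f x)"
        using c \<open>c \<le> f x\<close> by (intro ennreal_mult) auto
      finally show "1 \<le> ennreal (1 / c) * ennreal (f x)" by simp
    qed
  qed measurable
  also have "\<dots> \<le> ennreal (1 / c) * (\<integral>\<^sup>+ x. ennreal (f x) * indicator (space P) x \<partial>P)"
    by (rule nn_integral_Markov_inequality) auto
  also have "(\<integral>\<^sup>+ x. ennreal (f x) * indicator (space P) x \<partial>P) = (\<integral>\<^sup>+ x. ennreal (f x) \<partial>P)"
    by (intro nn_integral_cong) auto
  also have "ennreal (1 / c) * \<dots> \<le> ennreal (1 / c) * ennreal C" by (intro mult_left_mono int) auto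
  also have "\<dots> = ennreal (C / c)" using c C by (simp add: ennreal_mult[symmetric])
  finally show ?thesis .
qed

section \<open>Tails of the likelihood ratio under stationarity\<close>

context hmm_pair
begin

lemma law_stationary:
  assumes st: "stationary X M nu"
  shows "f \<in> borel_measurable X \<Longrightarrow> (\<integral>\<^sup>+ \<omega>. f (fst \<omega> n) \<partial>S.law) = (\<integral>\<^sup>+ x. f x \<partial>nu)"
proof (induction n arbitrary: f)
  case 0
  then show ?case by (rule S.law_initial)
next
  case (Suc n)
  note [measurable] = Suc.prems
  have m: "(\<lambda>x. \<integral>\<^sup>+ v. f v \<partial>M x) \<in> borel_measurable X"
    by (rule S.nn_integral_M_measurable) measurable
  have "(\<integral>\<^sup>+ \<omega>. f (fst \<omega> (Suc n)) \<partial>S.law) = (\<integral>\<^sup>+ \<omega>. \<integral>\<^sup>+ v. \<integral>\<^sup>+ u. f v \<partial>G v \<partial>M (fst \<omega> n) \<partial>S.law)"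
    by (subst S.law_Suc[where n=n]) (auto simp: adapted_def)
  also have "\<dots> = (\<integral>\<^sup>+ \<omega>. \<integral>\<^sup>+ v. f v \<partial>M (fst \<omega> n) \<partial>S.law)"
    using prob_space.emeasure_space_1[OF S.G_prob] coord_space(1) by (intro nn_integral_cong) simp
  also have "\<dots> = (\<integral>\<^sup>+ x. \<integral>\<^sup>+ v. f v \<partial>M x \<partial>nu)" by (rule Suc.IH[OF m])
  also have "\<dots> = (\<integral>\<^sup>+ x. f x \<partial>(nu \<bind> M))"
    by (rule nn_integral_bind[symmetric, where B=X]) auto
  also have "nu \<bind> M = nu" using st by (simp add: stationary_def)
  finally show ?case .
qed

lemma law_stationary_step:
  assumes st: "stationary X M nu" and F[measurable]: "F \<in> borel_measurable (X \<Otimes>\<^sub>M X \<Otimes>\<^sub>M Y)"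
  shows "(\<integral>\<^sup>+ \<omega>. F (fst \<omega> n, fst \<omega> (Suc n), snd \<omega> (Suc n)) \<partial>S.law) = (\<integral>\<^sup>+ x. \<integral>\<^sup>+ v. \<integral>\<^sup>+ u. F (x, v, u) \<partial>G v \<partial>M x \<partial>nu)"
proof -
  have "(\<lambda>z. \<integral>\<^sup>+ u. F (fst z, snd z, u) \<partial>G (snd z)) \<in> borel_measurable (X \<Otimes>\<^sub>M X)"
    by (rule S.nn_integral_G_measurable) (auto simp: case_prod_beta)
  then have m: "(\<lambda>x. \<integral>\<^sup>+ v. \<integral>\<^sup>+ u. F (x, v, u) \<partial>G v \<partial>M x) \<in> borel_measurable X"
    by (intro S.nn_integral_M_measurable) (auto simp: case_prod_beta)
  have "(\<integral>\<^sup>+ \<omega>. F (fst \<omega> n, fst \<omega> (Suc n), snd \<omega> (Suc n)) \<partial>S.law) =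
    (\<integral>\<^sup>+ \<omega>. \<integral>\<^sup>+ v. \<integral>\<^sup>+ u. F (fst \<omega> n, v, u) \<partial>G v \<partial>M (fst \<omega> n) \<partial>S.law)"
    by (subst S.law_Suc[where n=n]) (auto simp: adapted_def)
  also have "\<dots> = (\<integral>\<^sup>+ x. \<integral>\<^sup>+ v. \<integral>\<^sup>+ u. F (x, v, u) \<partial>G v \<partial>M x \<partial>nu)"
    by (rule law_stationary[OF st m])
  finally show ?thesis .
qed

text \<open>Moves the first observation factor of the likelihood ratio to time 1, where a transition
  precedes it and it can be compared with a one-step ratio.\<close>

lemma law_stationary_pair:
  assumes st: "stationary X M nu" and F[measurable]: "F \<in> borel_measurable (X \<Otimes>\<^sub>M Y)"
  shows "(\<integral>\<^sup>+ \<omega>. F (fst \<omega> 0, snd \<omega> 0) \<partial>S.law) = (\<integral>\<^sup>+ \<omega>. F (fst \<omega> 1, snd \<omega> 1) \<partial>S.law)"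
proof -
  obtain x0 y0 where x0: "x0 \<in> space S.PX" and y0: "y0 \<in> space S.PY"
    using S.PX_ne S.PY_ne by blast
  have m: "(\<lambda>x. \<integral>\<^sup>+ u. F (x, u) \<partial>G x) \<in> borel_measurable X"
    by (rule S.nn_integral_G_measurable) (auto simp: case_prod_beta)
  have "(\<integral>\<^sup>+ \<omega>. F (fst \<omega> 0, snd \<omega> 0) \<partial>S.law) = (\<integral>\<^sup>+ v. \<integral>\<^sup>+ u. F (v, u) \<partial>G v \<partial>nu)"
    by (subst S.law_0[OF _ _ x0 y0]) (auto simp: adapted_def)
  also have "\<dots> = (\<integral>\<^sup>+ \<omega>. \<integral>\<^sup>+ u. F (fst \<omega> (Suc 0), u) \<partial>G (fst \<omega> (Suc 0)) \<partial>S.law)"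
    using law_stationary[OF st m, of "Suc 0"] by simp
  also have "\<dots> = (\<integral>\<^sup>+ \<omega>. \<integral>\<^sup>+ v. \<integral>\<^sup>+ u. (\<integral>\<^sup>+ u. F (v, u) \<partial>G v) \<partial>G v \<partial>M (fst \<omega> 0) \<partial>S.law)"
    using measurable_compose[OF coord(1)[of "Suc 0"] m]
    by (subst S.law_Suc[where n=0]) (auto simp: adapted_def)
  also have "\<dots> = (\<integral>\<^sup>+ \<omega>. \<integral>\<^sup>+ v. \<integral>\<^sup>+ u. F (v, u) \<partial>G v \<partial>M (fst \<omega> 0) \<partial>S.law)"
  proof (rule nn_integral_cong, rule nn_integral_cong, goal_cases)
    case (1 \<omega> v)
    then have "v \<in> space X" using coord_space(1)[of \<omega> 0] by simp
    then show ?case using prob_space.emeasure_space_1[OF S.G_prob[of v]] by simp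
  qed
  also have "\<dots> = (\<integral>\<^sup>+ \<omega>. F (fst \<omega> 1, snd \<omega> 1) \<partial>S.law)"
    by (subst S.law_Suc[where n=0]) (auto simp: adapted_def)
  finally show ?thesis .
qed

text \<open>Under one step of the first model, the inverse ratio integrates to the total mass of one
  step of the second; the factors are removed in this way from the last to the first. The result is
  an exponential moment of minus the summed log-ratios that is the same for all
  \<open>n\<close>.\<close>

lemma inverse_ratio_prod:
  "(\<integral>\<^sup>+ \<omega>. (\<Prod>s<n. ennreal (1 / step_ratio s \<omega>)) \<partial>S.law) = 1"
proof (induction n)
  case 0
  show ?case using prob_space.emeasure_space_1[OF S.law_prob] by simp
next
  case (Suc n)
  let ?f = "\<lambda>n \<omega>. \<Prod>s<n. ennreal (1 / step_ratio s \<omega>)"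
  have "(\<integral>\<^sup>+ \<omega>. ?f (Suc n) \<omega> \<partial>S.law) = (\<integral>\<^sup>+ \<omega>. \<integral>\<^sup>+ v. \<integral>\<^sup>+ u. ?f n \<omega> * ennreal (1 / ratio (fst \<omega> n) v u) \<partial>G v \<partial>M (fst \<omega> n) \<partial>S.law)"
  proof (subst S.law_Suc[where n=n])
    show "adapted (Suc n) (?f (Suc n))"
      unfolding adapted_def by (auto intro!: prod.cong arg_cong2[where f="(*)"])
    have "?f (Suc n) (upd (Suc n) \<omega> v u) = ?f n \<omega> * ennreal (1 / ratio (fst \<omega> n) v u)" for \<omega> v u
    proof -
      have "(\<Prod>s<n. ennreal (1 / ratio (((fst \<omega>)(Suc n := v)) s) (((fst \<omega>)(Suc n := v)) (Suc s)) (((snd \<omega>)(Suc n := u)) (Suc s)))) = ?f n \<omega>"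
        by (intro prod.cong) auto
      then show ?thesis by simp
    qed
    then show "(\<integral>\<^sup>+ \<omega>. \<integral>\<^sup>+ v. \<integral>\<^sup>+ u. ?f (Suc n) (upd (Suc n) \<omega> v u) \<partial>G v \<partial>M (fst \<omega> n) \<partial>S.law)
      = (\<integral>\<^sup>+ \<omega>. \<integral>\<^sup>+ v. \<integral>\<^sup>+ u. ?f n \<omega> * ennreal (1 / ratio (fst \<omega> n) v u) \<partial>G v \<partial>M (fst \<omega> n) \<partial>S.law)"
      by (simp only:)
  qed measurable
  also have "\<dots> = (\<integral>\<^sup>+ \<omega>. ?f n \<omega> \<partial>S.law)"
  proof (rule nn_integral_cong)
    fix \<omega> assume "\<omega> \<in> space S.law"
    then have w: "\<omega> \<in> space \<Omega>" by simp
    have x[measurable]: "fst \<omega> n \<in> space X" by (rule coord_space[OF w])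
    have "(\<integral>\<^sup>+ v. \<integral>\<^sup>+ u. ?f n \<omega> * ennreal (1 / ratio (fst \<omega> n) v u) \<partial>G v \<partial>M (fst \<omega> n)) =
      (\<integral>\<^sup>+ v. \<integral>\<^sup>+ u. ?f n \<omega> * ennreal (1 / ratio (fst \<omega> n) v u) * ennreal (ratio (fst \<omega> n) v u) \<partial>G' v \<partial>M' (fst \<omega> n))"
      by (rule kernel_change[OF x]) measurable
    also have "\<dots> = (\<integral>\<^sup>+ v. \<integral>\<^sup>+ u. ?f n \<omega> \<partial>G' v \<partial>M' (fst \<omega> n))"
    proof (intro nn_integral_cong)
      fix v u assume v: "v \<in> space (M' (fst \<omega> n))" and u: "u \<in> space (G' v)"
      have v': "v \<in> space X" using v x by simp
      then have u': "u \<in> space Y" using u by simp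
      have "ennreal (1 / ratio (fst \<omega> n) v u) * ennreal (ratio (fst \<omega> n) v u) = 1"
        using ratio_pos[OF x v' u'] by (simp add: ennreal_mult[symmetric])
      then show "?f n \<omega> * ennreal (1 / ratio (fst \<omega> n) v u) * ennreal (ratio (fst \<omega> n) v u) = ?f n \<omega>"
        by (simp add: mult.assoc)
    qed
    also have "\<dots> = (\<integral>\<^sup>+ v. ?f n \<omega> \<partial>M' (fst \<omega> n))"
      using prob_space.emeasure_space_1[OF R.G_prob] x by (intro nn_integral_cong) simp
    also have "\<dots> = ?f n \<omega>"
      using prob_space.emeasure_space_1[OF R.M_prob[OF x]] by simp
    finally show "(\<integral>\<^sup>+ v. \<integral>\<^sup>+ u. ?f n \<omega> * ennreal (1 / ratio (fst \<omega> n) v u) \<partial>G v \<partial>M (fst \<omega> n)) = ?f n \<omega>" .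
  qed
  also have "\<dots> = 1" by (rule Suc.IH)
  finally show ?case .
qed

text \<open>Multiplying a step ratio by \<open>m' / m\<close> isolates the factor
  \<open>g / g'\<close>. That this multiplier has mean one controls the cost of doing so.\<close>

lemma transition_ratio:
  "(\<integral>\<^sup>+ \<omega>. ennreal (m' (fst \<omega> 0) (fst \<omega> 1) / m (fst \<omega> 0) (fst \<omega> 1)) \<partial>S.law) = 1"
proof -
  note [measurable_cong] = lambda(2)
  have space_lambda: "space lambda = space X" using sets_eq_imp_space_eq[OF lambda(2)] .
  have "(\<integral>\<^sup>+ \<omega>. ennreal (m' (fst \<omega> 0) (fst \<omega> 1) / m (fst \<omega> 0) (fst \<omega> 1)) \<partial>S.law) =
    (\<integral>\<^sup>+ \<omega>. \<integral>\<^sup>+ v. \<integral>\<^sup>+ u. ennreal (m' (fst \<omega> 0) v / m (fst \<omega> 0) v) \<partial>G v \<partial>M (fst \<omega> 0) \<partial>S.law)"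
    by (subst S.law_Suc[where n=0]) (auto simp: adapted_def)
  also have "\<dots> = (\<integral>\<^sup>+ \<omega>. 1 \<partial>S.law)"
  proof (rule nn_integral_cong)
    fix \<omega> assume "\<omega> \<in> space S.law"
    then have x[measurable]: "fst \<omega> 0 \<in> space X" by (intro coord_space(1)) simp
    let ?q = "\<lambda>v. m' (fst \<omega> 0) v / m (fst \<omega> 0) v"
    have "(\<integral>\<^sup>+ v. \<integral>\<^sup>+ u. ennreal (?q v) \<partial>G v \<partial>M (fst \<omega> 0)) =
      (\<integral>\<^sup>+ v. ennreal (?q v) \<partial>M (fst \<omega> 0))"
      using prob_space.emeasure_space_1[OF S.G_prob] x by (intro nn_integral_cong) simp
    also have "\<dots> = (\<integral>\<^sup>+ v. ennreal (m (fst \<omega> 0) v) * ennreal (?q v) \<partial>lambda)"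
      unfolding m_density[OF x] by (rule nn_integral_density) measurable
    also have "\<dots> = (\<integral>\<^sup>+ v. ennreal (m' (fst \<omega> 0) v) * 1 \<partial>lambda)"
    proof (rule nn_integral_cong)
      fix v assume "v \<in> space lambda"
      then have "v \<in> space X" by (simp add: space_lambda)
      from m_pos[OF x this] m'_pos[OF x this]
      show "ennreal (m (fst \<omega> 0) v) * ennreal (?q v) = ennreal (m' (fst \<omega> 0) v) * 1"
        by (simp add: ennreal_mult[symmetric])
    qed
    also have "\<dots> = (\<integral>\<^sup>+ v. 1 \<partial>M' (fst \<omega> 0))"
      unfolding m'_density[OF x] by (rule nn_integral_density[symmetric]) measurable
    also have "\<dots> = 1" using prob_space.emeasure_space_1[OF R.M_prob[OF x]] by simp
    finally show "(\<integral>\<^sup>+ v. \<integral>\<^sup>+ u. ennreal (?q v) \<partial>G v \<partial>M (fst \<omega> 0)) = 1" .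
  qed
  also have "\<dots> = 1" using prob_space.emeasure_space_1[OF S.law_prob] by simp
  finally show ?thesis .
qed

lemma rho_finite: "AE \<omega> in S.law. rho (fst \<omega> 0) \<noteq> \<infinity>"
proof -
  have "(\<integral>\<^sup>+ x. rho x \<partial>mu) = emeasure (density mu rho) (space mu)"
    by (subst emeasure_density) (auto intro!: nn_integral_cong)
  also have "\<dots> = 1" unfolding rho using prob_space.emeasure_space_1[OF S.mu_prob] by simp
  finally have "AE x in mu. rho x \<noteq> \<infinity>" by (intro nn_integral_noteq_infinite) auto
  then have "AE x in density mu rho. rho x \<noteq> \<infinity>" by (subst AE_density) auto
  then have "AE x in nu. rho x \<noteq> \<infinity>" unfolding rho .
  then show ?thesis by (subst S.AE_law_initial) measurable
qed

lemma lratio_finite: "AE \<omega> in S.law. lratio n \<omega> \<noteq> \<infinity>"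
  using rho_finite by eventually_elim (auto simp: lratio_def ennreal_mult_eq_top_iff ennreal_prod_eq_top)

text \<open>The logarithm of the likelihood ratio splits into the initial term, the first observation
  term and the sum of the transition terms; only the last one has an expectation that has to be
  controlled with its sign.\<close>

lemma lratio_tail:
  assumes st: "stationary X M nu" and T: "1 \<le> T" and C: "0 \<le> C" and c: "0 < c"
    and E: "ereal (real T) * ereal_expectation S.law
       (\<lambda>\<omega>. ereal (ln (ratio (fst \<omega> 0) (fst \<omega> 1) (snd \<omega> 1)))) \<le> ereal C"
  shows "emeasure S.law {\<omega> \<in> space S.law. ennreal (exp (3 * c)) < lratio T \<omega>} \<le>
    emeasure S.law {\<omega> \<in> space S.law. ennreal (exp c) < rho (fst \<omega> 0)} + ennreal ((C + 2) / c) + ennreal ((C + 1) / c)"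
proof -
  define lr where "lr s \<omega> = ln (step_ratio s \<omega>)" for s and \<omega> :: "(nat \<Rightarrow> 'x) \<times> (nat \<Rightarrow> 'y)"
  have lr_meas[measurable]: "lr s \<in> borel_measurable \<Omega>" for s unfolding lr_def by measurable
  have pos: "0 < step_ratio s \<omega>" if "\<omega> \<in> space S.law" for s \<omega>
    using that by (intro ratio_pos coord_space) auto
  define P N where "P = (\<integral>\<^sup>+ \<omega>. ennreal (lr 0 \<omega>) \<partial>S.law)" and "N = (\<integral>\<^sup>+ \<omega>. ennreal (- lr 0 \<omega>) \<partial>S.law)"
  \<comment> \<open>From \<open>x \<le> exp x\<close>, with the exponential of minus the sum equal
    to the product of inverse ratios, whose mean is one.\<close>
  have neg: "(\<integral>\<^sup>+ \<omega>. ennreal (- (\<Sum>s<n. lr s \<omega>)) \<partial>S.law) \<le> 1" for n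
  proof -
    have "(\<integral>\<^sup>+ \<omega>. ennreal (- (\<Sum>s<n. lr s \<omega>)) \<partial>S.law) \<le>
      (\<integral>\<^sup>+ \<omega>. (\<Prod>s<n. ennreal (1 / step_ratio s \<omega>)) \<partial>S.law)"
    proof (rule nn_integral_mono)
      fix \<omega> assume w: "\<omega> \<in> space S.law"
      have "- (\<Sum>s<n. lr s \<omega>) \<le> exp (- (\<Sum>s<n. lr s \<omega>))"
        using exp_ge_add_one_self[of "- (\<Sum>s<n. lr s \<omega>)"] by linarith
      also have "\<dots> = (\<Prod>s<n. exp (- lr s \<omega>))"
        by (simp add: exp_sum sum_negf[symmetric])
      also have "\<dots> = (\<Prod>s<n. 1 / step_ratio s \<omega>)"
        using pos[OF w] by (intro prod.cong) (auto simp: lr_def exp_minus inverse_eq_divide)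
      finally have "ennreal (- (\<Sum>s<n. lr s \<omega>)) \<le> ennreal \<dots>" by (rule ennreal_leI)
      also have "\<dots> = (\<Prod>s<n. ennreal (1 / step_ratio s \<omega>))"
        using pos[OF w] by (intro prod_ennreal[symmetric]) (auto intro: less_imp_le)
      finally show "ennreal (- (\<Sum>s<n. lr s \<omega>)) \<le> \<dots>" .
    qed
    then show ?thesis unfolding inverse_ratio_prod .
  qed
  have N1: "N \<le> 1" using neg[of 1] by (simp add: N_def)
  have EPN: "ereal (real T) * (enn2ereal P - enn2ereal N) \<le> ereal C"
    using E by (simp add: ereal_expectation_def P_def N_def lr_def)
  obtain nr where nr: "N = ennreal nr" "0 \<le> nr" "nr \<le> 1"
    using N1 by (cases N) (auto simp: top_unique)
  have "P \<noteq> \<infinity>"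
  proof
    assume "P = \<infinity>"
    then have "ereal (real T) * (enn2ereal P - enn2ereal N) = \<infinity>" using nr T by simp
    then show False using EPN by simp
  qed
  then obtain pr where pr: "P = ennreal pr" "0 \<le> pr" by (cases P) auto
  have int0: "integrable S.law (lr 0)"
    unfolding real_integrable_def using pr nr by (auto simp: P_def N_def)
  define e where "e = (\<integral>\<omega>. lr 0 \<omega> \<partial>S.law)"
  have e: "e = pr - nr"
    unfolding e_def real_lebesgue_integral_def[OF int0] P_def[symmetric] N_def[symmetric] using pr nr by simp
  have Te: "real T * e \<le> C" using EPN pr nr by (simp add: e)
  then have eC: "e \<le> C"
  proof (cases "e \<le> 0")
    case False
    then have "1 * e \<le> real T * e" using T by (intro mult_right_mono) auto
    then show ?thesis using Te by simp
  qed (use C in simp)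
  have prC: "pr \<le> C + 1" using e eC nr by simp
  have nn_st: "(\<integral>\<^sup>+ \<omega>. h (lr s \<omega>) \<partial>S.law) = (\<integral>\<^sup>+ \<omega>. h (lr 0 \<omega>) \<partial>S.law)" if [measurable]: "h \<in> borel_measurable borel" for h s
    using law_stationary_step[OF st, of "\<lambda>(x, v, u). h (ln (ratio x v u))" s]
      law_stationary_step[OF st, of "\<lambda>(x, v, u). h (ln (ratio x v u))" 0]
    by (simp add: lr_def case_prod_beta)
  have nnP: "(\<integral>\<^sup>+ \<omega>. ennreal (lr s \<omega>) \<partial>S.law) = ennreal pr" for s using nn_st[of ennreal s] pr by (simp add: P_def)
  have nnN: "(\<integral>\<^sup>+ \<omega>. ennreal (- lr s \<omega>) \<partial>S.law) = ennreal nr" for s using nn_st[of "\<lambda>x. ennreal (- x)" s] nr by (simp add: N_def)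
  have ints: "integrable S.law (lr s)" for s
    unfolding real_integrable_def using nnP[of s] nnN[of s] by simp
  have Es: "(\<integral>\<omega>. lr s \<omega> \<partial>S.law) = e" for s
    unfolding real_lebesgue_integral_def[OF ints] nnP nnN e using pr nr by simp
  define Su where "Su \<omega> = (\<Sum>s<T. lr s \<omega>)" for \<omega>
  have Su_meas[measurable]: "Su \<in> borel_measurable \<Omega>" unfolding Su_def[abs_def] by measurable
  have intS: "integrable S.law Su" unfolding Su_def[abs_def] using ints by auto
  have ES: "(\<integral>\<omega>. Su \<omega> \<partial>S.law) = real T * e" unfolding Su_def using ints Es by simp
  \<comment> \<open>The mean of the positive part is the signed mean, at most \<open>C\<close>, plus
    the mean of the negative part, at most 1. The decomposition is applied to the whole sum, since
    bounding positive parts term by term could cost a factor \<open>T\<close>.\<close>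
  have SuP: "(\<integral>\<^sup>+ \<omega>. ennreal (Su \<omega>) \<partial>S.law) \<le> ennreal (C + 1)"
  proof -
    have n: "(\<integral>\<^sup>+ \<omega>. ennreal (- Su \<omega>) \<partial>S.law) \<le> 1" unfolding Su_def by (rule neg)
    obtain nr' where nr': "(\<integral>\<^sup>+ \<omega>. ennreal (- Su \<omega>) \<partial>S.law) = ennreal nr'" "0 \<le> nr'" "nr' \<le> 1"
      using n by (cases "\<integral>\<^sup>+ \<omega>. ennreal (- Su \<omega>) \<partial>S.law") (auto simp: top_unique)
    have "(\<integral>\<^sup>+ \<omega>. ennreal (Su \<omega>) \<partial>S.law) \<noteq> \<infinity>" using intS unfolding real_integrable_def by auto
    then obtain pr' where pr': "(\<integral>\<^sup>+ \<omega>. ennreal (Su \<omega>) \<partial>S.law) = ennreal pr'" "0 \<le> pr'"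
      by (cases "\<integral>\<^sup>+ \<omega>. ennreal (Su \<omega>) \<partial>S.law") auto
    have "real T * e = pr' - nr'"
      using ES unfolding real_lebesgue_integral_def[OF intS] pr' nr' using pr' nr' by simp
    then show ?thesis using Te nr' pr' by (simp add: ennreal_leI)
  qed
  define q where "q x y = g x y / g' x y" for x y
  have q_meas[measurable (raw)]: "(\<lambda>a. q (f a) (h a)) \<in> borel_measurable L" if "f \<in> L \<rightarrow>\<^sub>M X" "h \<in> L \<rightarrow>\<^sub>M Y" for f h L
    unfolding q_def using that by (intro borel_measurable_divide S.g_measurable_comp R.g_measurable_comp)
  have q_pos: "0 < q (fst \<omega> s) (snd \<omega> s)" if "\<omega> \<in> space S.law" for \<omega> s
    unfolding q_def using that by (intro divide_pos_pos g_pos g'_pos coord_space) auto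
  \<comment> \<open>After the shift to time 1, \<open>ln q\<close> is the log step ratio plus the
    logarithm of \<open>m' / m\<close>. The positive part of the former has mean at most
    \<open>C + 1\<close>, and the latter is at most \<open>m' / m\<close>, which has mean 1.\<close>
  have qP: "(\<integral>\<^sup>+ \<omega>. ennreal (ln (q (fst \<omega> 0) (snd \<omega> 0))) \<partial>S.law) \<le> ennreal (C + 2)"
  proof -
    have "(\<integral>\<^sup>+ \<omega>. ennreal (ln (q (fst \<omega> 0) (snd \<omega> 0))) \<partial>S.law) = (\<integral>\<^sup>+ \<omega>. ennreal (ln (q (fst \<omega> 1) (snd \<omega> 1))) \<partial>S.law)"
      using law_stationary_pair[OF st, of "\<lambda>z. ennreal (ln (q (fst z) (snd z)))"] by simp
    also have "\<dots> \<le> (\<integral>\<^sup>+ \<omega>. ennreal (lr 0 \<omega>) + ennreal (m' (fst \<omega> 0) (fst \<omega> 1) / m (fst \<omega> 0) (fst \<omega> 1)) \<partial>S.law)"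
    proof (intro nn_integral_mono ennreal_add_le)
      fix \<omega> assume w: "\<omega> \<in> space S.law"
      then have sp: "fst \<omega> i \<in> space X" "snd \<omega> i \<in> space Y" for i by (auto intro!: coord_space)
      define r where "r = m' (fst \<omega> 0) (fst \<omega> 1) / m (fst \<omega> 0) (fst \<omega> 1)"
      have r: "0 < r" unfolding r_def by (intro divide_pos_pos m_pos m'_pos sp)
      have "q (fst \<omega> 1) (snd \<omega> 1) = ratio (fst \<omega> 0) (fst \<omega> 1) (snd \<omega> 1) * r"
        using m_pos[OF sp(1) sp(1), of 0 1] m'_pos[OF sp(1) sp(1), of 0 1] by (simp add: q_def ratio_def r_def)
      then have "ln (q (fst \<omega> 1) (snd \<omega> 1)) = lr 0 \<omega> + ln r"
        using pos[OF w, of 0] r by (simp add: lr_def ln_mult)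
      also have "\<dots> \<le> lr 0 \<omega> + r" using ln_le_minus_one[OF r] by simp
      finally show "ln (q (fst \<omega> 1) (snd \<omega> 1)) \<le> lr 0 \<omega> + m' (fst \<omega> 0) (fst \<omega> 1) / m (fst \<omega> 0) (fst \<omega> 1)"
        by (simp add: r_def)
    qed
    also have "\<dots> = P + 1"
      unfolding P_def by (subst nn_integral_add) (use transition_ratio in \<open>auto\<close>)
    also have "\<dots> \<le> ennreal (C + 2)"
      using pr prC by (simp add: ennreal_leI flip: ennreal_1 ennreal_plus)
    finally show ?thesis .
  qed
  let ?E = "{\<omega> \<in> space S.law. ennreal (exp (3 * c)) < lratio T \<omega>}" and ?R = "{\<omega> \<in> space S.law. ennreal (exp c) < rho (fst \<omega> 0)}"
  let ?Q = "{\<omega> \<in> space S.law. c \<le> ln (q (fst \<omega> 0) (snd \<omega> 0))}" and ?S = "{\<omega> \<in> space S.law. c \<le> Su \<omega>}"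
  \<comment> \<open>\<open>lratio T\<close> is a product of three factors; if each is at most
    \<open>exp c\<close>, the product is at most \<open>exp (3 * c)\<close>.\<close>
  have sub: "?E \<subseteq>
    ?R \<union>
    ?Q \<union> ?S"
  proof (rule subsetI, rule ccontr)
    fix \<omega> assume "\<omega> \<in> ?E"
      and n: "\<omega> \<notin> ?R \<union>
    ?Q \<union> ?S"
    then have w: "\<omega> \<in> space S.law" and gt: "ennreal (exp (3 * c)) < lratio T \<omega>" by auto
    from n w have n1: "rho (fst \<omega> 0) \<le> ennreal (exp c)" and n2: "ln (q (fst \<omega> 0) (snd \<omega> 0)) \<le> c" and n3: "Su \<omega> \<le> c"
      by auto
    have "q (fst \<omega> 0) (snd \<omega> 0) \<le> exp c"
      using n2 q_pos[OF w, of 0] by (metis exp_le_cancel_iff exp_ln)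
    then have 2: "ennreal (g (fst \<omega> 0) (snd \<omega> 0) / g' (fst \<omega> 0) (snd \<omega> 0)) \<le> ennreal (exp c)"
      by (intro ennreal_leI) (simp add: q_def)
    have "(\<Prod>s<T. step_ratio s \<omega>) = exp (Su \<omega>)"
      unfolding Su_def using pos[OF w] by (simp add: exp_sum lr_def)
    then have "(\<Prod>s<T. ennreal (step_ratio s \<omega>)) = ennreal (exp (Su \<omega>))"
      using pos[OF w] by (subst prod_ennreal) (auto intro: less_imp_le)
    then have 3: "(\<Prod>s<T. ennreal (step_ratio s \<omega>)) \<le> ennreal (exp c)"
      using n3 by (simp add: ennreal_leI)
    have "lratio T \<omega> \<le> ennreal (exp c) * ennreal (exp c) * ennreal (exp c)"
      unfolding lratio_def using n1 2 3 by (intro mult_mono) auto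
    also have "\<dots> = ennreal (exp (3 * c))"
      by (simp add: ennreal_mult[symmetric] exp_add[symmetric])
    finally show False using gt by simp
  qed
  have "emeasure S.law ?E \<le> 
    emeasure S.law (?R \<union>
    ?Q \<union> ?S)"
    by (rule emeasure_mono[OF sub]) measurable
  also have "\<dots> \<le> emeasure S.law ?R +
    emeasure S.law ?Q + emeasure S.law ?S"
    by (rule order.trans[OF emeasure_subadditive add_mono[OF emeasure_subadditive order.refl]]) measurable
  also have "\<dots> \<le> emeasure S.law ?R + ennreal ((C + 2) / c) + ennreal ((C + 1) / c)"
    using C by (intro add_mono order.refl emeasure_ge_le c qP SuP) auto
  finally show ?thesis .
qed

end

section \<open>Tightness\<close>

lemma (in hmm_with_proposals) B_const_cong:
  assumes eq: "\<And>i. i \<le> T \<Longrightarrow> y i = y' i" and t: "t \<le> T"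
  shows "B_const X mu M g d0 w t T y = B_const X mu M g d0 w t T y'"
proof -
  have "w_norm X g d0 w t (y t) * Q_norm X M g y (t + 1) l / cond_lik mu M g y t (t + l) =
    w_norm X g d0 w t (y' t) * Q_norm X M g y' (t + 1) l / cond_lik mu M g y' t (t + l)" if l: "l \<in> {0..T - t}" for l
  proof -
    have "lik mu M g y i = lik mu M g y' i" if "i \<le> T" for i
      using that eq by (intro depD[OF dep_lik]) auto
    then have "cond_lik mu M g y t (t + l) = cond_lik mu M g y' t (t + l)"
      using l t by (simp add: cond_lik_def)
    moreover have "Q_norm X M g y (t + 1) l = Q_norm X M g y' (t + 1) l"
      using l t eq by (intro Q_norm_cong) auto
    ultimately show ?thesis using eq t by simp
  qed
  then show ?thesis unfolding B_const_def by (intro SUP_cong) auto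
qed

text \<open>If \<open>mu\<close> charged a set where the density of \<open>nu\<close> vanishes, the
  quotient of densities would be infinite there, and so would the positive part of the mean
  logarithm.\<close>

lemma (in hmm) absolutely_continuous_initial:
  assumes lambda: "sigma_finite_measure lambda" "sets lambda = sets X"
    and ac: "absolutely_continuous lambda mu" "absolutely_continuous lambda nu"
    and nu: "nu \<in> space (prob_algebra X)"
    and fin: "ereal_expectation law (\<lambda>(x, y). ln_ennreal (RN_deriv lambda mu (x 0) / RN_deriv lambda nu (x 0))) < \<infinity>"
  shows "absolutely_continuous nu mu"
proof -
  interpret lambda: sigma_finite_measure lambda by fact
  note [measurable_cong] = lambda(2)
  define h where "h x = RN_deriv lambda mu x / RN_deriv lambda nu x" for x
  have [measurable]: "h \<in> borel_measurable X" unfolding h_def by measurable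
  have [measurable]: "(\<lambda>x. ln_ennreal (h x)) \<in> borel_measurable X"
    unfolding ln_ennreal_def by measurable
  have sets_nu: "sets nu = sets X" using nu by (simp add: space_prob_algebra)
  have dens: "density lambda (RN_deriv lambda mu) = mu" "density lambda (RN_deriv lambda nu) = nu"
    using ac lambda sets_nu by (auto intro!: lambda.density_RN_deriv)
  \<comment> \<open>An infinite positive part makes the difference infinite whatever the negative
    part is, since \<infinity> - \<infinity> = \<infinity> in \<open>ereal\<close>.\<close>
  have "(\<integral>\<^sup>+ \<omega>. e2ennreal (ln_ennreal (h (fst \<omega> 0))) \<partial>law) \<noteq> \<infinity>"
    using fin by (auto simp: ereal_expectation_def h_def case_prod_beta)
  then have "AE \<omega> in law. e2ennreal (ln_ennreal (h (fst \<omega> 0))) \<noteq> \<infinity>"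
    by (intro nn_integral_noteq_infinite) auto
  then have AE_law: "AE \<omega> in law. h (fst \<omega> 0) \<noteq> \<infinity>"
    by eventually_elim (auto simp: ln_ennreal_def)
  then have "AE x in mu. h x \<noteq> \<infinity>"
    by (subst (asm) AE_law_initial) measurable
  then have "AE x in density lambda (RN_deriv lambda mu). h x \<noteq> \<infinity>"
    unfolding dens .
  then have h: "AE x in lambda. 0 < RN_deriv lambda mu x \<longrightarrow> h x \<noteq> \<infinity>"
    by (subst (asm) AE_density) auto
  show ?thesis
    unfolding absolutely_continuous_def
  proof
    fix A assume "A \<in> null_sets nu"
    then have "A \<in> null_sets (density lambda (RN_deriv lambda nu))" unfolding dens .
    then have A: "A \<in> sets lambda" and "AE x in lambda. x \<in> A \<longrightarrow> RN_deriv lambda nu x = 0"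
      by (auto simp: null_sets_density_iff)
    with h have "AE x in lambda. x \<in> A \<longrightarrow> RN_deriv lambda mu x = 0"
      by eventually_elim (auto simp: h_def zero_less_iff_neq_zero)
    with A have "A \<in> null_sets (density lambda (RN_deriv lambda mu))"
      by (auto simp: null_sets_density_iff)
    then show "A \<in> null_sets mu" unfolding dens .
  qed
qed

text \<open>Continuity from above along integer levels: the exceedance events decrease to the null
  event of an infinite value. Used for \<open>rho\<close> and for the likelihood ratios at single
  horizons.\<close>

lemma AE_finite_tail:
  fixes f :: "'a \<Rightarrow> ennreal" and \<delta> :: real
  assumes P: "prob_space P" and f[measurable]: "f \<in> borel_measurable P" and fin: "AE x in P. f x \<noteq> \<infinity>" and \<delta>: "0 < \<delta>"
  shows "\<exists>n::nat. \<forall>c\<ge>real n. emeasure P {x \<in> space P. ennreal c < f x} \<le> ennreal \<delta>"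
proof -
  interpret prob_space P by fact
  let ?A = "\<lambda>n::nat. {x \<in> space P. of_nat n < f x}"
  have "(\<lambda>n. emeasure P (?A n)) \<longlonglongrightarrow> emeasure P (\<Inter>n. ?A n)"
  proof (rule Lim_emeasure_decseq)
    show "decseq ?A"
      unfolding decseq_def by (auto intro: le_less_trans[rotated])
  qed auto
  also have "emeasure P (\<Inter>n. ?A n) = emeasure P {x \<in> space P. f x = \<infinity>}"
  proof (rule arg_cong[where f="emeasure P"])
    have "f x = \<infinity>" if "\<And>n. of_nat n < f x" for x
      using that ennreal_Ex_less_of_nat[of "f x"] by (metis infinity_ennreal_def less_asym' top.not_eq_extremum)
    then show "(\<Inter>n. ?A n) = {x \<in> space P. f x = \<infinity>}" by (auto simp: of_nat_less_top)
  qed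
  also have "\<dots> = 0"
    using fin by (subst (asm) AE_iff_measurable[OF _ refl]) auto
  finally have "eventually (\<lambda>n. emeasure P (?A n) < ennreal \<delta>) sequentially"
    using \<delta> by (intro order_tendstoD) auto
  then obtain n where n: "emeasure P (?A n) < ennreal \<delta>" by (auto simp: eventually_sequentially)
  have "emeasure P {x \<in> space P. ennreal c < f x} \<le> ennreal \<delta>" if "real n \<le> c" for c
  proof -
    have "of_nat n \<le> ennreal c" using that by (simp add: ennreal_of_nat_eq_real_of_nat ennreal_leI)
    then have "emeasure P {x \<in> space P. ennreal c < f x} \<le> emeasure P (?A n)"
      by (intro emeasure_mono) auto
    then show ?thesis using n by simp
  qed
  then show ?thesis by blast
qed

theorem theorem6:
  fixes Theta :: "'p::euclidean_space set"
    and X :: "'x measure" and Y :: "'y measure"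
    and kappa :: "'y measure" and lambda :: "'x measure" and mu :: "'x measure"
    and M :: "'p \<Rightarrow> 'x \<Rightarrow> 'x measure" and G :: "'p \<Rightarrow> 'x \<Rightarrow> 'y measure"
    and m :: "'p \<Rightarrow> 'x \<Rightarrow> 'x \<Rightarrow> real" and g :: "'p \<Rightarrow> 'x \<Rightarrow> 'y \<Rightarrow> real"
    and r0 :: "'p \<Rightarrow> 'y \<Rightarrow> 'x measure" and d0 :: "'p \<Rightarrow> 'y \<Rightarrow> 'x \<Rightarrow> ennreal"
    and R :: "'p \<Rightarrow> 'y \<Rightarrow> 'x \<Rightarrow> 'x measure" and w :: "'p \<Rightarrow> 'y \<Rightarrow> 'x \<Rightarrow> 'x \<Rightarrow> ennreal"
    and \<pi> :: "'p \<Rightarrow> 'x measure"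
    and \<sigma> \<alpha> \<gamma> :: real and lstar :: nat
    and thetastar :: 'p and theta :: "nat \<Rightarrow> 'p" and N :: "nat \<Rightarrow> nat"
  assumes Theta: "compact Theta"
    and model: "\<And>\<theta>. \<theta> \<in> Theta \<Longrightarrow>
          hmm_with_proposals X Y kappa mu (M \<theta>) (G \<theta>) (g \<theta>) (r0 \<theta>) (d0 \<theta>) (R \<theta>) (w \<theta>)"
    and A1_stationary: "\<And>\<theta>. \<theta> \<in> Theta \<Longrightarrow> stationary X (M \<theta>) (\<pi> \<theta>)"
    and A1_unique: "\<And>\<theta> p. \<theta> \<in> Theta \<Longrightarrow> stationary X (M \<theta>) p \<Longrightarrow> p = \<pi> \<theta>"
    and A2_lambda: "sigma_finite_measure lambda" "sets lambda = sets X"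
    and A2_sigma: "0 < \<sigma>"
    and A2_bound: "\<And>\<theta> x A. \<theta> \<in> Theta \<Longrightarrow> x \<in> space X \<Longrightarrow> A \<in> sets X \<Longrightarrow>
          emeasure (M \<theta> x) A \<le> ennreal \<sigma> * emeasure lambda A"
    and A2_m_measurable: "\<And>\<theta>. \<theta> \<in> Theta \<Longrightarrow>
          (\<lambda>(x, x'). m \<theta> x x') \<in> borel_measurable (X \<Otimes>\<^sub>M X)"
    and A2_m_density: "\<And>\<theta> x. \<theta> \<in> Theta \<Longrightarrow> x \<in> space X \<Longrightarrow>
          M \<theta> x = density lambda (\<lambda>x'. ennreal (m \<theta> x x'))"
    and A2_mu: "absolutely_continuous lambda mu"
    and A3_m: "\<And>\<theta> x x'. \<theta> \<in> Theta \<Longrightarrow> x \<in> space X \<Longrightarrow> x' \<in> space X \<Longrightarrow> 0 < m \<theta> x x'"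
    and A3_g: "\<And>\<theta> x y. \<theta> \<in> Theta \<Longrightarrow> x \<in> space X \<Longrightarrow> y \<in> space Y \<Longrightarrow> 0 < g \<theta> x y"
    and A4_lstar: "1 \<le> lstar"
    and A4_alpha: "0 < \<alpha>" "\<alpha> < 1"
    and A4_B: "\<And>l. l \<in> {0..lstar - 1} \<Longrightarrow>
          (SUP t. SUP \<theta>\<in>Theta. \<integral>\<^sup>+ \<omega>. ennreal_powr
              (B_tilde X kappa mu (M \<theta>) (g \<theta>) (d0 \<theta>) (w \<theta>) t l (snd \<omega>)) \<alpha>
            \<partial>hmm_law X Y mu (M \<theta>) (G \<theta>)) < \<infinity>"
    and A4_C:
          "(SUP t. SUP \<theta>\<in>Theta. \<integral>\<^sup>+ \<omega>. ennreal_powr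
              (C_tilde X lambda kappa mu (M \<theta>) (g \<theta>) (d0 \<theta>) (w \<theta>) t lstar (snd \<omega>)) \<alpha>
            \<partial>hmm_law X Y mu (M \<theta>) (G \<theta>)) < \<infinity>"
    and thetastar: "thetastar \<in> Theta"
    and theta: "\<And>T. theta T \<in> Theta"
    and theta_rate:
          "limsup (\<lambda>T. ereal (real T) * ereal_expectation
              (hmm_law X Y (\<pi> thetastar) (M thetastar) (G thetastar))
              (\<lambda>(x, y). ereal (ln
                 ((m thetastar (x 0) (x 1) * g thetastar (x 1) (y 1)) /
                  (m (theta T) (x 0) (x 1) * g (theta T) (x 1) (y 1)))))) < \<infinity>"
    and initial:
          "ereal_expectation (hmm_law X Y (\<pi> thetastar) (M thetastar) (G thetastar))
             (\<lambda>(x, y). ln_ennreal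
                (RN_deriv lambda (\<pi> thetastar) (x 0) / RN_deriv lambda mu (x 0))) < \<infinity>"
    and gamma: "0 < \<gamma>" "\<gamma> < \<alpha>"
    and N_ge_2: "\<And>T. 1 \<le> T \<Longrightarrow> 2 \<le> N T"
    and N_asymp: "(\<lambda>T. real (N T)) \<sim>[at_top] (\<lambda>T. real T powr (1 / \<gamma>))"
  shows "bounded_in_prob (hmm_law X Y (\<pi> thetastar) (M thetastar) (G thetastar)) {1..}
           (\<lambda>T \<omega>. inverse (eps_const X mu (M (theta T)) (g (theta T)) (d0 (theta T)) (w (theta T))
              T (N T) (snd \<omega>)))"
proof -

  \<comment> \<open>Models, absolute continuity and likelihood ratios\<close>
  note ts = model[OF thetastar]
  interpret W: hmm_with_proposals X Y kappa mu "M thetastar" "G thetastar" "g thetastar" "r0 thetastar" "d0 thetastar" "R thetastar" "w thetastar"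
    by (rule ts)
  define nu where "nu = \<pi> thetastar"
  have st: "stationary X (M thetastar) nu" unfolding nu_def by (rule A1_stationary[OF thetastar])
  then have nu: "nu \<in> space (prob_algebra X)" by (simp add: stationary_def)
  interpret S: hmm_density X Y kappa nu "M thetastar" "G thetastar" "g thetastar"
    by (intro hmm_density.intro hmm.intro kappa_measure.intro hmm_density_axioms.intro)
      (fact nu W.kappa_sigma_finite W.sets_kappa W.M W.G W.g_measurable W.g_nonneg W.g_density)+
  \<comment> \<open>By the domination in (A-2), a set that is null for \<lambda> is null for every
    \<open>M thetastar x\<close>, hence for the stationary law, which is a mixture of these.\<close>
  have ac_nu: "absolutely_continuous lambda nu"
    unfolding absolutely_continuous_def
  proof
    fix A assume "A \<in> null_sets lambda"
    then have A: "A \<in> sets X" "emeasure lambda A = 0" using A2_lambda by auto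
    have "emeasure nu A = emeasure (nu \<bind> M thetastar) A" using st by (simp add: stationary_def)
    also have "\<dots> = (\<integral>\<^sup>+ x. emeasure (M thetastar x) A \<partial>nu)"
      using A prob_space.not_empty[OF S.mu_prob] by (intro emeasure_bind[where N=X]) auto
    also have "\<dots> = (\<integral>\<^sup>+ x. 0 \<partial>nu)"
      using A2_bound[OF thetastar _ A(1)] A(2) by (intro nn_integral_cong) simp
    finally show "A \<in> null_sets nu" using A by (auto intro!: null_setsI)
  qed
  \<comment> \<open>Inside \<open>S\<close> the initial law is the stationary one, so the roles of
    the two measures are exchanged: the stationary law is dominated by \<open>mu\<close>.\<close>
  have ac: "absolutely_continuous mu nu"
    by (rule S.absolutely_continuous_initial[OF A2_lambda ac_nu A2_mu W.mu])
      (use initial in \<open>simp add: nu_def\<close>)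
  interpret mu: prob_space mu by (rule W.mu_prob)
  define rho where "rho = RN_deriv mu nu"
  have rho: "rho \<in> borel_measurable X" "density mu rho = nu"
    unfolding rho_def using ac by (auto intro!: mu.density_RN_deriv)
  have pair: "hmm_pair X Y kappa nu (M thetastar) (G thetastar) (g thetastar) mu (M \<theta>) (G \<theta>) (g \<theta>) lambda (m thetastar) (m \<theta>) rho"
    if \<theta>: "\<theta> \<in> Theta" for \<theta>
  proof -
    interpret W': hmm_with_proposals X Y kappa mu "M \<theta>" "G \<theta>" "g \<theta>" "r0 \<theta>" "d0 \<theta>" "R \<theta>" "w \<theta>"
      by (rule model[OF \<theta>])
    show ?thesis
      by (intro hmm_pair.intro hmm_pair_axioms.intro S.hmm_density_axioms W'.hmm_density_axioms
        A2_lambda A2_m_measurable A2_m_density A3_m A3_g \<theta> thetastar rho)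
  qed
  define L where "L T = hmm_pair.lratio (g thetastar) (g (theta T)) (m thetastar) (m (theta T)) rho T" for T

  \<comment> \<open>Uniform tightness of the likelihood ratios\<close>
  let ?tail = "\<lambda>T c. emeasure S.law {\<omega> \<in> space S.law. ennreal c < L T \<omega>}"
  let ?rate = "\<lambda>T. ereal (real T) * ereal_expectation S.law
              (\<lambda>(x, y). ereal (ln
                 ((m thetastar (x 0) (x 1) * g thetastar (x 1) (y 1)) /
                  (m (theta T) (x 0) (x 1) * g (theta T) (x 1) (y 1)))))"
  let ?R = "\<lambda>T. hmm_law X Y mu (M (theta T)) (G (theta T))"
  have lratio_bounded: "\<exists>K\<ge>0. \<forall>T\<ge>1. ?tail T K \<le> ennreal \<delta>"
    if \<delta>: "0 < \<delta>" for \<delta> :: real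
  proof -
    obtain C0 where "limsup (\<lambda>T. ?rate T) < ereal C0"
      using less_PInf_Ex_of_nat[THEN iffD1, OF less_imp_neq[OF theta_rate[folded nu_def]]] by blast
    from Limsup_lessD[OF this] obtain T0 where T0: "\<And>T. T0 \<le> T \<Longrightarrow> ?rate T < ereal C0"
      by (auto simp: eventually_sequentially)
    define C where "C = max C0 0"
    obtain n where n: "\<And>c. real n \<le> c \<Longrightarrow> emeasure S.law {\<omega> \<in> space S.law. ennreal c < rho (fst \<omega> 0)} \<le> ennreal (\<delta> / 3)"
      using AE_finite_tail[OF S.law_prob _ hmm_pair.rho_finite[OF pair[OF thetastar]], of "\<delta> / 3"] rho(1) \<delta> by auto
    \<comment> \<open>The first summand puts \<open>exp c\<close> into the range where the tail of
      \<open>rho\<close> is small; the second makes the two remaining terms of the tail bound at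
      most \<open>\<delta> / 3\<close> each.\<close>
    define c where "c = real n + 3 * (C + 2) / \<delta>"
    have C: "0 \<le> C" by (simp add: C_def)
    have cpos: "0 < c" using \<delta> C unfolding c_def by (intro add_nonneg_pos divide_pos_pos) auto
    have cb: "(C + 2) / c \<le> \<delta> / 3"
    proof -
      have "3 * (C + 2) / \<delta> \<le> c" by (simp add: c_def)
      then show ?thesis using cpos \<delta> by (simp add: field_simps)
    qed
    have cn: "real n \<le> exp c"
    proof -
      have "real n \<le> c" using \<delta> C by (simp add: c_def)
      then show ?thesis using exp_ge_add_one_self[of c] by linarith
    qed
    have large: "?tail T (exp (3 * c)) \<le> ennreal \<delta>" if T: "T0 \<le> T" "1 \<le> T" for T
    proof -
      interpret H: hmm_pair X Y kappa nu "M thetastar" "G thetastar" "g thetastar" mu "M (theta T)" "G (theta T)" "g (theta T)"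
          lambda "m thetastar" "m (theta T)" rho
        by (rule pair[OF theta])
      have "ereal (real T) * ereal_expectation S.law (\<lambda>\<omega>. ereal (ln (H.ratio (fst \<omega> 0) (fst \<omega> 1) (snd \<omega> 1)))) \<le> ereal C"
        using less_imp_le[OF T0[OF T(1)]] unfolding H.ratio_def case_prod_unfold
        by (rule order.trans) (simp add: C_def)
      from H.lratio_tail[OF st T(2) C cpos this]
      have "?tail T (exp (3 * c)) \<le>
        emeasure S.law {\<omega> \<in> space S.law. ennreal (exp c) < rho (fst \<omega> 0)} + ennreal ((C + 2) / c) + ennreal ((C + 1) / c)"
        unfolding L_def .
      also have "\<dots> \<le> ennreal (\<delta> / 3) + ennreal (\<delta> / 3) + ennreal (\<delta> / 3)"
      proof (intro add_mono n cn ennreal_leI cb)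
        have "(C + 1) / c \<le> (C + 2) / c" using cpos by (intro divide_right_mono) auto
        then show "(C + 1) / c \<le> \<delta> / 3" using cb by (rule order.trans)
      qed
      also have "\<dots> = ennreal \<delta>" using \<delta> by (simp flip: ennreal_plus)
      finally show ?thesis .
    qed
    have L_meas[measurable]: "L T \<in> borel_measurable (S.PX \<Otimes>\<^sub>M S.PY)" for T
      unfolding L_def by (rule hmm_pair.lratio_measurable[OF pair[OF theta]])
    have "AE \<omega> in S.law. L T \<omega> \<noteq> \<infinity>" for T
      unfolding L_def by (rule hmm_pair.lratio_finite[OF pair[OF theta]])
    then have "\<exists>k::nat. \<forall>c\<ge>real k. ?tail T c \<le> ennreal \<delta>" for T
      by (intro AE_finite_tail S.law_prob \<delta>) auto
    then have "\<exists>k. \<forall>T. \<forall>c\<ge>real (k T). ?tail T c \<le> ennreal \<delta>"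
      by (intro choice allI)
    then obtain k where k: "\<And>T c. real (k T) \<le> c \<Longrightarrow> ?tail T c \<le> ennreal \<delta>"
      by blast
    \<comment> \<open>The limsup assumption yields a uniform level only from \<open>T0\<close> on.
      Each of the finitely many earlier ratios is finite almost surely and has its own level; the
      sum dominates all of them.\<close>
    define K where "K = exp (3 * c) + (\<Sum>T<T0. real (k T))"
    have "?tail T K \<le> ennreal \<delta>" if "1 \<le> T" for T
    proof (cases "T0 \<le> T")
      case True
      have "ennreal (exp (3 * c)) \<le> ennreal K" unfolding K_def by (intro ennreal_leI) (simp add: sum_nonneg)
      then have "?tail T K \<le> ?tail T (exp (3 * c))"
        by (intro emeasure_mono) (auto intro: le_less_trans)
      then show ?thesis using large[OF True that] by simp
    next
      case False
      then have "real (k T) \<le> (\<Sum>T<T0. real (k T))" by (intro member_le_sum) auto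
      also have "\<dots> \<le> K" by (simp add: K_def)
      finally show ?thesis by (rule k)
    qed
    moreover have "0 \<le> K" unfolding K_def by (intro add_nonneg_nonneg sum_nonneg) auto
    ultimately show ?thesis by blast
  qed

  \<comment> \<open>Tail bounds uniform in parameter, time and horizon\<close>
  let ?EB = "\<lambda>\<theta> t l. \<integral>\<^sup>+ \<omega>. ennreal_powr (B_tilde X kappa mu (M \<theta>) (g \<theta>) (d0 \<theta>) (w \<theta>) t l (snd \<omega>)) \<alpha>
    \<partial>hmm_law X Y mu (M \<theta>) (G \<theta>)"
  let ?EC = "\<lambda>\<theta> t. \<integral>\<^sup>+ \<omega>. ennreal_powr (C_tilde X lambda kappa mu (M \<theta>) (g \<theta>) (d0 \<theta>) (w \<theta>) t lstar (snd \<omega>)) \<alpha>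
    \<partial>hmm_law X Y mu (M \<theta>) (G \<theta>)"
  define BS where "BS l = (SUP t. SUP \<theta>\<in>Theta. ?EB \<theta> t l)" for l
  define CS where "CS = (SUP t. SUP \<theta>\<in>Theta. ?EC \<theta> t)"
  \<comment> \<open>A common bound for all \<open>l < lstar\<close>: each finite supremum is at most
    their sum.\<close>
  define KB where "KB = (\<Sum>l<lstar. enn2real (BS l))"
  define KC where "KC = enn2real CS"
  define K where "K = real lstar * KB + \<sigma> powr \<alpha> * KC"
  have K0: "0 \<le> KB" "0 \<le> KC" "0 \<le> K"
    unfolding KB_def KC_def K_def by (auto intro!: sum_nonneg add_nonneg_nonneg mult_nonneg_nonneg)
  have tail: "emeasure (hmm_law X Y mu (M \<theta>) (G \<theta>)) {\<omega> \<in> space (hmm_law X Y mu (M \<theta>) (G \<theta>)).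
      of_nat k < B_const X mu (M \<theta>) (g \<theta>) (d0 \<theta>) (w \<theta>) t T (snd \<omega>)} \<le> ennreal (K * real k powr - \<alpha>)"
    if \<theta>: "\<theta> \<in> Theta" and k: "1 \<le> k" for \<theta> k t T
  proof -
    interpret W': hmm_with_proposals X Y kappa mu "M \<theta>" "G \<theta>" "g \<theta>" "r0 \<theta>" "d0 \<theta>" "R \<theta>" "w \<theta>"
      by (rule model[OF \<theta>])
    have B: "?EB \<theta> t l \<le> ennreal KB"
      if l: "l < lstar" for l
    proof -
      have "?EB \<theta> t l \<le> BS l"
        unfolding BS_def by (rule SUP_upper2[of t]) (auto intro!: SUP_upper2[OF \<theta>])
      also have "BS l < \<infinity>" unfolding BS_def using l by (intro A4_B) auto
      then have "BS l = ennreal (enn2real (BS l))" by simp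
      also have "\<dots> \<le> ennreal KB"
        unfolding KB_def using l by (intro ennreal_leI member_le_sum) auto
      finally show ?thesis .
    qed
    have C: "?EC \<theta> t \<le> ennreal KC"
    proof -
      have "?EC \<theta> t \<le> CS"
        unfolding CS_def by (rule SUP_upper2[of t]) (auto intro!: SUP_upper2[OF \<theta>])
      also have "CS < \<infinity>" unfolding CS_def by (rule A4_C)
      then have "CS = ennreal KC" by (simp add: KC_def)
      finally show ?thesis .
    qed
    have "emeasure W'.law {\<omega> \<in> space W'.law. ennreal (real k) < B_const X mu (M \<theta>) (g \<theta>) (d0 \<theta>) (w \<theta>) t T (snd \<omega>)}
      \<le> ennreal ((real lstar * KB + \<sigma> powr \<alpha> * KC) * real k powr - \<alpha>)"
      by (rule W'.B_const_tail[OF A3_g[OF \<theta>] A2_lambda A2_sigma A2_bound[OF \<theta>] A4_alpha _ A4_lstar B C K0(1,2)])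
        (use k in auto)
    then show ?thesis by (simp add: K_def ennreal_of_nat_eq_real_of_nat)
  qed
  obtain D0 where D0: "\<And>T. 1 \<le> T \<Longrightarrow> real (Suc T) * real (N T) powr - \<alpha> \<le> D0"
    using growth_bound[OF gamma N_ge_2 N_asymp] by auto
  \<comment> \<open>At level \<open>s * N T\<close>, the tail of a sum of \<open>Suc T\<close> terms
    carries the factor \<open>Suc T\<close> times \<open>N T powr - \<alpha>\<close>, which
    \<open>D0\<close> bounds. \<open>D\<close> is thus the constant left in front of
    \<open>s powr - \<alpha>\<close> for all horizons.\<close>
  define D where "D = (K + 1 + K / (1 - \<alpha>)) * max D0 0"
  have D_nonneg: "0 \<le> D" unfolding D_def using K0 A4_alpha by (intro mult_nonneg_nonneg add_nonneg_nonneg divide_nonneg_nonneg) auto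
  let ?B = "\<lambda>T t (\<omega> :: (nat \<Rightarrow> 'x) \<times> (nat \<Rightarrow> 'y)). B_const X mu (M (theta T)) (g (theta T)) (d0 (theta T)) (w (theta T)) t T (snd \<omega>)"
  let ?Z = "\<lambda>T (\<omega> :: (nat \<Rightarrow> 'x) \<times> (nat \<Rightarrow> 'y)). inverse (eps_const X mu (M (theta T)) (g (theta T)) (d0 (theta T)) (w (theta T)) T (N T) (snd \<omega>))"
  have sum_tail: "emeasure (?R T) {\<omega> \<in> space (?R T).
      of_nat (s * N T) < (\<Sum>t\<in>{0..T}. ?B T t \<omega>)} \<le> ennreal (D * real s powr - \<alpha>)"
    if T: "1 \<le> T" and s: "1 \<le> s" for T s
  proof -
    interpret W': hmm_with_proposals X Y kappa mu "M (theta T)" "G (theta T)" "g (theta T)" "r0 (theta T)" "d0 (theta T)" "R (theta T)" "w (theta T)"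
      by (rule model[OF theta])
    have "emeasure W'.law {\<omega> \<in> space W'.law. of_nat (s * N T) < (\<Sum>t\<in>{0..T}. ?B T t \<omega>)}
      \<le> ennreal (real (card {0..T}) * ((K + 1 + K / (1 - \<alpha>)) * real (s * N T) powr - \<alpha>))"
      using s N_ge_2[OF T] by (intro sum_tail_bound[OF W'.law_prob] tail theta K0 A4_alpha) (auto simp: Suc_le_eq)
    also have "\<dots> \<le> ennreal (D * real s powr - \<alpha>)"
    proof (rule ennreal_leI)
      have "real (card {0..T}) * ((K + 1 + K / (1 - \<alpha>)) * real (s * N T) powr - \<alpha>) =
        (K + 1 + K / (1 - \<alpha>)) * (real (Suc T) * real (N T) powr - \<alpha>) * real s powr - \<alpha>"
        by (simp add: powr_mult)
      also have "\<dots> \<le> (K + 1 + K / (1 - \<alpha>)) * max D0 0 * real s powr - \<alpha>"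
        using K0 A4_alpha D0[OF T] by (intro mult_right_mono mult_left_mono add_nonneg_nonneg divide_nonneg_nonneg) auto
      finally show "real (card {0..T}) * ((K + 1 + K / (1 - \<alpha>)) * real (s * N T) powr - \<alpha>) \<le> D * real s powr - \<alpha>"
        by (simp add: D_def)
    qed
    finally show ?thesis .
  qed

  \<comment> \<open>Transfer to the stationary law\<close>
  have "\<exists>K'::real. \<forall>T\<in>{1..}. measure S.law {\<omega> \<in> space S.law.
      ?Z T \<omega> > ennreal K'} < \<delta>"
    if \<delta>: "0 < \<delta>" for \<delta>
  proof -
    \<comment> \<open>The order of choices matters: the level \<open>K1\<close> of the likelihood
      ratio is fixed first, and then \<open>s\<close> is taken so large that the tail of the sum,
      multiplied by \<open>K1\<close>, stays below \<open>\<delta> / 3\<close>. Both are independent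
      of \<open>T\<close>.\<close>
    obtain K1 where K1: "0 \<le> K1" "\<And>T. 1 \<le> T \<Longrightarrow> ?tail T K1 \<le> ennreal (\<delta> / 3)"
      using lratio_bounded[of "\<delta> / 3"] \<delta> by auto
    have "((\<lambda>s. K1 * (D * real s powr - \<alpha>)) \<longlongrightarrow> K1 * (D * 0)) sequentially"
      using A4_alpha by (intro tendsto_mult tendsto_const tendsto_neg_powr filterlim_real_sequentially) auto
    then have "eventually (\<lambda>s. K1 * (D * real s powr - \<alpha>) < \<delta> / 3) sequentially"
      using \<delta> by (intro order_tendstoD) auto
    then obtain s0 where s0: "\<And>s. s0 \<le> s \<Longrightarrow> K1 * (D * real s powr - \<alpha>) < \<delta> / 3"
      by (auto simp: eventually_sequentially)
    define s where "s = max s0 1"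
    have s: "1 \<le> s" "K1 * (D * real s powr - \<alpha>) < \<delta> / 3" using s0[of s] by (auto simp: s_def)
    have "measure S.law {\<omega> \<in> space S.law. ?Z T \<omega>
       > ennreal (exp (4 * real s))} < \<delta>" if T: "1 \<le> T" for T
    proof -
      interpret W': hmm_with_proposals X Y kappa mu "M (theta T)" "G (theta T)" "g (theta T)" "r0 (theta T)" "d0 (theta T)" "R (theta T)" "w (theta T)"
        by (rule model[OF theta])
      let ?P = "\<lambda>\<omega>. of_nat (s * N T) < (\<Sum>t\<in>{0..T}. ?B T t \<omega>)"
      let ?A = "{\<omega> \<in> space S.law. ?Z T \<omega>
         > ennreal (exp (4 * real s))}"
      have P_meas[measurable]: "Measurable.pred (S.PX \<Otimes>\<^sub>M S.PY) ?P" by measurable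
      have P_adapted: "adapted T ?P"
        unfolding adapted_def
      proof (intro allI impI)
        fix x x' :: "nat \<Rightarrow> 'x" and y y' :: "nat \<Rightarrow> 'y" assume "\<forall>i\<le>T. x i = x' i \<and> y i = y' i"
        then have "(\<Sum>t\<in>{0..T}. ?B T t (x, y)) = (\<Sum>t\<in>{0..T}. ?B T t (x', y'))"
          by (intro sum.cong) (auto intro!: W'.B_const_cong)
        then show "?P (x, y) = ?P (x', y')" by simp
      qed
      have "?A \<subseteq> {\<omega> \<in> space S.law. ?P \<omega>}"
      proof safe
        fix x :: "nat \<Rightarrow> 'x" and y :: "nat \<Rightarrow> 'y"
        assume gt: "?Z T (x, y)
         > ennreal (exp (4 * real s))"
        show "?P (x, y)"
        proof (rule ccontr)
          assume "\<not> ?P (x, y)"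
          then have "(\<Sum>t\<in>{0..T}. ?B T t (x, y)) \<le> ennreal (real s * real (N T))"
            by (simp add: not_less ennreal_of_nat_eq_real_of_nat ennreal_mult)
          from prod_ratio_bound[OF _ N_ge_2[OF T] _ this]
          have "?Z T (x, y)
            \<le> ennreal (exp (4 * real s))" by (simp add: eps_const_def)
          then show False using gt by simp
        qed
      qed
      then have "emeasure S.law ?A \<le> emeasure S.law {\<omega> \<in> space S.law. ?P \<omega>}"
        by (rule emeasure_mono) measurable
      also have "\<dots> \<le> ?tail T K1 + ennreal K1 * emeasure W'.law {\<omega> \<in> space W'.law. ?P \<omega>}"
        unfolding L_def by (rule hmm_pair.change_of_measure_event[OF pair[OF theta] P_meas P_adapted])
      also have "\<dots> \<le> ennreal (\<delta> / 3) + ennreal K1 * ennreal (D * real s powr - \<alpha>)"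
        by (intro add_mono mult_left_mono K1 T sum_tail s) auto
      also have "\<dots> \<le> ennreal (\<delta> / 3) + ennreal (\<delta> / 3)"
        using K1 s D_nonneg by (intro add_left_mono) (auto simp: ennreal_mult[symmetric] intro!: ennreal_leI)
      \<comment> \<open>Two thirds of \<delta> leave room for the strict inequality in
        \<open>bounded_in_prob\<close>.\<close>
      also have "\<dots> = ennreal (2 * \<delta> / 3)" using \<delta> by (simp flip: ennreal_plus)
      finally have "measure S.law ?A \<le> 2 * \<delta> / 3"
        using \<delta> unfolding measure_def by (intro enn2real_leI) auto
      then show ?thesis using \<delta> by simp
    qed
    then show ?thesis by (intro exI[of _ "exp (4 * real s)"]) auto
  qed
  then show ?thesis unfolding bounded_in_prob_def nu_def by blast
qed

end
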